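(* Let $n\ge 0$, $C_0,\ldots,C_n\in\mathcal{P}(\mathbb{R}^d)$, $\mathcal{M}_0,\ldots,\mathcal{M}_n\in\hat{\mathscr{B}}(\mathbb{R}^d,\mathbb{R}^d)$ such that $\mathcal{M}_i\subseteq\mathrm{BL}(C_i)$ for all $0\leq i\leq n$, and let $T_0,\ldots,T_n\in\mathrm{GL}_d$ and $k>0$ (an integer, $k\le d$). Then for $Q_0,\ldots,Q_n\in O(d)$ independent and uniformly at random, $$\mathbb{E}\bigg[ \Theta_k\bigg( \bigcap_{i=0}^n T_i Q_i C_i ,\ \bigwedge_{i=0}^n T_i Q_i \mathcal{M}_i \bigg)\bigg] = \Theta_{nd+k}(C,\mathcal{M}) ,$$ where $C:=C_0\times\cdots\times C_n$ and $\mathcal{M}:=\mathcal{M}_0\,\hat\times \cdots\hat\times\, \mathcal{M}_n$. The support measures of the product are given by $$\Theta_m(C,\mathcal{M}) = \sum_{i_0+\cdots+i_n=m} \Theta_{i_0}(C_0,\mathcal{M}_0)\cdots \Theta_{i_n}(C_n,\mathcal{M}_n) .$$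
   Context: A polyhedral cone in $\mathbb{R}^d$ is a set of the form $\{x\in\mathbb{R}^d : Ax\le 0\}$ for some real matrix $A$ with $d$ columns; $\mathcal{P}(\mathbb{R}^d)$ is the set of polyhedral cones in $\mathbb{R}^d$. The polar cone is $C^\circ=\{z: \langle x,z\rangle\le 0 \text{ for all } x\in C\}$. A face of $C$ is a subset $\{x\in C: \langle x,z\rangle=0\}$ with $z\in C^\circ$. $\mathcal{L}_k(C)$ is the finite set of linear spans of faces of $C$ whose span has dimension $k$. The $k$-skeleton is $S_k(C)=\bigcup_{L\in\mathcal{L}_k(C)}\mathrm{int}_L(C\cap L)$, where $\mathrm{int}_L$ is the interior relative to $L$. $\Pi_C$ is the orthogonal (nearest point) projection onto $C$. The biconic $\sigma$-algebra $\hat{\mathscr{B}}(\mathbb{R}^d,\mathbb{R}^d)$ consists of the Borel sets $\mathcal{M}\subseteq\mathbb{R}^d\times\mathbb{R}^d$ with $\{(\lambda x,\lambda' x'):(x,x')\in\mathcal{M}\}=\mathcal{M}$ for all $\lambda,\lambda'>0$. The biconic lift of $C$ is $\mathrm{BL}(C)=\{(x,z)\in C\times C^\circ:\langle x,z\rangle=0\}$. For $T\in\mathrm{GL}_d$, $T\mathcal{M}:=\{(Tx,(T^{-1})^{\mathsf T}x'):(x,x')\in\mathcal{M}\}$. The biconic product of $\mathcal{M}\in\hat{\mathscr{B}}(\mathbb{R}^d,\mathbb{R}^d)$ and $\mathcal{N}\in\hat{\mathscr{B}}(\mathbb{R}^e,\mathbb{R}^e)$ is $\mathcal{M}\,\hat\times\,\mathcal{N}=\{(x,y,x',y'):(x,x')\in\mathcal{M},(y,y')\in\mathcal{N}\}\in\hat{\mathscr{B}}(\mathbb{R}^{d+e},\mathbb{R}^{d+e})$,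 iterated for several factors. The conjunction is $\mathcal{M}\wedge\mathcal{N}=\{(x,x'+y'):(x,x')\in\mathcal{M},(x,y')\in\mathcal{N}\}$, iterated for several sets. The support measures of $C\in\mathcal{P}(\mathbb{R}^d)$ are $\Theta_k(C,\mathcal{M})=\mathbb{P}\{\Pi_C(g)\in S_k(C)\text{ and }(\Pi_C(g),\Pi_{C^\circ}(g))\in\mathcal{M}\}$, with $g\in\mathbb{R}^d$ standard Gaussian, $0\le k\le d$ (and analogously in $\mathbb{R}^{(n+1)d}$ for the product cone). If a conjunction of Borel sets is not Borel, its measure is understood with respect to the completion. "Uniformly at random" in $O(d)$ means distributed according to the normalized Haar measure. *)

theory Defs
  imports "HOL-Probability.Probability"
begin

text \<open>The \<open>i\<close>-th row of the matrix is \<open>A i\<close>, for \<open>i < m\<close>; the notions in this theory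
  are stated for an arbitrary Euclidean space so that they apply both to \<open>real^'d\<close> and to
  the product space \<open>(real^'d)^'n\<close>.\<close>

definition polyhedral_cone :: "'a::euclidean_space set \<Rightarrow> bool" where
  "polyhedral_cone C \<longleftrightarrow> (\<exists>(m::nat) A :: nat \<Rightarrow> 'a. C = {x. \<forall>i<m. A i \<bullet> x \<le> 0})"

definition polar_cone :: "'a::euclidean_space set \<Rightarrow> 'a set" where
  "polar_cone C = {z. \<forall>x\<in>C. x \<bullet> z \<le> 0}"

definition cone_faces :: "'a::euclidean_space set \<Rightarrow> 'a set set" where
  "cone_faces C = {{x \<in> C. x \<bullet> z = 0} | z. z \<in> polar_cone C}"

definition face_spans :: "nat \<Rightarrow> 'a::euclidean_space set \<Rightarrow> 'a set set" where
  "face_spans k C = {span F | F. F \<in> cone_faces C \<and> dim (span F) = k}"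

definition skeleton :: "nat \<Rightarrow> 'a::euclidean_space set \<Rightarrow> 'a set" where
  "skeleton k C = (\<Union>L\<in>face_spans k C. top_of_set L interior_of (C \<inter> L))"

definition biconic_sets :: "('a::euclidean_space \<times> 'a) set set" where
  "biconic_sets = {M \<in> sets borel.
     \<forall>s>0. \<forall>t>0. (\<lambda>(x, x'). (s *\<^sub>R x, t *\<^sub>R x')) ` M = M}"

definition biconic_lift :: "'a::euclidean_space set \<Rightarrow> ('a \<times> 'a) set" where
  "biconic_lift C = {(x, z). x \<in> C \<and> z \<in> polar_cone C \<and> x \<bullet> z = 0}"

definition cone_image :: "real^'d^'d \<Rightarrow> (real^'d) set \<Rightarrow> (real^'d) set" where
  "cone_image T C = (\<lambda>x. T *v x) ` C"

definition biconic_image ::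
  "real^'d^'d \<Rightarrow> ((real^'d) \<times> (real^'d)) set \<Rightarrow> ((real^'d) \<times> (real^'d)) set" where
  "biconic_image T M = (\<lambda>(x, x'). (T *v x, transpose (matrix_inv T) *v x')) ` M"

text \<open>The finite index type \<open>'n\<close> plays the role of \<open>{0, \<dots>, n}\<close>, so \<open>(real^'d)^'n\<close> is the
  product of \<open>n + 1\<close> copies of \<open>real^'d\<close> and its inner product is the sum of those of
  the factors.\<close>

definition cone_product :: "('n::finite \<Rightarrow> (real^'d) set) \<Rightarrow> (real^'d^'n) set" where
  "cone_product C = {x. \<forall>i. x $ i \<in> C i}"

definition biconic_product ::
  "('n::finite \<Rightarrow> ((real^'d) \<times> (real^'d)) set) \<Rightarrow> ((real^'d^'n) \<times> (real^'d^'n)) set" where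
  "biconic_product M = {(x, x'). \<forall>i. (x $ i, x' $ i) \<in> M i}"

text \<open>The conjunction of all \<open>M i\<close>: iterating the binary conjunction keeps the common first
  component and adds up the second components.\<close>

definition conjunction ::
  "('n::finite \<Rightarrow> ('a::euclidean_space \<times> 'a) set) \<Rightarrow> ('a \<times> 'a) set" where
  "conjunction M = {(x, \<Sum>i\<in>UNIV. y i) | x y. \<forall>i. (x, y i) \<in> M i}"

definition std_gaussian :: "'a::euclidean_space measure" where
  "std_gaussian = density lborel
     (\<lambda>x. ennreal (exp (- (norm x)\<^sup>2 / 2) / sqrt (2 * pi) ^ DIM('a)))"

text \<open>The Gaussian measure is completed because a conjunction of Borel sets, being a linear image
  of a Borel set, need not be Borel.\<close>

definition support_measure ::
  "nat \<Rightarrow> 'a::euclidean_space set \<Rightarrow> ('a \<times> 'a) set \<Rightarrow> real" where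
  "support_measure k C M = measure (completion std_gaussian)
     {g. closest_point C g \<in> skeleton k C \<and>
         (closest_point C g, closest_point (polar_cone C) g) \<in> M}"

definition orthogonal_borel :: "(real^'d^'d) measure" where
  "orthogonal_borel = restrict_space borel {Q. orthogonal_matrix Q}"

text \<open>Left invariance suffices: on a compact group it forces right invariance and uniqueness.\<close>

definition normalized_haar :: "(real^'d^'d) measure \<Rightarrow> bool" where
  "normalized_haar \<mu> \<longleftrightarrow> prob_space \<mu> \<and> sets \<mu> = sets orthogonal_borel \<and>
     (\<forall>R. orthogonal_matrix R \<longrightarrow> distr \<mu> \<mu> (\<lambda>Q. R ** Q) = \<mu>)"

end

theory Submission
  imports Defs
begin

text \<open>Write \<open>\<Theta>\<^sub>k(C, M)\<close> for the support measure. A polyhedral cone \<open>C\<close> is the disjoint union of the relative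
  interiors of its faces, and by the Moreau decomposition every point is uniquely \<open>x + z\<close> with \<open>x \<in> C\<close>
  and \<open>z\<close> in the normal cone at \<open>x\<close>. If \<open>L\<close> is the span of the smallest face containing \<open>x\<close>, then
  \<open>x \<in> L\<close> and \<open>z \<in> L\<^sup>\<bottom>\<close>. So, for \<open>M\<close> contained in the biconic lift, \<open>\<Theta>\<^sub>k(C, M)\<close> is a sum over the \<open>k\<close>-dimensional face spans \<open>L\<close>, and the summand of
  \<open>L\<close> is the Gaussian measure of the sums \<open>x + z\<close> of the pairs in a biconic subset of \<open>L \<times> L\<^sup>\<bottom>\<close>
  (\<open>support_measure_eq_sum_faces\<close>). The faces of a product cone are the products of faces, and the
  components of a Gaussian vector are independent; this gives the formula for the support measures
  of the product (\<open>support_measure_product\<close>).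

  A point of \<open>\<Inter>i. T\<^sub>i Q\<^sub>i C\<^sub>i\<close> determines a tuple of face spans \<open>L\<^sub>i\<close> of the \<open>C\<^sub>i\<close>, and the span of its face
  in the intersection is \<open>\<Inter>i. T\<^sub>i Q\<^sub>i L\<^sub>i\<close>. Almost surely the rotated subspaces are in general position: either they
  meet only in \<open>0\<close>, or the orthogonal complements of the \<open>T\<^sub>i Q\<^sub>i L\<^sub>i\<close> are linearly independent
  (\<open>AE_transversal\<close>, \<open>AE_dim_Inter\<close>). Since \<open>k > 0\<close>, the tuples that contribute to
  the left-hand side are then those with \<open>dim L\<^sub>0 + \<dots> + dim L\<^sub>n = n d + k\<close>. The same tuples contribute to
  \<open>\<Theta>\<close> of the product in degree \<open>n d + k\<close>, so the two contributions can be compared for each tuple separately.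

  For a single tuple in general position, every \<open>g\<close> is uniquely \<open>x + \<Sum>i. y\<^sub>i\<close> with \<open>x = T\<^sub>i Q\<^sub>i a\<^sub>i\<close>, \<open>a\<^sub>i \<in> L\<^sub>i\<close>, for
  all \<open>i\<close>, and with \<open>y\<^sub>i\<close> the image of some \<open>b\<^sub>i \<in> L\<^sub>i\<^sup>\<bottom>\<close> under the inverse transpose of \<open>T\<^sub>i Q\<^sub>i\<close>. As \<open>M\<^sub>i\<close> is
  biconic, only the directions of \<open>a\<^sub>i\<close> and \<open>b\<^sub>i\<close> matter. Replacing \<open>Q\<^sub>i\<close> by \<open>Q\<^sub>i R\<^sub>i\<close> with \<open>R\<^sub>i\<close> orthogonal and
  \<open>R\<^sub>i L\<^sub>i = L\<^sub>i\<close> changes neither the law of \<open>(Q, g)\<close> nor \<open>x\<close> and \<open>y\<^sub>i\<close>, but it rotates \<open>a\<^sub>i\<close> and \<open>b\<^sub>i\<close> by the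
  inverse of \<open>R\<^sub>i\<close> (\<open>solution_law\<close>). So the joint law of all directions is invariant under a
  group of isometries that acts transitively on a product of spheres. Such a law gives the same mass to all balls
  of the same radius, and there is only one probability measure with this property
  (\<open>uniformly_distributed_unique\<close>, \<open>invariant_law_biconic_eq\<close>). The directions of the orthogonal projections
  of independent Gaussian vectors \<open>g\<^sub>i\<close> to \<open>L\<^sub>i\<close> and \<open>L\<^sub>i\<^sup>\<bottom>\<close> also have such a law, and the corresponding probability
  is the contribution of the tuple to the product (\<open>kinematic_formula_subspaces\<close>).\<close>

section \<open>Measures determined by the measures of balls\<close>

text \<open>If one ball of radius \<open>r\<close> centred in \<open>X\<close> is null, then all of them are; by the Lindelof property
  countably many of them cover \<open>X\<close>, which has full measure.\<close>
lemma uniformly_distributed_ball_pos: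
  fixes \<mu> :: "'a::{metric_space, second_countable_topology} measure"
  assumes "prob_space \<mu>" and S: "sets \<mu> = sets borel" and AE: "AE x in \<mu>. x \<in> X"
    and unif: "\<And>x y r. x \<in> X \<Longrightarrow> y \<in> X \<Longrightarrow> emeasure \<mu> (ball x r) = emeasure \<mu> (ball y r)"
    and "x \<in> X" "0 < r"
  shows "0 < emeasure \<mu> (ball x r)"
proof (rule ccontr)
  interpret prob_space \<mu> by fact
  assume "\<not> ?thesis"
  then have null: "emeasure \<mu> (ball y r) = 0" if "y \<in> X" for y
    using unif[OF \<open>x \<in> X\<close> that] by (simp add: not_less)
  obtain F where F: "F \<subseteq> (\<lambda>y. ball y r) ` X" "countable F" "\<Union>F = \<Union>((\<lambda>y. ball y r) ` X)"
    by (rule Lindelof[of "(\<lambda>y. ball y r) ` X"]) auto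
  have "\<Union>F \<in> null_sets \<mu>"
  proof -
    have "(\<Union>A\<in>F. A) \<in> null_sets \<mu>"
    proof (rule null_sets_UN'[OF F(2)])
    fix A assume "A \<in> F"
    then obtain y where "y \<in> X" "A = ball y r" using F(1) by auto
    then show "A \<in> null_sets \<mu>" using null[of y] by (auto simp: null_sets_def S)
    qed
    then show ?thesis by simp
  qed
  then have "AE z in \<mu>. z \<notin> \<Union>F" by (rule AE_not_in)
  with AE have "AE z in \<mu>. False"
    by eventually_elim (use F(3) \<open>0 < r\<close> in auto)
  then show False by simp
qed

text \<open>Both sides are the product measure of the set of pairs in \<open>V \<times> V\<close> at distance less than \<open>r\<close>.\<close>
lemma indicator_ball_fubini:
  fixes \<mu> \<nu> :: "'a::{metric_space, second_countable_topology} measure"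
  assumes \<mu>: "sigma_finite_measure \<mu>" "sets \<mu> = sets borel"
    and \<nu>: "sigma_finite_measure \<nu>" "sets \<nu> = sets borel"
    and "open V"
  shows "(\<integral>\<^sup>+x. indicator V x * emeasure \<mu> (ball x r \<inter> V) \<partial>\<nu>) =
        (\<integral>\<^sup>+y. indicator V y * emeasure \<nu> (ball y r \<inter> V) \<partial>\<mu>)"
proof -
  interpret \<mu>: sigma_finite_measure \<mu> by fact
  interpret \<nu>: sigma_finite_measure \<nu> by fact
  interpret pair_sigma_finite \<mu> \<nu> ..
  note [measurable_cong] = \<open>sets \<mu> = sets borel\<close> \<open>sets \<nu> = sets borel\<close>
  have [measurable]: "V \<in> sets borel" using \<open>open V\<close> by simp
  have eq: "indicator V x * emeasure M (ball x r \<inter> V)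
      = (\<integral>\<^sup>+y. indicator V x * (indicator V y * (if dist x y < r then 1 else 0)) \<partial>M)"
    if [measurable_cong]: "sets M = sets borel" for M :: "'a measure" and x
  proof -
    have "emeasure M (ball x r \<inter> V) = (\<integral>\<^sup>+y. indicator (ball x r \<inter> V) y \<partial>M)"
      using that by (simp add: \<open>open V\<close>)
    also have "\<dots> = (\<integral>\<^sup>+y. indicator V y * (if dist x y < r then 1 else 0) \<partial>M)"
      by (intro nn_integral_cong) (auto simp: indicator_def)
    finally show ?thesis
      by (simp add: nn_integral_cmult)
  qed
  have "(\<integral>\<^sup>+x. indicator V x * emeasure \<mu> (ball x r \<inter> V) \<partial>\<nu>)
    = (\<integral>\<^sup>+x. (\<integral>\<^sup>+y. indicator V x * (indicator V y * (if dist x y < r then 1 else 0)) \<partial>\<mu>) \<partial>\<nu>)"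
    by (simp add: eq[OF \<mu>(2)])
  also have "\<dots> = (\<integral>\<^sup>+y. (\<integral>\<^sup>+x. indicator V x * (indicator V y * (if dist x y < r then 1 else 0)) \<partial>\<nu>) \<partial>\<mu>)"
    by (rule Fubini') measurable
  also have "\<dots> = (\<integral>\<^sup>+y. indicator V y * emeasure \<nu> (ball y r \<inter> V) \<partial>\<mu>)"
    unfolding eq[OF \<nu>(2)] by (intro nn_integral_cong) (auto simp: indicator_def dist_commute)
  finally show ?thesis .
qed

text \<open>For \<open>x \<in> U\<close> the fraction of the ball around \<open>x\<close> that lies in \<open>U\<close> is eventually \<open>1\<close> as the radius
  tends to \<open>0\<close>. By the previous lemma the integral of this fraction over \<open>U\<close> with respect to \<open>\<nu>\<close> is at most
  the \<open>\<mu>\<close>-measure of \<open>U\<close>, so Fatou's lemma applies. The argument goes back to Christensen.\<close>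
lemma ball_measures_le_on_open:
  fixes \<mu> \<nu> :: "'a::{metric_space, second_countable_topology} measure"
  assumes \<mu>: "sigma_finite_measure \<mu>" "sets \<mu> = sets borel" "AE x in \<mu>. x \<in> X"
    and \<nu>: "sigma_finite_measure \<nu>" "sets \<nu> = sets borel" "AE x in \<nu>. x \<in> X"
    and h: "\<And>x r. x \<in> X \<Longrightarrow> emeasure \<mu> (ball x r) = h r"
    and k: "\<And>x r. x \<in> X \<Longrightarrow> emeasure \<nu> (ball x r) = h r"
    and h_pos: "\<And>r. 0 < r \<Longrightarrow> 0 < h r" and h_fin: "\<And>r. h r \<noteq> top"
    and "open U"
  shows "emeasure \<nu> U \<le> emeasure \<mu> U"
proof -
  interpret \<mu>: sigma_finite_measure \<mu> by fact
  interpret \<nu>: sigma_finite_measure \<nu> by fact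
  interpret pair_sigma_finite \<mu> \<nu> ..
  note [measurable_cong] = \<open>sets \<mu> = sets borel\<close> \<open>sets \<nu> = sets borel\<close>
  have [measurable]: "U \<in> sets borel" using \<open>open U\<close> by simp
  note fubini = indicator_ball_fubini[OF \<mu>(1,2) \<nu>(1,2)]
  define r where "r n = inverse (real (Suc n))" for n
  have r: "0 < r n" for n by (simp add: r_def)
  define f where "f n x = indicator U x * emeasure \<mu> (ball x (r n) \<inter> U) / h (r n)" for n x
  have fn: "(\<lambda>x. indicator U x * emeasure \<mu> (ball x (r n) \<inter> U)) \<in> borel_measurable \<nu>" for n
  proof -
    have "(\<lambda>x. \<integral>\<^sup>+y. indicator U x * (indicator U y * (if dist x y < r n then 1 else 0)) \<partial>\<mu>) \<in> borel_measurable \<nu>"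
      by measurable
    also have "(\<lambda>x. \<integral>\<^sup>+y. indicator U x * (indicator U y * (if dist x y < r n then 1 else 0)) \<partial>\<mu>)
      = (\<lambda>x. indicator U x * emeasure \<mu> (ball x (r n) \<inter> U))"
    proof
      fix x
      have "(\<integral>\<^sup>+y. indicator U x * (indicator U y * (if dist x y < r n then 1 else 0)) \<partial>\<mu>)
         = indicator U x * (\<integral>\<^sup>+y. indicator (ball x (r n) \<inter> U) y \<partial>\<mu>)"
        by (subst nn_integral_cmult[symmetric]) (measurable, auto intro!: nn_integral_cong simp: indicator_def)
      then show "(\<integral>\<^sup>+y. indicator U x * (indicator U y * (if dist x y < r n then 1 else 0)) \<partial>\<mu>)
         = indicator U x * emeasure \<mu> (ball x (r n) \<inter> U)"
        by (simp add: \<mu>(2) \<open>open U\<close>)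
    qed
    finally show ?thesis .
  qed
  have f_int: "(\<integral>\<^sup>+x. f n x \<partial>\<nu>) \<le> emeasure \<mu> U" for n
  proof -
    have "(\<integral>\<^sup>+x. f n x \<partial>\<nu>) = (\<integral>\<^sup>+x. indicator U x * emeasure \<mu> (ball x (r n) \<inter> U) \<partial>\<nu>) / h (r n)"
      unfolding f_def by (rule nn_integral_divide[OF fn])
    also have "\<dots> = (\<integral>\<^sup>+y. indicator U y * emeasure \<nu> (ball y (r n) \<inter> U) \<partial>\<mu>) / h (r n)"
      by (simp add: fubini \<open>open U\<close>)
    also have "\<dots> \<le> (\<integral>\<^sup>+y. h (r n) * indicator U y \<partial>\<mu>) / h (r n)"
    proof (intro divide_right_mono_ennreal nn_integral_mono_AE)
      show "AE y in \<mu>. indicator U y * emeasure \<nu> (ball y (r n) \<inter> U) \<le> h (r n) * indicator U y"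
        using \<mu>(3)
      proof eventually_elim
        case (elim y)
        have "emeasure \<nu> (ball y (r n) \<inter> U) \<le> emeasure \<nu> (ball y (r n))"
          by (rule emeasure_mono) (auto simp: \<nu>(2))
        then show ?case using k[OF elim, of "r n"] by (auto simp: indicator_def)
      qed
    qed
    also have "\<dots> = h (r n) * emeasure \<mu> U / h (r n)"
      by (subst nn_integral_cmult_indicator) (auto simp: \<mu>(2) \<open>open U\<close>)
    also have "\<dots> = emeasure \<mu> U"
      using h_pos[OF r[of n]] h_fin by (simp add: mult.commute ennreal_mult_divide_eq)
    finally show ?thesis .
  qed
  have "emeasure \<nu> U = (\<integral>\<^sup>+x. indicator U x \<partial>\<nu>)" by (simp add: \<nu>(2) \<open>open U\<close>)
  also have "\<dots> \<le> (\<integral>\<^sup>+x. liminf (\<lambda>n. f n x) \<partial>\<nu>)"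
  proof (intro nn_integral_mono_AE)
    show "AE x in \<nu>. indicator U x \<le> liminf (\<lambda>n. f n x)"
      using \<nu>(3)
    proof eventually_elim
      case (elim x)
      show ?case
      proof (cases "x \<in> U")
        case True
        then obtain e where e: "e > 0" "ball x e \<subseteq> U" using \<open>open U\<close> by (auto simp: open_contains_ball)
        have "eventually (\<lambda>n. r n < e) sequentially"
          unfolding r_def using LIMSEQ_inverse_real_of_nat \<open>e > 0\<close> by (rule order_tendstoD(2))
        then have "eventually (\<lambda>n. (1::ennreal) \<le> f n x) sequentially"
        proof eventually_elim
          case (elim n)
          then have "ball x (r n) \<inter> U = ball x (r n)" using e(2) by auto
          then have "f n x = h (r n) / h (r n)" using \<open>x \<in> U\<close> h[OF \<open>x \<in> X\<close>] by (simp add: f_def)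
          also have "\<dots> = 1" using h_pos[OF r[of n]] h_fin[of "r n"]
            by (metis ennreal_divide_self not_less_zero top.not_eq_extremum)
          finally show ?case by simp
        qed
        then have "1 \<le> liminf (\<lambda>n. f n x)" by (rule Liminf_bounded)
        then show ?thesis using True by simp
      qed simp
    qed
  qed
  also have "\<dots> \<le> liminf (\<lambda>n. \<integral>\<^sup>+x. f n x \<partial>\<nu>)"
    by (rule nn_integral_liminf) (auto simp: f_def fn intro!: borel_measurable_divide_ennreal)
  also have "\<dots> \<le> emeasure \<mu> U"
    using f_int by (intro Liminf_le) (auto simp: eventually_sequentially)
  finally show ?thesis .
qed

lemma ball_measures_determine:
  fixes \<mu> \<nu> :: "'a::{metric_space, second_countable_topology} measure"
  assumes \<mu>: "sigma_finite_measure \<mu>" "sets \<mu> = sets borel" "AE x in \<mu>. x \<in> X"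
    and \<nu>: "sigma_finite_measure \<nu>" "sets \<nu> = sets borel" "AE x in \<nu>. x \<in> X"
    and h: "\<And>x r. x \<in> X \<Longrightarrow> emeasure \<mu> (ball x r) = h r"
    and k: "\<And>x r. x \<in> X \<Longrightarrow> emeasure \<nu> (ball x r) = h r"
    and h_pos: "\<And>r. 0 < r \<Longrightarrow> 0 < h r" and h_fin: "\<And>r. h r \<noteq> top"
    and "c \<in> X"
  shows "\<mu> = \<nu>"
proof (rule measure_eqI_generator_eq[where E="{S. open S}" and \<Omega>=UNIV and A="\<lambda>n. ball c (real n)"])
  show "emeasure \<mu> U = emeasure \<nu> U" if "U \<in> {S. open S}" for U
    by (intro antisym ball_measures_le_on_open[OF \<mu> \<nu> h k h_pos h_fin]
        ball_measures_le_on_open[OF \<nu> \<mu> k h h_pos h_fin]) (use that in auto)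
  show "(\<Union>i. ball c (real i)) = UNIV" by (auto simp: reals_Archimedean2)
  show "emeasure \<mu> (ball c (real i)) \<noteq> \<infinity>" for i using h[OF \<open>c \<in> X\<close>] h_fin by simp
qed (auto simp: Int_stable_def \<mu> \<nu> borel_def)

text \<open>The common ball measures of \<open>\<mu>\<close> and \<open>\<nu>\<close> agree: integrating the \<open>\<mu>\<close>-measure of the ball around \<open>x\<close> against
  \<open>\<nu>\<close> gives the same as exchanging the roles of the two measures. This replaces the uniqueness of invariant
  measures on homogeneous spaces.\<close>
lemma uniformly_distributed_unique:
  fixes \<mu> \<nu> :: "'a::{metric_space, second_countable_topology} measure"
  assumes \<mu>: "prob_space \<mu>" "sets \<mu> = sets borel" "AE x in \<mu>. x \<in> X"
    and \<nu>: "prob_space \<nu>" "sets \<nu> = sets borel" "AE x in \<nu>. x \<in> X"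
    and unif\<mu>: "\<And>x y r. x \<in> X \<Longrightarrow> y \<in> X \<Longrightarrow> emeasure \<mu> (ball x r) = emeasure \<mu> (ball y r)"
    and unif\<nu>: "\<And>x y r. x \<in> X \<Longrightarrow> y \<in> X \<Longrightarrow> emeasure \<nu> (ball x r) = emeasure \<nu> (ball y r)"
  shows "\<mu> = \<nu>"
proof -
  interpret \<mu>: prob_space \<mu> by fact
  interpret \<nu>: prob_space \<nu> by fact
  obtain x0 where "x0 \<in> X"
  proof (cases "X = {}")
    case True
    with \<mu>(3) have "AE x in \<mu>. False" by simp
    then show ?thesis by simp
  qed auto
  define h where "h r = emeasure \<mu> (ball x0 r)" for r
  define k where "k r = emeasure \<nu> (ball x0 r)" for r
  have h: "emeasure \<mu> (ball x r) = h r" and k: "emeasure \<nu> (ball x r) = k r" if "x \<in> X" for x r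
    using that \<open>x0 \<in> X\<close> unif\<mu> unif\<nu> unfolding h_def k_def by blast+
  have hk: "h r = k r" for r
  proof -
    have "h r = (\<integral>\<^sup>+x. h r \<partial>\<nu>)" by (simp add: \<nu>.emeasure_space_1)
    also have "\<dots> = (\<integral>\<^sup>+x. emeasure \<mu> (ball x r) \<partial>\<nu>)"
      by (intro nn_integral_cong_AE) (use \<nu>(3) in \<open>auto simp: h\<close>)
    also have "\<dots> = (\<integral>\<^sup>+y. emeasure \<nu> (ball y r) \<partial>\<mu>)"
      using indicator_ball_fubini[OF _ \<mu>(2) _ \<nu>(2), of UNIV r]
      by (simp add: \<mu>.sigma_finite_measure_axioms \<nu>.sigma_finite_measure_axioms)
    also have "\<dots> = (\<integral>\<^sup>+y. k r \<partial>\<mu>)"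
      by (intro nn_integral_cong_AE) (use \<mu>(3) in \<open>auto simp: k\<close>)
    finally show ?thesis by (simp add: \<mu>.emeasure_space_1)
  qed
  show ?thesis
  proof (rule ball_measures_determine)
    show "sigma_finite_measure \<mu>" "sigma_finite_measure \<nu>" by unfold_locales
    show "0 < h r" if "0 < r" for r
      unfolding h_def by (rule uniformly_distributed_ball_pos[OF \<mu> unif\<mu> \<open>x0 \<in> X\<close> that])
    show "h r \<noteq> top" for r by (simp add: h_def)
    show "emeasure \<mu> (ball x r) = h r" "emeasure \<nu> (ball x r) = h r" if "x \<in> X" for x r
      using h k hk that by auto
  qed fact+
qed

section \<open>The standard Gaussian measure\<close>

lemma sets_std_gaussian [simp, measurable_cong]: "sets std_gaussian = sets borel"
  by (simp add: std_gaussian_def)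

lemma space_std_gaussian [simp]: "space std_gaussian = UNIV"
  by (simp add: std_gaussian_def)

abbreviation std_gaussian_density :: "'a::euclidean_space \<Rightarrow> ennreal" where
  "std_gaussian_density x \<equiv> ennreal (exp (- (norm x)\<^sup>2 / 2) / sqrt (2 * pi) ^ DIM('a))"

text \<open>The reason why Gaussian coordinates, and hence the components of a Gaussian tuple, are independent.\<close>
lemma std_gaussian_density_eq_prod:
  "std_gaussian_density (x :: 'a::euclidean_space) = (\<Prod>b\<in>Basis. ennreal (std_normal_density (x \<bullet> b)))"
proof -
  have "(norm x)\<^sup>2 = (\<Sum>b\<in>Basis. (x \<bullet> b)\<^sup>2)"
    unfolding power2_norm_eq_inner by (subst euclidean_inner) (simp add: power2_eq_square)
  then have "exp (- (norm x)\<^sup>2 / 2) = (\<Prod>b\<in>Basis. exp (- (x \<bullet> b)\<^sup>2 / 2))"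
    by (simp add: exp_sum[symmetric] sum_negf sum_divide_distrib)
  then show ?thesis
    by (simp add: std_normal_density_def prod_dividef prod_ennreal)
qed

lemma prob_space_std_gaussian: "prob_space (std_gaussian :: 'a::euclidean_space measure)"
proof
  have "emeasure (std_gaussian :: 'a measure) (space std_gaussian) = (\<integral>\<^sup>+x. std_gaussian_density x \<partial>(lborel :: 'a measure))"
    by (simp add: std_gaussian_def emeasure_density)
  also have "\<dots> = (\<integral>\<^sup>+x. (\<Prod>b\<in>Basis. ennreal (std_normal_density (x \<bullet> b))) \<partial>(lborel :: 'a measure))"
    by (simp only: std_gaussian_density_eq_prod)
  also have "\<dots> = (\<Prod>b\<in>(Basis::'a set). \<integral>\<^sup>+x. ennreal (std_normal_density x) \<partial>lborel)"
    by (rule nn_integral_lborel_prod) auto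
  also have "(\<integral>\<^sup>+x. ennreal (std_normal_density x) \<partial>lborel) = 1"
    using prob_space.emeasure_space_1[OF prob_space_normal_density[of 1 0]]
    by (simp add: emeasure_density)
  finally show "emeasure (std_gaussian :: 'a measure) (space std_gaussian) = 1" by simp
qed

interpretation std_gaussian: prob_space "std_gaussian :: 'a::euclidean_space measure"
  by (rule prob_space_std_gaussian)

text \<open>All almost sure statements about the Gaussian vector are reduced to this one.\<close>
lemma AE_std_gaussian_notin_subspace:
  fixes U :: "'a::euclidean_space set"
  assumes "subspace U" "U \<noteq> UNIV"
  shows "AE g in std_gaussian. g \<notin> U"
proof -
  have "dim U < DIM('a)"
    using assms dim_eq_full[of U] dim_subset_UNIV[of U] by (metis le_neq_implies_less span_eq_iff)
  then have "negligible U" by (rule negligible_lowdim)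
  then have "AE x in lebesgue. x \<notin> U"
    by (simp add: negligible_iff_null_sets AE_not_in)
  then have "AE x in lborel. x \<notin> U"
    by (simp add: AE_completion_iff)
  then show ?thesis
    unfolding std_gaussian_def by (subst AE_density) auto
qed

lemma lborel_vec:
  "(lborel :: ('a::euclidean_space^'n) measure)
    = distr (\<Pi>\<^sub>M i\<in>(UNIV::'n set). lborel) borel (\<lambda>f. \<chi> i. f i)"
proof (rule lborel_eqI)
  interpret product_sigma_finite "\<lambda>_::'n. lborel :: 'a measure" ..
  have [measurable]: "(\<lambda>f. \<chi> i. f i) \<in> (\<Pi>\<^sub>M i\<in>(UNIV::'n set). lborel) \<rightarrow>\<^sub>M (borel :: ('a^'n) measure)"
    by (subst borel_measurable_euclidean_space) (auto simp: Basis_vec_def inner_axis)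
  fix l u :: "'a^'n" assume le: "\<And>b. b \<in> Basis \<Longrightarrow> l \<bullet> b \<le> u \<bullet> b"
  have le': "l $ i \<bullet> b \<le> u $ i \<bullet> b" if "b \<in> Basis" for i b
    using le[of "axis i b"] that by (auto simp: Basis_vec_def inner_axis)
  have "(\<lambda>f. \<chi> i. f i) -` box l u \<inter> space (\<Pi>\<^sub>M i\<in>(UNIV::'n set). lborel) = (\<Pi>\<^sub>E i\<in>UNIV. box (l $ i) (u $ i))"
    by (auto simp: mem_box Basis_vec_def inner_axis space_PiM PiE_iff)
  then have "emeasure (distr (\<Pi>\<^sub>M i\<in>(UNIV::'n set). lborel) borel (\<lambda>f. \<chi> i. f i)) (box l u)
      = (\<Prod>i\<in>UNIV. emeasure lborel (box (l $ i) (u $ i)))"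
    by (simp add: emeasure_distr emeasure_PiM)
  also have "\<dots> = ennreal (\<Prod>i\<in>UNIV. \<Prod>b\<in>Basis. (u - l) $ i \<bullet> b)"
    by (simp add: emeasure_lborel_box_eq le' prod_ennreal prod_nonneg inner_diff_left)
  also have "(\<Prod>i\<in>UNIV. \<Prod>b\<in>Basis. (u - l) $ i \<bullet> b) = (\<Prod>(i, b)\<in>UNIV \<times> Basis. (u - l) $ i \<bullet> b)"
    by (rule prod.cartesian_product)
  also have "\<dots> = (\<Prod>b\<in>Basis. (u - l) \<bullet> b)"
  proof (rule prod.reindex_cong[symmetric])
    show "inj_on (\<lambda>(i, b). axis i b) ((UNIV::'n set) \<times> (Basis::'a set))"
      by (auto simp: inj_on_def axis_eq_axis)
    show "(Basis :: ('a^'n) set) = (\<lambda>(i, b). axis i b) ` (UNIV \<times> Basis)"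
      by (auto simp: Basis_vec_def)
  qed (auto simp: inner_axis)
  finally show "emeasure (distr (\<Pi>\<^sub>M i\<in>(UNIV::'n set). lborel) borel (\<lambda>f. \<chi> i. f i)) (box l u)
    = ennreal (\<Prod>b\<in>Basis. (u - l) \<bullet> b)" .
qed simp

lemma emeasure_std_gaussian_vec:
  fixes A :: "'n::finite \<Rightarrow> 'a::euclidean_space set"
  assumes [measurable]: "\<And>i. A i \<in> sets borel"
  shows "emeasure std_gaussian {g. \<forall>i. g $ i \<in> A i} = (\<Prod>i\<in>UNIV. emeasure std_gaussian (A i))"
proof -
  interpret product_sigma_finite "\<lambda>_::'n. lborel :: 'a measure" ..
  have vec: "(\<lambda>f. \<chi> i. f i) \<in> (\<Pi>\<^sub>M i\<in>(UNIV::'n set). lborel) \<rightarrow>\<^sub>M (borel :: ('a^'n) measure)"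
    by (subst borel_measurable_euclidean_space) (auto simp: Basis_vec_def inner_axis)
  have nth [measurable]: "(\<lambda>g :: 'a^'n. g $ i) \<in> borel_measurable borel" for i
    by (intro borel_measurable_continuous_onI continuous_intros)
  have S [measurable]: "{g :: 'a^'n. \<forall>i. g $ i \<in> A i} \<in> sets borel"
    by measurable
  have dens: "std_gaussian_density g = (\<Prod>i\<in>UNIV. std_gaussian_density (g $ i))" for g :: "'a^'n"
  proof -
    have "std_gaussian_density g = (\<Prod>(i, b)\<in>UNIV \<times> Basis. ennreal (std_normal_density (g $ i \<bullet> b)))"
      unfolding std_gaussian_density_eq_prod
    proof (rule prod.reindex_cong)
      show "inj_on (\<lambda>(i, b). axis i b) ((UNIV::'n set) \<times> (Basis::'a set))"
        by (auto simp: inj_on_def axis_eq_axis)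
      show "(Basis :: ('a^'n) set) = (\<lambda>(i, b). axis i b) ` (UNIV \<times> Basis)"
        by (auto simp: Basis_vec_def)
    qed (auto simp: inner_axis)
    then show ?thesis unfolding std_gaussian_density_eq_prod prod.cartesian_product .
  qed
  have "emeasure std_gaussian {g. \<forall>i. g $ i \<in> A i}
      = (\<integral>\<^sup>+g. std_gaussian_density g * indicator {g. \<forall>i. g $ i \<in> A i} g \<partial>lborel)"
    using S unfolding std_gaussian_def by (subst emeasure_density) auto
  also have "\<dots> = (\<integral>\<^sup>+g. (\<Prod>i\<in>UNIV. std_gaussian_density (g $ i) * indicator (A i) (g $ i)) \<partial>(lborel :: ('a^'n) measure))"
  proof (intro nn_integral_cong)
    fix g :: "'a^'n"
    have "indicator {g. \<forall>i. g $ i \<in> A i} g = (\<Prod>i\<in>UNIV. indicator (A i) (g $ i) :: ennreal)"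
      by (cases "\<forall>i. g $ i \<in> A i") (auto simp: indicator_def)
    then show "std_gaussian_density g * indicator {g. \<forall>i. g $ i \<in> A i} g
      = (\<Prod>i\<in>UNIV. std_gaussian_density (g $ i) * indicator (A i) (g $ i))"
      by (simp only: dens prod.distrib)
  qed
  also have "\<dots> = (\<integral>\<^sup>+f. (\<Prod>i\<in>UNIV. std_gaussian_density (f i) * indicator (A i) (f i)) \<partial>(\<Pi>\<^sub>M i\<in>(UNIV::'n set). lborel))"
    by (subst lborel_vec, subst nn_integral_distr[OF vec]) auto
  also have "\<dots> = (\<Prod>i\<in>UNIV. \<integral>\<^sup>+x. std_gaussian_density x * indicator (A i) x \<partial>lborel)"
    by (rule product_nn_integral_prod) auto
  also have "\<dots> = (\<Prod>i\<in>UNIV. emeasure std_gaussian (A i))"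
    by (simp add: std_gaussian_def emeasure_density)
  finally show ?thesis .
qed

text \<open>Translation invariance and the isometry property show that both measures give every ball of radius \<open>r\<close> the
  measure of the ball around \<open>0\<close>, and the measures of balls determine the measure.\<close>
lemma lborel_orthogonal_invariant:
  fixes f :: "'a::euclidean_space \<Rightarrow> 'a"
  assumes f: "orthogonal_transformation f"
  shows "distr lborel borel f = lborel"
proof -
  have lin: "linear f" by (rule orthogonal_transformation_linear[OF f])
  have [measurable]: "f \<in> borel_measurable borel"
    by (intro borel_measurable_continuous_onI linear_continuous_on) (simp add: lin linear_linear)
  obtain g where g: "orthogonal_transformation g" "\<And>x. f (g x) = x" "\<And>x. g (f x) = x"
    by (metis f orthogonal_transformation_inv orthogonal_transformation_bij bij_inv_eq_iff)
  have pre: "f -` ball x r = ball (g x) r" for x r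
    using f g(2) unfolding orthogonal_transformation_isometry by (auto simp: mem_ball) (metis g(2))+
  have ball: "emeasure lborel (ball x r) = emeasure lborel (ball (0::'a) r)" for x :: 'a and r
  proof -
    have "emeasure lborel (ball x r) = emeasure (distr lborel borel ((+) x)) (ball x r)"
      by (simp add: lborel_distr_plus)
    also have "\<dots> = emeasure lborel ((+) x -` ball x r)" by (simp add: emeasure_distr)
    also have "(+) x -` ball x r = ball 0 r" by (auto simp: dist_norm)
    finally show ?thesis .
  qed
  have ball': "emeasure (distr lborel borel f) (ball x r) = emeasure lborel (ball (0::'a) r)" for x r
  proof -
    have "emeasure (distr lborel borel f) (ball x r) = emeasure lborel (ball (g x) r)"
      by (simp add: emeasure_distr pre)
    then show ?thesis using ball[of "g x" r] by simp
  qed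
  have pos: "0 < emeasure lborel (ball (0::'a) r)" if "0 < r" for r
    using content_ball_pos[OF that, of "0::'a"] by (auto simp: measure_def zero_less_iff_neq_zero)
  have fin: "emeasure lborel (ball (0::'a) r) \<noteq> top" for r
    using emeasure_bounded_finite[of "ball (0::'a) r"] by (simp add: less_top)
  have "sigma_finite_measure (distr lborel borel f)"
  proof
    have "\<Union>(range (\<lambda>n. ball (0::'a) (real n))) = UNIV"
      by (auto simp: reals_Archimedean2)
    then show "\<exists>A. countable A \<and> A \<subseteq> sets (distr lborel borel f) \<and> \<Union>A = space (distr lborel borel f) \<and>
        (\<forall>a\<in>A. emeasure (distr lborel borel f) a \<noteq> \<infinity>)"
      using ball' fin by (intro exI[of _ "range (\<lambda>n. ball (0::'a) (real n))"]) auto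
  qed
  then show ?thesis
    by (rule ball_measures_determine[OF _ _ _ lborel.sigma_finite_measure_axioms _ _ ball' ball pos fin UNIV_I]) auto
qed

lemma std_gaussian_orthogonal_invariant:
  fixes f :: "'a::euclidean_space \<Rightarrow> 'a"
  assumes f: "orthogonal_transformation f"
  shows "distr std_gaussian borel f = std_gaussian"
proof -
  have [measurable]: "f \<in> borel_measurable borel"
    by (intro borel_measurable_continuous_onI linear_continuous_on)
      (simp add: orthogonal_transformation_linear[OF f] linear_linear)
  have "density (distr lborel borel f) std_gaussian_density
      = distr (density lborel (\<lambda>x. std_gaussian_density (f x))) borel f"
    by (rule density_distr) auto
  then show ?thesis
    by (simp add: lborel_orthogonal_invariant[OF f] std_gaussian_def orthogonal_transformation_norm[OF f])
qed

section \<open>Independent Haar matrices\<close>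

lemma continuous_on_matrix_matrix_mult [continuous_intros]:
  fixes A :: "'a::topological_space \<Rightarrow> real^'m^'n" and B :: "'a \<Rightarrow> real^'p^'m"
  assumes "continuous_on S A" "continuous_on S B"
  shows "continuous_on S (\<lambda>x. A x ** B x)"
  unfolding matrix_matrix_mult_def
  by (intro continuous_on_vec_lambda continuous_intros assms)

lemma continuous_on_matrix_vector_mult [continuous_intros]:
  fixes A :: "'a::topological_space \<Rightarrow> real^'m^'n" and x :: "'a \<Rightarrow> real^'m"
  assumes "continuous_on S A" "continuous_on S x"
  shows "continuous_on S (\<lambda>t. A t *v x t)"
  unfolding matrix_vector_mult_def
  by (intro continuous_on_vec_lambda continuous_intros assms)

lemma continuous_on_transpose [continuous_intros]:
  fixes A :: "'a::topological_space \<Rightarrow> real^'m^'n"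
  assumes "continuous_on S A"
  shows "continuous_on S (\<lambda>t. transpose (A t))"
  unfolding transpose_def
  by (intro continuous_on_vec_lambda continuous_intros assms)

lemma borel_measurable_vec_lambda [measurable (raw)]:
  fixes f :: "'n::finite \<Rightarrow> 'w \<Rightarrow> 'a::euclidean_space"
  assumes [measurable]: "\<And>i. f i \<in> borel_measurable M"
  shows "(\<lambda>w. \<chi> i. f i w) \<in> borel_measurable M"
  by (subst borel_measurable_euclidean_space) (auto simp: Basis_vec_def inner_axis)

lemma borel_measurable_matrix_matrix_mult [measurable (raw)]:
  fixes A :: "'w \<Rightarrow> real^'m^'n" and B :: "'w \<Rightarrow> real^'p^'m"
  assumes [measurable]: "A \<in> borel_measurable M" "B \<in> borel_measurable M"
  shows "(\<lambda>w. A w ** B w) \<in> borel_measurable M"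
  by (rule borel_measurable_continuous_Pair[OF assms]) (intro continuous_intros)

lemma borel_measurable_transpose [measurable (raw)]:
  fixes A :: "'w \<Rightarrow> real^'m^'n"
  assumes "A \<in> borel_measurable M"
  shows "(\<lambda>w. transpose (A w)) \<in> borel_measurable M"
  by (rule borel_measurable_continuous_on[OF _ assms]) (intro continuous_intros)

lemma borel_measurable_vec_nth [measurable (raw)]:
  fixes f :: "'w \<Rightarrow> 'a::euclidean_space^'n"
  assumes "f \<in> borel_measurable M"
  shows "(\<lambda>w. f w $ i) \<in> borel_measurable M"
  by (rule borel_measurable_continuous_on[OF _ assms]) (intro continuous_intros)

lemma closed_orthogonal_matrix: "closed {Q :: real^'d^'d. orthogonal_matrix Q}"
  unfolding orthogonal_matrix_def by (intro closed_Collect_conj closed_Collect_eq continuous_intros)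

lemma orthogonal_matrix_transpose_iff [simp]:
  "orthogonal_matrix (transpose Q) \<longleftrightarrow> orthogonal_matrix (Q :: real^'d^'d)"
  by (auto simp: orthogonal_matrix_def)

text \<open>The double integral of \<open>1\<^sub>A(Q1\<^sup>T Q2)\<close> is computed in both orders. Integrating first over \<open>Q2\<close>, left
  invariance removes \<open>Q1\<^sup>T\<close>; integrating first over \<open>Q1\<close>, left invariance removes \<open>Q2\<close> from the transpose
  \<open>(Q2\<^sup>T Q1)\<^sup>T\<close>.\<close>
lemma left_invariant_imp_transpose_invariant:
  fixes \<mu> :: "(real^'d^'d) measure"
  assumes "prob_space \<mu>" and S [measurable_cong]: "sets \<mu> = sets borel"
    and orth: "AE Q in \<mu>. orthogonal_matrix Q"
    and left: "\<And>R. orthogonal_matrix R \<Longrightarrow> distr \<mu> borel (\<lambda>Q. R ** Q) = \<mu>"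
  shows "distr \<mu> borel transpose = \<mu>"
proof (rule measure_eqI)
  interpret prob_space \<mu> by fact
  interpret pair_sigma_finite \<mu> \<mu> ..
  fix A assume "A \<in> sets (distr \<mu> borel transpose)"
  then have [measurable]: "A \<in> sets borel" by simp
  have L: "(\<integral>\<^sup>+Q. indicator A (R ** Q) \<partial>\<mu>) = emeasure \<mu> A" if "orthogonal_matrix R" for R
  proof -
    have "emeasure \<mu> A = emeasure (distr \<mu> borel (\<lambda>Q. R ** Q)) A" by (simp add: left[OF that])
    also have "\<dots> = (\<integral>\<^sup>+Q. indicator A Q \<partial>distr \<mu> borel (\<lambda>Q. R ** Q))" by simp
    also have "\<dots> = (\<integral>\<^sup>+Q. indicator A (R ** Q) \<partial>\<mu>)" by (subst nn_integral_distr) auto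
    finally show ?thesis by simp
  qed
  have LT: "(\<integral>\<^sup>+Q. indicator A (transpose Q ** R) \<partial>\<mu>) = emeasure (distr \<mu> borel transpose) A"
    if "orthogonal_matrix R" for R
  proof -
    have R: "orthogonal_matrix (transpose R)" using that by simp
    have "emeasure (distr \<mu> borel transpose) A = (\<integral>\<^sup>+Q. indicator A Q \<partial>distr \<mu> borel transpose)" by simp
    also have "\<dots> = (\<integral>\<^sup>+Q. indicator A (transpose Q) \<partial>\<mu>)" by (subst nn_integral_distr) auto
    also have "\<dots> = (\<integral>\<^sup>+Q. indicator A (transpose Q) \<partial>distr \<mu> borel (\<lambda>Q. transpose R ** Q))"
      by (simp add: left[OF R])
    also have "\<dots> = (\<integral>\<^sup>+Q. indicator A (transpose Q ** R) \<partial>\<mu>)"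
      by (subst nn_integral_distr) (auto simp: matrix_transpose_mul)
    finally show ?thesis by simp
  qed
  have "emeasure \<mu> A = (\<integral>\<^sup>+Q1. emeasure \<mu> A \<partial>\<mu>)" by (simp add: emeasure_space_1)
  also have "\<dots> = (\<integral>\<^sup>+Q1. (\<integral>\<^sup>+Q2. indicator A (transpose Q1 ** Q2) \<partial>\<mu>) \<partial>\<mu>)"
    by (intro nn_integral_cong_AE) (use orth in eventually_elim, simp add: L)
  also have "\<dots> = (\<integral>\<^sup>+Q2. (\<integral>\<^sup>+Q1. indicator A (transpose Q1 ** Q2) \<partial>\<mu>) \<partial>\<mu>)"
    by (rule Fubini') measurable
  also have "\<dots> = (\<integral>\<^sup>+Q2. emeasure (distr \<mu> borel transpose) A \<partial>\<mu>)"
    by (intro nn_integral_cong_AE) (use orth in eventually_elim, simp add: LT)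
  also have "\<dots> = emeasure (distr \<mu> borel transpose) A" by (simp add: emeasure_space_1)
  finally show "emeasure (distr \<mu> borel transpose) A = emeasure \<mu> A" by simp
qed (simp add: S)

text \<open>Transposition preserves the measure and exchanges left and right multiplication.\<close>
lemma left_invariant_imp_right_invariant:
  fixes \<mu> :: "(real^'d^'d) measure"
  assumes "prob_space \<mu>" and S [measurable_cong]: "sets \<mu> = sets borel"
    and orth: "AE Q in \<mu>. orthogonal_matrix Q"
    and left: "\<And>R. orthogonal_matrix R \<Longrightarrow> distr \<mu> borel (\<lambda>Q. R ** Q) = \<mu>"
    and R: "orthogonal_matrix R"
  shows "distr \<mu> borel (\<lambda>Q. Q ** R) = \<mu>"
proof -
  note T = left_invariant_imp_transpose_invariant[OF assms(1-4)]
  have "distr \<mu> borel (\<lambda>Q. Q ** R) = distr (distr \<mu> borel transpose) borel (\<lambda>Q. Q ** R)"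
    by (simp add: T)
  also have "\<dots> = distr \<mu> borel (\<lambda>Q. transpose (transpose R ** Q))"
    by (subst distr_distr) (auto simp: comp_def matrix_transpose_mul)
  also have "\<dots> = distr (distr \<mu> borel (\<lambda>Q. transpose R ** Q)) borel transpose"
    by (subst distr_distr) (auto simp: comp_def)
  also have "\<dots> = \<mu>" using left[of "transpose R"] R by (simp add: T)
  finally show ?thesis .
qed

lemma (in prob_space) indep_vars_joint_law_eq:
  fixes X Y :: "'n::finite \<Rightarrow> 'a \<Rightarrow> 'b::euclidean_space"
  assumes X: "indep_vars (\<lambda>_. borel) X UNIV" and Y: "indep_vars (\<lambda>_. borel) Y UNIV"
    and XY: "\<And>i. distr M borel (X i) = distr M borel (Y i)"
  shows "distr M borel (\<lambda>\<omega>. \<chi> i. X i \<omega>) = distr M borel (\<lambda>\<omega>. \<chi> i. Y i \<omega>)"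
proof -
  have law: "distr M borel (\<lambda>\<omega>. \<chi> i. Z i \<omega>)
      = distr (\<Pi>\<^sub>M i\<in>UNIV. distr M borel (Z i)) borel (\<lambda>f. \<chi> i. f i)"
    if Z: "indep_vars (\<lambda>_. borel) Z UNIV" for Z :: "'n \<Rightarrow> 'a \<Rightarrow> 'b"
  proof -
    have [measurable]: "Z i \<in> borel_measurable M" for i using Z by (auto simp: indep_vars_def)
    have "(\<Pi>\<^sub>M i\<in>UNIV. distr M borel (Z i)) = distr M (\<Pi>\<^sub>M i\<in>UNIV. borel) (\<lambda>\<omega>. \<lambda>i\<in>UNIV. Z i \<omega>)"
      using indep_vars_iff_distr_eq_PiM[where I=UNIV and M'="\<lambda>_. borel" and X=Z] Z by simp
    also have "distr \<dots> borel (\<lambda>f. \<chi> i. f i) = distr M borel (\<lambda>\<omega>. \<chi> i. Z i \<omega>)"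
    proof -
      have "(\<lambda>\<omega>. \<lambda>i\<in>UNIV. Z i \<omega>) \<in> M \<rightarrow>\<^sub>M (\<Pi>\<^sub>M i\<in>UNIV. borel)" by measurable
      then show ?thesis by (subst distr_distr) (auto simp: comp_def restrict_def)
    qed
    finally show ?thesis by simp
  qed
  show ?thesis by (simp add: law X Y XY)
qed

text \<open>The only information about the joint law of the random rotations that the kinematic formula uses. The tuple
  is a vector of matrices, so that the law lives on a Euclidean space and null sets can be treated by closedness
  arguments.\<close>
locale right_invariant_rotations = prob_space \<nu>
  for \<nu> :: "(real^'d^'d^'n::finite) measure" +
  assumes sets_eq [simp, measurable_cong]: "sets \<nu> = sets borel"
    and AE_orthogonal: "AE q in \<nu>. \<forall>i. orthogonal_matrix (q $ i)"
    and right_invariant: "\<And>R. (\<And>i. orthogonal_matrix (R i)) \<Longrightarrow> distr \<nu> borel (\<lambda>q. \<chi> i. q $ i ** R i) = \<nu>"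

lemma joint_haar_right_invariant:
  fixes Q :: "'n::finite \<Rightarrow> 'w \<Rightarrow> real^'d^'d"
  assumes "prob_space P" and indep: "prob_space.indep_vars P (\<lambda>_. orthogonal_borel) Q UNIV"
    and haar: "\<And>i. normalized_haar (distr P orthogonal_borel (Q i))"
  shows "right_invariant_rotations (distr P borel (\<lambda>\<omega>. \<chi> i. Q i \<omega>))"
proof -
  interpret prob_space P by fact
  have QO: "Q i \<in> P \<rightarrow>\<^sub>M orthogonal_borel" for i using indep by (auto simp: indep_vars_def)
  have spO: "space (orthogonal_borel :: (real^'d^'d) measure) = {Q. orthogonal_matrix Q}"
    by (simp add: orthogonal_borel_def space_restrict_space)
  have QB [measurable]: "Q i \<in> borel_measurable P" for i
    using QO[of i] unfolding orthogonal_borel_def by (simp add: measurable_restrict_space2_iff)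
  have orth: "orthogonal_matrix (Q i \<omega>)" if "\<omega> \<in> space P" for i \<omega>
    using measurable_space[OF QO that, of i] by (simp add: spO)
  have OB: "f \<in> orthogonal_borel \<rightarrow>\<^sub>M borel" if "f \<in> borel \<rightarrow>\<^sub>M borel" for f :: "real^'d^'d \<Rightarrow> real^'d^'d"
    unfolding orthogonal_borel_def using that by (rule measurable_restrict_space1)
  have right: "distr P borel (\<lambda>\<omega>. Q i \<omega> ** R) = distr P borel (Q i)" if R: "orthogonal_matrix R" for i R
  proof -
    let ?\<mu> = "distr P borel (Q i)"
    have left: "distr ?\<mu> borel (\<lambda>Q. R ** Q) = ?\<mu>" if R: "orthogonal_matrix R" for R
    proof -
      let ?\<mu>' = "distr P orthogonal_borel (Q i)"
      have RO: "(\<lambda>Q. R ** Q) \<in> orthogonal_borel \<rightarrow>\<^sub>M orthogonal_borel"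
        unfolding orthogonal_borel_def
        by (rule measurable_restrict_space3) (auto intro: orthogonal_matrix_mul[OF R])
      have id: "(\<lambda>Q. Q) \<in> orthogonal_borel \<rightarrow>\<^sub>M (borel :: (real^'d^'d) measure)" by (rule OB) simp
      have inv: "distr ?\<mu>' orthogonal_borel (\<lambda>Q. R ** Q) = ?\<mu>'"
      proof -
        have "distr ?\<mu>' orthogonal_borel (\<lambda>Q. R ** Q) = distr ?\<mu>' ?\<mu>' (\<lambda>Q. R ** Q)"
          by (rule distr_cong) auto
        then show ?thesis using haar[of i] R by (simp add: normalized_haar_def)
      qed
      have "?\<mu> = distr ?\<mu>' borel (\<lambda>Q. Q)"
        by (subst distr_distr[OF id QO]) (simp add: comp_def)
      also have "\<dots> = distr (distr ?\<mu>' orthogonal_borel (\<lambda>Q. R ** Q)) borel (\<lambda>Q. Q)" by (simp add: inv)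
      also have "\<dots> = distr ?\<mu>' borel (\<lambda>Q. R ** Q)"
        by (subst distr_distr) (use id RO in \<open>auto simp: comp_def\<close>)
      also have "\<dots> = distr P borel (\<lambda>\<omega>. R ** Q i \<omega>)"
        by (subst distr_distr[OF _ QO]) (auto simp: comp_def intro: OB)
      also have "\<dots> = distr ?\<mu> borel (\<lambda>Q. R ** Q)"
        by (subst distr_distr) (auto simp: comp_def)
      finally show ?thesis by simp
    qed
    have "distr ?\<mu> borel (\<lambda>Q. Q ** R) = ?\<mu>"
    proof (rule left_invariant_imp_right_invariant[OF _ _ _ left R])
      show "prob_space ?\<mu>" by (rule prob_space_distr) simp
      show "AE Q in ?\<mu>. orthogonal_matrix Q"
        using borel_closed[OF closed_orthogonal_matrix] by (subst AE_distr_iff) (auto simp: orth)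
    qed simp
    then show ?thesis by (subst (asm) distr_distr) (auto simp: comp_def)
  qed
  show ?thesis
  proof (rule right_invariant_rotations.intro, rule prob_space_distr, simp, rule right_invariant_rotations_axioms.intro)
    show "AE q in distr P borel (\<lambda>\<omega>. \<chi> i. Q i \<omega>). \<forall>i. orthogonal_matrix (q $ i)"
    proof (subst AE_distr_iff)
      have "closed {q :: real^'d^'d^'n. orthogonal_matrix (q $ i)}" for i
        unfolding orthogonal_matrix_def by (intro closed_Collect_conj closed_Collect_eq continuous_intros)
      then show "{q \<in> space borel. \<forall>i. orthogonal_matrix ((q :: real^'d^'d^'n) $ i)} \<in> sets borel"
        by (auto intro!: borel_closed closed_Collect_all)
    qed (auto simp: orth)
    fix R :: "'n \<Rightarrow> real^'d^'d" assume R: "\<And>i. orthogonal_matrix (R i)"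
    have "distr (distr P borel (\<lambda>\<omega>. \<chi> i. Q i \<omega>)) borel (\<lambda>q. \<chi> i. q $ i ** R i)
        = distr P borel (\<lambda>\<omega>. \<chi> i. Q i \<omega> ** R i)"
      by (subst distr_distr) (auto simp: comp_def)
    also have "\<dots> = distr P borel (\<lambda>\<omega>. \<chi> i. Q i \<omega>)"
    proof (rule indep_vars_joint_law_eq)
      show "indep_vars (\<lambda>_. borel) (\<lambda>i \<omega>. Q i \<omega> ** R i) UNIV"
        by (rule indep_vars_compose2[OF indep, where Y="\<lambda>i Q. Q ** R i"], rule OB) simp
      show "indep_vars (\<lambda>_. borel) Q UNIV"
        by (rule indep_vars_compose2[OF indep, where Y="\<lambda>i Q. Q"], rule OB) simp
    qed (rule right[OF R])
    finally show "distr (distr P borel (\<lambda>\<omega>. \<chi> i. Q i \<omega>)) borel (\<lambda>q. \<chi> i. q $ i ** R i)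
      = distr P borel (\<lambda>\<omega>. \<chi> i. Q i \<omega>)" .
  qed simp
qed

section \<open>General position of rotated subspaces\<close>

lemma closest_point_subspace:
  fixes L :: "'a::euclidean_space set"
  assumes L: "subspace L"
  shows "closest_point L z \<in> L" and "\<And>y. y \<in> L \<Longrightarrow> (z - closest_point L z) \<bullet> y = 0"
proof -
  have ne: "L \<noteq> {}" using subspace_0[OF L] by auto
  show p: "closest_point L z \<in> L" by (rule closest_point_in_set[OF closed_subspace[OF L] ne])
  fix y assume y: "y \<in> L"
  have "(z - closest_point L z) \<bullet> (closest_point L z + y - closest_point L z) \<le> 0"
    by (rule closest_point_dot[OF subspace_imp_convex[OF L] closed_subspace[OF L] subspace_add[OF L p y]])
  moreover have "(z - closest_point L z) \<bullet> (closest_point L z - y - closest_point L z) \<le> 0"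
    by (rule closest_point_dot[OF subspace_imp_convex[OF L] closed_subspace[OF L] subspace_diff[OF L p y]])
  ultimately show "(z - closest_point L z) \<bullet> y = 0" by simp
qed

lemma closest_point_subspace_unique:
  fixes L :: "'a::euclidean_space set"
  assumes L: "subspace L" and p: "p \<in> L" "\<And>y. y \<in> L \<Longrightarrow> (z - p) \<bullet> y = 0"
  shows "closest_point L z = p"
proof -
  let ?c = "closest_point L z"
  have d: "?c - p \<in> L" by (rule subspace_diff[OF L closest_point_subspace(1)[OF L] p(1)])
  have "(?c - p) \<bullet> (?c - p) = (z - p) \<bullet> (?c - p) - (z - ?c) \<bullet> (?c - p)" by (simp add: inner_diff_left)
  also have "\<dots> = 0" using p(2)[OF d] closest_point_subspace(2)[OF L d, of z] by simp
  finally show ?thesis by simp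
qed

lemma closest_point_subspace_add:
  fixes L :: "'a::euclidean_space set"
  assumes L: "subspace L" and "x \<in> L" "z \<in> L\<^sup>\<bottom>"
  shows "closest_point L (x + z) = x"
  using assms by (intro closest_point_subspace_unique) (auto simp: orthogonal_comp_def orthogonal_def inner_commute)

lemma residual_in_orthogonal_comp:
  fixes L :: "'a::euclidean_space set"
  assumes L: "subspace L" shows "z - closest_point L z \<in> L\<^sup>\<bottom>"
  using closest_point_subspace(2)[OF L, of _ z] by (auto simp: orthogonal_comp_def orthogonal_def inner_commute)

lemma borel_measurable_closest_point:
  fixes C :: "'a::euclidean_space set"
  assumes "convex C" "closed C" "C \<noteq> {}"
  shows "closest_point C \<in> borel_measurable borel"
  by (intro borel_measurable_continuous_onI continuous_on_closest_point assms)

lemma subspace_vec: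
  fixes N :: "'n::finite \<Rightarrow> 'a::euclidean_space set"
  assumes "\<And>i. subspace (N i)"
  shows "subspace {b :: 'a^'n. \<forall>i. b $ i \<in> N i}"
  using assms by (auto simp: subspace_def)

text \<open>Orthonormal bases of the factors, placed in their coordinates, form an orthonormal basis of the product.\<close>
lemma dim_vec_subspace:
  fixes N :: "'n::finite \<Rightarrow> 'a::euclidean_space set"
  assumes N: "\<And>i. subspace (N i)"
  shows "dim {b :: 'a^'n. \<forall>i. b $ i \<in> N i} = (\<Sum>i\<in>UNIV. dim (N i))"
proof -
  have "\<exists>\<beta>. \<beta> \<subseteq> N i \<and> pairwise orthogonal \<beta> \<and> (\<forall>x\<in>\<beta>. norm x = 1) \<and> independent \<beta> \<and> card \<beta> = dim (N i) \<and> span \<beta> = N i" for i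
    using orthonormal_basis_subspace[OF N[of i]] by metis
  then obtain \<beta> where \<beta>: "\<And>i. \<beta> i \<subseteq> N i" "\<And>i. pairwise orthogonal (\<beta> i)" "\<And>i x. x \<in> \<beta> i \<Longrightarrow> norm x = 1"
    "\<And>i. independent (\<beta> i)" "\<And>i. card (\<beta> i) = dim (N i)" "\<And>i. span (\<beta> i) = N i"
    by metis
  have fin: "finite (\<beta> i)" for i by (rule independent_imp_finite[OF \<beta>(4)])
  define E where "E = (\<lambda>(i, e). axis i e :: 'a^'n) ` (SIGMA i:UNIV. \<beta> i)"
  have nz: "e \<noteq> 0" if "e \<in> \<beta> i" for e i using \<beta>(3)[OF that] by auto
  have inj: "inj_on (\<lambda>(i, e). axis i e :: 'a^'n) (SIGMA i:UNIV. \<beta> i)"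
    using nz by (auto simp: inj_on_def axis_eq_axis)
  have orth: "pairwise orthogonal E"
    using \<beta>(2) unfolding E_def pairwise_def by (auto simp: orthogonal_def inner_axis_axis) metis
  have "0 \<notin> E" using nz by (auto simp: E_def axis_eq_0_iff)
  then have ind: "independent E" by (intro pairwise_orthogonal_independent orth)
  have lin: "linear (axis i :: 'a \<Rightarrow> 'a^'n)" for i
    by (auto simp: linear_iff vec_eq_iff axis_def)
  have "E \<subseteq> {b. \<forall>i. b $ i \<in> N i}"
    using subsetD[OF \<beta>(1)] subspace_0[OF N] by (auto simp: E_def axis_def)
  moreover have "{b. \<forall>i. b $ i \<in> N i} \<subseteq> span E"
  proof
    fix b :: "'a^'n" assume b: "b \<in> {b. \<forall>i. b $ i \<in> N i}"
    have "axis i (b $ i) \<in> span E" for i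
    proof -
      have "axis i (b $ i) \<in> axis i ` span (\<beta> i)" using b \<beta>(6) by auto
      also have "axis i ` span (\<beta> i) = span (axis i ` \<beta> i)" by (rule linear_span_image[OF lin, symmetric])
      also have "\<dots> \<subseteq> span E" by (rule span_mono) (force simp: E_def)
      finally show ?thesis .
    qed
    then have "(\<Sum>i\<in>UNIV. axis i (b $ i)) \<in> span E" by (intro span_sum) auto
    moreover have "(\<Sum>i\<in>UNIV. axis i (b $ i)) = b"
      by (simp add: vec_eq_iff axis_def if_distrib cong: if_cong)
    ultimately show "b \<in> span E" by simp
  qed
  ultimately have "card E = dim {b :: 'a^'n. \<forall>i. b $ i \<in> N i}"
    using basis_card_eq_dim ind by blast
  moreover have "card E = (\<Sum>i\<in>UNIV. dim (N i))"
    unfolding E_def by (subst card_image[OF inj]) (simp add: card_SigmaI fin \<beta>(5))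
  ultimately show ?thesis by simp
qed

text \<open>The Householder reflection in the hyperplane orthogonal to \<open>u\<close>; for \<open>u = 0\<close> division by zero makes it the identity.\<close>
definition reflection :: "real^'d \<Rightarrow> real^'d^'d" where
  "reflection u = mat 1 - (2 / (u \<bullet> u)) *\<^sub>R (\<chi> i j. u $ i * u $ j)"

lemma reflection_mult: "reflection u *v x = x - (2 * (u \<bullet> x) / (u \<bullet> u)) *\<^sub>R u"
proof -
  have "(\<chi> i j. u $ i * u $ j) *v x = (u \<bullet> x) *\<^sub>R u"
    by (simp add: matrix_vector_mult_def vec_eq_iff inner_vec_def sum_distrib_left sum_distrib_right mult.assoc mult.left_commute mult.commute)
  then show ?thesis
    by (simp add: reflection_def matrix_vector_mult_diff_rdistrib scaleR_matrix_vector_assoc[symmetric])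
qed

lemma orthogonal_matrix_reflection: "orthogonal_matrix (reflection u)"
proof -
  have "norm (reflection u *v x) = norm x" for x
    by (cases "u = 0")
      (auto simp: reflection_mult norm_eq inner_diff_left inner_diff_right inner_commute field_simps)
  then have "orthogonal_transformation ((*v) (reflection u))"
    by (simp add: orthogonal_transformation)
  then show ?thesis
    by (simp add: orthogonal_transformation_matrix)
qed

lemma reflection_swap:
  assumes "norm x = norm y"
  shows "reflection (x - y) *v x = y"
proof (cases "x = y")
  case False
  have "(x - y) \<bullet> (x - y) = 2 * ((x - y) \<bullet> x)"
    using assms by (simp add: norm_eq inner_diff_left inner_diff_right inner_commute)
  moreover have "(x - y) \<bullet> (x - y) \<noteq> 0" using False by simp
  ultimately have "2 * ((x - y) \<bullet> x) / ((x - y) \<bullet> (x - y)) = 1" by (metis divide_self)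
  then show ?thesis by (simp only: reflection_mult scaleR_one) simp
qed (simp add: reflection_mult)

lemma reflection_fix: "u \<bullet> x = 0 \<Longrightarrow> reflection u *v x = x"
  by (simp add: reflection_mult)

lemma borel_measurable_reflection [measurable (raw)]:
  assumes [measurable]: "f \<in> borel_measurable M"
  shows "(\<lambda>w. reflection (f w)) \<in> borel_measurable M"
  unfolding reflection_def by measurable

lemma
  fixes A :: "real^'d^'d"
  assumes "invertible A"
  shows matrix_inv_right: "A ** matrix_inv A = mat 1" and matrix_inv_left: "matrix_inv A ** A = mat 1"
  using someI_ex[OF assms[unfolded invertible_def]] by (auto simp: matrix_inv_def)

lemma image_of_preimage:
  fixes T Q :: "real^'d^'d"
  assumes "invertible T" "orthogonal_matrix Q"
  shows "T *v (Q *v (transpose Q *v (matrix_inv T *v x))) = x"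
proof -
  have "T *v (Q *v (transpose Q *v (matrix_inv T *v x))) = (T ** (Q ** transpose Q) ** matrix_inv T) *v x"
    by (simp add: matrix_vector_mul_assoc matrix_mul_assoc)
  then show ?thesis using assms(2) matrix_inv_right[OF assms(1)] by (simp add: orthogonal_matrix_def)
qed

text \<open>The subspaces \<open>B\<^sub>i q\<^sub>i N\<^sub>i\<close> are linearly independent and each \<open>B\<^sub>i q\<^sub>i\<close> is injective on \<open>N\<^sub>i\<close>. It is applied with
  \<open>N\<^sub>i = L\<^sub>i\<^sup>\<bottom>\<close> and \<open>B\<^sub>i\<close> the inverse transpose of \<open>T\<^sub>i\<close>, when it says that the subspaces \<open>T\<^sub>i q\<^sub>i L\<^sub>i\<close> intersect
  transversally.\<close>
definition transversal ::
  "('n::finite \<Rightarrow> real^'d^'d) \<Rightarrow> ('n \<Rightarrow> (real^'d) set) \<Rightarrow> real^'d^'d^'n \<Rightarrow> bool" where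
  "transversal B N q \<longleftrightarrow>
    (\<forall>b. (\<forall>i. b $ i \<in> N i) \<longrightarrow> (\<Sum>i\<in>UNIV. B i *v (q $ i *v b $ i)) = 0 \<longrightarrow> b = 0)"

lemma linear_sum_images: "linear (\<lambda>b :: real^'d^'n::finite. \<Sum>i\<in>UNIV. B i *v (q $ i *v b $ i))"
  by (intro linear_compose_sum ballI linear_compose[of "\<lambda>b. b $ _" "\<lambda>x. B _ *v (q $ _ *v x)", unfolded comp_def]) 
    (auto simp: linear_iff matrix_vector_right_distrib matrix_vector_mult_scaleR)

text \<open>By homogeneity a violating \<open>b\<close> can be taken from the unit sphere, which is compact.\<close>
lemma closed_not_transversal:
  fixes N :: "'n::finite \<Rightarrow> (real^'d) set"
  assumes N: "\<And>i. subspace (N i)"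
  shows "closed {q. \<not> transversal B N q}"
proof -
  let ?T = "{(b, q). (\<forall>i. b $ i \<in> N i) \<and> (\<Sum>i\<in>UNIV. B i *v (q $ i *v b $ i)) = 0}"
  have "closed {p :: (real^'d^'n) \<times> (real^'d^'d^'n). (\<forall>i. fst p $ i \<in> N i) \<and> (\<Sum>i\<in>UNIV. B i *v (snd p $ i *v fst p $ i)) = 0}"
    by (intro closed_Collect_conj closed_Collect_all closed_Collect_eq continuous_intros
        continuous_closed_vimage[unfolded vimage_def] closed_subspace N)
  then have "closed {q. \<exists>b. b \<in> sphere 0 1 \<and> (b, q) \<in> ?T}"
    by (intro closed_compact_projection) (auto simp: split_def)
  also have "{q. \<exists>b. b \<in> sphere 0 1 \<and> (b, q) \<in> ?T} = {q. \<not> transversal B N q}"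
  proof (intro Collect_cong iffI)
    fix q assume "\<not> transversal B N q"
    then obtain b where b: "\<forall>i. b $ i \<in> N i" "(\<Sum>i\<in>UNIV. B i *v (q $ i *v b $ i)) = 0" "b \<noteq> 0"
      by (auto simp: transversal_def)
    have "(\<Sum>i\<in>UNIV. B i *v (q $ i *v sgn b $ i)) = inverse (norm b) *\<^sub>R (\<Sum>i\<in>UNIV. B i *v (q $ i *v b $ i))"
      by (simp add: sgn_div_norm matrix_vector_mult_scaleR scaleR_sum_right)
    with b have "sgn b \<in> sphere 0 1 \<and> (sgn b, q) \<in> ?T"
      by (auto simp: norm_sgn sgn_div_norm subspace_scale[OF N])
    then show "\<exists>b. b \<in> sphere 0 1 \<and> (b, q) \<in> ?T" by blast
  qed (auto simp: transversal_def)
  finally show ?thesis .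
qed

lemma dim_inter_hyperplane:
  fixes N :: "'a::euclidean_space set"
  assumes N: "subspace N" and l: "l \<in> N" "l \<noteq> 0"
  shows "dim {x \<in> N. l \<bullet> x = 0} + 1 = dim N"
proof -
  have "dim {y \<in> N. \<forall>x\<in>span {l}. orthogonal x y} + dim (span {l}) = dim N"
    by (rule dim_subspace_orthogonal_to_vectors) (use N l in \<open>auto simp: span_minimal\<close>)
  moreover have "{y \<in> N. \<forall>x\<in>span {l}. orthogonal x y} = {x \<in> N. l \<bullet> x = 0}"
    by (auto simp: span_singleton orthogonal_def)
  ultimately show ?thesis using l by (simp add: dim_insert)
qed

context right_invariant_rotations
begin

lemma AE_right_mult:
  assumes P: "{q. P q} \<in> sets borel" and R: "\<And>i. orthogonal_matrix (R i)"
    and AE: "AE q in \<nu>. P (\<chi> i. q $ i ** R i)"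
  shows "AE q in \<nu>. P q"
proof -
  have "AE q in distr \<nu> borel (\<lambda>q. \<chi> i. q $ i ** R i). P q"
    using P AE by (subst AE_distr_iff) auto
  then show ?thesis unfolding right_invariant[of R, OF R] .
qed

text \<open>Induction on the total dimension. Some \<open>N\<^sub>i\<close> contains a unit vector \<open>l\<close>; let \<open>N'\<^sub>i\<close> be its orthogonal complement in
  \<open>N\<^sub>i\<close>. For almost every \<open>q\<close> the smaller tuple is transversal and spans a proper subspace \<open>U\<close>. By right
  invariance \<open>q\<^sub>i\<close> may be multiplied by a random reflection that fixes \<open>N'\<^sub>i\<close> pointwise and sends \<open>l\<close> to the
  direction of the projection of a Gaussian vector to the complement of \<open>N'\<^sub>i\<close>. This direction almost surely
  avoids the preimage of \<open>U\<close>, and then the whole tuple is transversal.\<close>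
lemma AE_transversal:
  assumes B: "\<And>i. invertible (B i)" and N: "\<And>i. subspace (N i)"
    and le: "(\<Sum>i\<in>UNIV. dim (N i)) \<le> CARD('d)"
  shows "AE q in \<nu>. transversal B N q"
  using N le
proof (induction "\<Sum>i\<in>UNIV. dim (N i)" arbitrary: N)
  case 0
  have "N i \<subseteq> {0}" for i
  proof -
    have "dim (N i) = 0" using 0(1) by simp
    then show ?thesis by (simp add: dim_eq_0)
  qed
  then have "transversal B N q" for q by (fastforce simp: transversal_def vec_eq_iff)
  then show ?case by simp
next
  case (Suc c)
  have "(\<Sum>i\<in>UNIV. dim (N i)) \<noteq> 0" using Suc(2) by (metis nat.distinct(1))
  then obtain i where i: "dim (N i) \<noteq> 0" by (meson sum.neutral)
  then obtain l0 where l0: "l0 \<in> N i" "l0 \<noteq> 0" by (auto simp: dim_eq_0)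
  define l where "l = sgn l0"
  have l: "l \<in> N i" "norm l = 1" using l0 subspace_scale[OF Suc(3)] by (auto simp: l_def norm_sgn sgn_div_norm)
  define N' where "N' = N(i := {x \<in> N i. l \<bullet> x = 0})"
  have N': "subspace (N' j)" for j
    using Suc(3) by (auto simp: N'_def subspace_def inner_add_right)
  have dimi: "dim (N' i) + 1 = dim (N i)"
    using dim_inter_hyperplane[OF Suc(3) l(1)] l(2) by (force simp: N'_def)
  have sumN: "(\<Sum>j\<in>UNIV. dim (N j)) = dim (N i) + (\<Sum>j\<in>UNIV - {i}. dim (N j))"
    by (rule sum.remove) auto
  have sumN': "(\<Sum>j\<in>UNIV. dim (N' j)) = dim (N' i) + (\<Sum>j\<in>UNIV - {i}. dim (N j))"
  proof -
    have "(\<Sum>j\<in>UNIV - {i}. dim (N' j)) = (\<Sum>j\<in>UNIV - {i}. dim (N j))"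
      by (rule sum.cong) (auto simp: N'_def)
    then show ?thesis by (subst sum.remove[of _ i]) auto
  qed
  have c: "c = (\<Sum>j\<in>UNIV. dim (N' j))" using Suc(2) dimi sumN sumN' by simp
  have IH: "AE q in \<nu>. transversal B N' q"
    by (rule Suc(1)[OF c N']) (use Suc(2,4) c in simp)
  \<comment> \<open>the random direction orthogonal to \<open>N' i\<close>, and the reflection that takes \<open>l\<close> to it\<close>
  define e where "e z = sgn (z - closest_point (N' i) z)" for z
  define R where "R z j = (if j = i then reflection (l - e z) else mat 1)" for z j
  have R_orth: "orthogonal_matrix (R z j)" for z j
    by (simp add: R_def orthogonal_matrix_reflection orthogonal_matrix_id)
  have [measurable]: "closest_point (N' i) \<in> borel_measurable borel"
    using subspace_0[OF N'] by (intro borel_measurable_closest_point subspace_imp_convex closed_subspace N') auto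
  have e_meas [measurable]: "e \<in> borel_measurable borel" unfolding e_def by measurable
  have R_meas [measurable]: "(\<lambda>z. R z j) \<in> borel_measurable borel" for j
    by (cases "j = i") (simp_all add: R_def)
  have trans_meas: "{q. transversal B N q} \<in> sets borel"
    using borel_closed[OF closed_not_transversal[OF Suc(3), of B]]
    by (subst sets.sets_Collect_neg[where P="\<lambda>q. \<not> transversal B N q" and M=borel, simplified]) auto
  have key: "AE z in std_gaussian. transversal B N (\<chi> j. q $ j ** R z j)"
    if tr: "transversal B N' q" and orth: "\<forall>i. orthogonal_matrix (q $ i)" for q
  proof -
    let ?S = "\<lambda>b. \<Sum>i\<in>UNIV. B i *v (q $ i *v b $ i)"
    define U where "U = ?S ` {b. \<forall>i. b $ i \<in> N' i}"
    have U: "subspace U" unfolding U_def by (intro linear_subspace_image linear_sum_images subspace_vec N')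
    have "dim U \<le> (\<Sum>j\<in>UNIV. dim (N' j))"
      unfolding U_def dim_vec_subspace[OF N', symmetric] by (rule dim_image_le[OF linear_sum_images])
    then have "U \<noteq> UNIV" using c Suc(2,4) by auto
    \<comment> \<open>the directions that the image of \<open>l\<close> has to avoid\<close>
    define W where "W = (\<lambda>x. B i *v (q $ i *v x)) -` U"
    have lin: "linear (\<lambda>x. B i *v (q $ i *v x))"
      by (auto simp: linear_iff matrix_vector_right_distrib matrix_vector_mult_scaleR)
    have W: "subspace W" unfolding W_def by (rule linear_subspace_vimage[OF lin U])
    have surj: "\<exists>x. B i *v (q $ i *v x) = y" for y
      using image_of_preimage[OF B, of "q $ i" i y] orth by blast
    have "W \<noteq> UNIV"
    proof
      assume "W = UNIV"
      then have "y \<in> U" for y using surj[of y] by (auto simp: W_def)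
      with \<open>U \<noteq> UNIV\<close> show False by auto
    qed
    have N'W: "N' i \<subseteq> W"
    proof
      fix x assume x: "x \<in> N' i"
      have "B i *v (q $ i *v x) = ?S (axis i x)"
        by (subst sum.remove[of _ i]) (auto simp: axis_def intro!: sum.neutral)
      moreover have "axis i x \<in> {b. \<forall>i. b $ i \<in> N' i}" using x subspace_0[OF N'] by (auto simp: axis_def)
      ultimately show "x \<in> W" unfolding W_def U_def by auto
    qed
    have "AE z in std_gaussian. z \<notin> W" by (rule AE_std_gaussian_notin_subspace[OF W \<open>W \<noteq> UNIV\<close>])
    then show ?thesis
    proof eventually_elim
      case (elim z)
      define p where "p = closest_point (N' i) z"
      have p: "p \<in> N' i" "\<And>y. y \<in> N' i \<Longrightarrow> (z - p) \<bullet> y = 0"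
        unfolding p_def using closest_point_subspace[OF N'] by blast+
      have "z \<noteq> p" using elim p(1) N'W by auto
      have e: "norm (e z) = 1" "\<And>y. y \<in> N' i \<Longrightarrow> e z \<bullet> y = 0" "z - p = norm (z - p) *\<^sub>R e z"
        using \<open>z \<noteq> p\<close> p(2) by (auto simp: e_def p_def[symmetric] norm_sgn sgn_div_norm)
      have eW: "e z \<notin> W"
      proof
        assume "e z \<in> W"
        then have "(z - p) + p \<in> W" using e(3) p(1) N'W W by (metis subspace_add subspace_scale subsetD)
        with elim show False by simp
      qed
      have Rl: "R z i *v l = e z" using reflection_swap[of l "e z"] l e by (simp add: R_def)
      have RN': "R z i *v x = x" if "x \<in> N' i" for x
        using that e(2)[OF that] by (auto simp: R_def N'_def inner_diff_left intro!: reflection_fix)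
      show ?case unfolding transversal_def
      proof (intro allI impI)
        fix b assume b: "\<forall>j. b $ j \<in> N j"
          and 0: "(\<Sum>j\<in>UNIV. B j *v ((\<chi> j. q $ j ** R z j) $ j *v b $ j)) = 0"
        \<comment> \<open>\<open>b $ i = n + t *\<^sub>R l\<close> with \<open>n \<in> N' i\<close>; the reflection turns \<open>l\<close> into \<open>e z\<close>\<close>
        define t where "t = l \<bullet> b $ i"
        define n where "n = b $ i - t *\<^sub>R l"
        have n: "n \<in> N' i" using b l Suc(3)
          by (auto simp: N'_def n_def t_def inner_diff_right norm_eq_1 intro!: subspace_diff subspace_scale)
        have Rb: "R z i *v b $ i = n + t *\<^sub>R e z"
        proof -
          have "b $ i = n + t *\<^sub>R l" by (simp add: n_def)
          then show ?thesis using RN'[OF n] Rl by (simp add: matrix_vector_right_distrib matrix_vector_mult_scaleR)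
        qed
        define b' where "b' = (\<chi> j. if j = i then n else b $ j)"
        have b': "\<forall>j. b' $ j \<in> N' j" using b n by (auto simp: b'_def N'_def)
        have "B j *v ((\<chi> j. q $ j ** R z j) $ j *v b $ j) = B j *v (q $ j *v b' $ j) + (if j = i then t *\<^sub>R (B i *v (q $ i *v e z)) else 0)" for j
          using Rb by (auto simp: b'_def matrix_vector_mul_assoc[symmetric] R_def matrix_vector_right_distrib matrix_vector_mult_scaleR)
        with 0 have eq: "?S b' + t *\<^sub>R (B i *v (q $ i *v e z)) = 0" by (simp add: sum.distrib)
        have "t = 0"
        proof (rule ccontr)
          assume "t \<noteq> 0"
          have "?S b' \<in> U" using b' by (auto simp: U_def)
          moreover have "B i *v (q $ i *v e z) = (- inverse t) *\<^sub>R ?S b'"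
          proof -
            have "t *\<^sub>R (B i *v (q $ i *v e z)) = - ?S b'" using eq by (simp add: eq_neg_iff_add_eq_0 add.commute)
            then have "inverse t *\<^sub>R (t *\<^sub>R (B i *v (q $ i *v e z))) = inverse t *\<^sub>R (- ?S b')" by simp
            then show ?thesis using \<open>t \<noteq> 0\<close> by simp
          qed
          ultimately have "B i *v (q $ i *v e z) \<in> U" using subspace_scale[OF U] by presburger
          then have "e z \<in> W" by (simp add: W_def)
          with eW show False by simp
        qed
        with eq have "?S b' = 0" by simp
        with tr b' have "b' = 0" by (auto simp: transversal_def)
        moreover have "b = b'" using \<open>t = 0\<close> by (simp add: b'_def n_def vec_eq_iff)
        ultimately show "b = 0" by simp
      qed
    qed
  qed
  interpret G: pair_sigma_finite \<nu> "std_gaussian :: (real^'d) measure" ..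
  have "AE q in \<nu>. AE z in std_gaussian. transversal B N (\<chi> j. q $ j ** R z j)"
    using IH AE_orthogonal by eventually_elim (rule key)
  then have "AE z in std_gaussian. AE q in \<nu>. transversal B N (\<chi> j. q $ j ** R z j)"
  proof (subst (asm) G.AE_commute)
    have "(\<lambda>p. \<chi> j. fst p $ j ** R (snd p) j) \<in> \<nu> \<Otimes>\<^sub>M (std_gaussian :: (real^'d) measure) \<rightarrow>\<^sub>M borel"
      by measurable
    from measurable_sets[OF this trans_meas]
    show "{x \<in> space (\<nu> \<Otimes>\<^sub>M std_gaussian). transversal B N (\<chi> j. fst x $ j ** R (snd x) j)} \<in> sets (\<nu> \<Otimes>\<^sub>M std_gaussian)"
      by (simp add: vimage_def Int_def conj_commute)
  qed
  then obtain z where "AE q in \<nu>. transversal B N (\<chi> j. q $ j ** R z j)"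
    using std_gaussian.AE_False by (metis (mono_tags, lifting) eventually_mono)
  then show ?case by (rule AE_right_mult[OF trans_meas R_orth])
qed

end

section \<open>Faces of polyhedral cones\<close>

text \<open>For a point of a polyhedral cone this is the span of the smallest face containing it. The description by small
  segments does not mention the defining inequalities, so it is compatible with linear images, intersections and products.\<close>
definition face_span :: "'a::euclidean_space set \<Rightarrow> 'a \<Rightarrow> 'a set" where
  "face_span C x = {y. \<exists>e>0. x + e *\<^sub>R y \<in> C \<and> x - e *\<^sub>R y \<in> C}"

lemma polyhedral_cone_iff:
  "polyhedral_cone C \<longleftrightarrow> (\<exists>S. finite S \<and> C = {x. \<forall>a\<in>S. a \<bullet> x \<le> 0})"
proof
  assume "polyhedral_cone C"
  then obtain m :: nat and A where "C = {x. \<forall>i<m. A i \<bullet> x \<le> 0}" by (auto simp: polyhedral_cone_def)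
  then show "\<exists>S. finite S \<and> C = {x. \<forall>a\<in>S. a \<bullet> x \<le> 0}"
    by (intro exI[of _ "A ` {..<m}"]) auto
next
  assume "\<exists>S. finite S \<and> C = {x. \<forall>a\<in>S. a \<bullet> x \<le> 0}"
  then obtain S where S: "finite S" "C = {x. \<forall>a\<in>S. a \<bullet> x \<le> 0}" by auto
  obtain A and m :: nat where "S = A ` {i. i < m}"
    using finite_imp_nat_seg_image_inj_on[OF S(1)] by auto
  then show "polyhedral_cone C"
    unfolding polyhedral_cone_def S(2) by (intro exI[of _ m] exI[of _ A]) auto
qed

lemma polyhedral_coneE:
  assumes "polyhedral_cone C"
  obtains S where "finite S" "C = {x. \<forall>a\<in>S. a \<bullet> x \<le> 0}"
  using assms by (auto simp: polyhedral_cone_iff)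

lemma polyhedral_cone_family:
  assumes "\<And>i. polyhedral_cone (C i)"
  obtains S where "\<And>i. finite (S i)" "\<And>i. C i = {x. \<forall>a\<in>S i. a \<bullet> x \<le> 0}"
proof -
  have "\<forall>i. \<exists>S. finite S \<and> C i = {x. \<forall>a\<in>S. a \<bullet> x \<le> 0}"
    using assms unfolding polyhedral_cone_iff by (rule allI)
  from choice[OF this] that show thesis by blast
qed

text \<open>Inequalities that are strict at \<open>x\<close> stay strict for small \<open>e\<close>, so only the active ones constrain \<open>y\<close>.\<close>
lemma face_span_halfspaces:
  assumes S: "finite S" and C: "C = {x. \<forall>a\<in>S. a \<bullet> x \<le> 0}" and x: "x \<in> C"
  shows "face_span C x = {y. \<forall>a\<in>S. a \<bullet> x = 0 \<longrightarrow> a \<bullet> y = 0}"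
proof (intro set_eqI iffI)
  fix y assume "y \<in> face_span C x"
  then obtain e where e: "e > 0" "x + e *\<^sub>R y \<in> C" "x - e *\<^sub>R y \<in> C" by (auto simp: face_span_def)
  have "a \<bullet> y = 0" if a: "a \<in> S" "a \<bullet> x = 0" for a
  proof -
    have "e * (a \<bullet> y) \<le> 0" "- (e * (a \<bullet> y)) \<le> 0"
      using e(2,3) a by (auto simp: C inner_add_right inner_diff_right)
    then show ?thesis using e(1) by simp
  qed
  then show "y \<in> {y. \<forall>a\<in>S. a \<bullet> x = 0 \<longrightarrow> a \<bullet> y = 0}" by auto
next
  fix y assume y: "y \<in> {y. \<forall>a\<in>S. a \<bullet> x = 0 \<longrightarrow> a \<bullet> y = 0}"
  have "\<forall>\<^sub>F e in at_right (0::real). \<forall>a\<in>S. a \<bullet> x + e * (a \<bullet> y) \<le> 0 \<and> a \<bullet> x - e * (a \<bullet> y) \<le> 0"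
  proof (intro eventually_ball_finite S ballI)
    fix a assume a: "a \<in> S"
    show "\<forall>\<^sub>F e in at_right 0. a \<bullet> x + e * (a \<bullet> y) \<le> 0 \<and> a \<bullet> x - e * (a \<bullet> y) \<le> 0"
    proof (cases "a \<bullet> x = 0")
      case False
      then have neg: "a \<bullet> x < 0" using x a by (auto simp: C less_le)
      have "((\<lambda>e. a \<bullet> x + e * (a \<bullet> y)) \<longlongrightarrow> a \<bullet> x + 0 * (a \<bullet> y)) (at_right 0)"
        "((\<lambda>e. a \<bullet> x - e * (a \<bullet> y)) \<longlongrightarrow> a \<bullet> x - 0 * (a \<bullet> y)) (at_right 0)"
        by (intro tendsto_intros)+
      then have "\<forall>\<^sub>F e in at_right 0. a \<bullet> x + e * (a \<bullet> y) < 0" "\<forall>\<^sub>F e in at_right 0. a \<bullet> x - e * (a \<bullet> y) < 0"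
        using neg by (auto dest: order_tendstoD(2))
      then show ?thesis by eventually_elim auto
    qed (use y a in auto)
  qed
  moreover have "\<forall>\<^sub>F e in at_right (0::real). e > 0" by (simp add: eventually_at_right_less)
  ultimately have "\<forall>\<^sub>F e in at_right (0::real). e > 0 \<and> x + e *\<^sub>R y \<in> C \<and> x - e *\<^sub>R y \<in> C"
    by eventually_elim (auto simp: C inner_add_right inner_diff_right)
  then obtain e where "e > 0 \<and> x + e *\<^sub>R y \<in> C \<and> x - e *\<^sub>R y \<in> C"
    using eventually_happens'[OF trivial_limit_at_right_real] by blast
  then show "y \<in> face_span C x" by (auto simp: face_span_def)
qed

lemma convex_polyhedral_cone: "polyhedral_cone C \<Longrightarrow> convex C"
  by (erule polyhedral_coneE) (auto simp: Collect_ball_eq intro!: convex_INT convex_halfspace_le)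

lemma closed_polyhedral_cone: "polyhedral_cone C \<Longrightarrow> closed C"
  by (erule polyhedral_coneE) (auto simp: Collect_ball_eq intro!: closed_INT closed_halfspace_le)

lemma zero_in_polyhedral_cone: "polyhedral_cone C \<Longrightarrow> 0 \<in> C"
  by (erule polyhedral_coneE) auto

lemma scale_in_polyhedral_cone:
  assumes "polyhedral_cone C" "x \<in> C" "0 \<le> s" shows "s *\<^sub>R x \<in> C"
  using assms by (elim polyhedral_coneE) (auto simp: mult_nonneg_nonpos)

lemma convex_polar_cone: "convex (polar_cone C)"
  unfolding polar_cone_def by (auto simp: Collect_ball_eq intro!: convex_INT convex_halfspace_le)

lemma closed_polar_cone: "closed (polar_cone C)"
  unfolding polar_cone_def by (auto simp: Collect_ball_eq intro!: closed_INT closed_halfspace_le)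

lemma subspace_face_span:
  assumes "polyhedral_cone C" "x \<in> C" shows "subspace (face_span C x)"
proof -
  obtain S where S: "finite S" "C = {x. \<forall>a\<in>S. a \<bullet> x \<le> 0}" using assms(1) by (rule polyhedral_coneE)
  show ?thesis unfolding face_span_halfspaces[OF S assms(2)] by (auto simp: subspace_def inner_add_right)
qed

lemma self_in_face_span:
  assumes "polyhedral_cone C" "x \<in> C" shows "x \<in> face_span C x"
proof -
  obtain S where S: "finite S" "C = {x. \<forall>a\<in>S. a \<bullet> x \<le> 0}" using assms(1) by (rule polyhedral_coneE)
  show ?thesis unfolding face_span_halfspaces[OF S assms(2)] by auto
qed

text \<open>The linear functional \<open>z\<close> is nonpositive on \<open>C\<close> and vanishes at the midpoint \<open>x\<close> of a segment in \<open>C\<close>.\<close>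
lemma normal_orthogonal_face_span:
  assumes "z \<in> polar_cone C" "x \<bullet> z = 0" "y \<in> face_span C x"
  shows "y \<bullet> z = 0"
proof -
  obtain e where e: "e > 0" "x + e *\<^sub>R y \<in> C" "x - e *\<^sub>R y \<in> C" using assms(3) by (auto simp: face_span_def)
  have "(x + e *\<^sub>R y) \<bullet> z \<le> 0" "(x - e *\<^sub>R y) \<bullet> z \<le> 0" using e assms(1) by (auto simp: polar_cone_def)
  then have "e * (y \<bullet> z) \<le> 0" "- (e * (y \<bullet> z)) \<le> 0"
    using assms(2) by (simp_all add: inner_add_left inner_diff_left)
  then show ?thesis using e(1) by simp
qed

lemma face_span_scale:
  assumes "polyhedral_cone C" "x \<in> C" "0 < s" shows "face_span C (s *\<^sub>R x) = face_span C x"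
proof -
  obtain S where S: "finite S" "C = {x. \<forall>a\<in>S. a \<bullet> x \<le> 0}" using assms(1) by (rule polyhedral_coneE)
  have "s *\<^sub>R x \<in> C" using assms by (intro scale_in_polyhedral_cone) auto
  then show ?thesis using assms(3) face_span_halfspaces[OF S] assms(2) by simp
qed

lemma polyhedral_cone_Inter:
  fixes C :: "'n::finite \<Rightarrow> 'a::euclidean_space set"
  assumes C: "\<And>i. polyhedral_cone (C i)"
  shows "polyhedral_cone (\<Inter>i. C i)"
    and "(\<And>i. x \<in> C i) \<Longrightarrow> face_span (\<Inter>i. C i) x = (\<Inter>i. face_span (C i) x)"
proof -
  obtain S where S: "\<And>i. finite (S i)" "\<And>i. C i = {x. \<forall>a\<in>S i. a \<bullet> x \<le> 0}"
    using polyhedral_cone_family[of C, OF C] by blast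
  have fin: "finite (\<Union>i. S i)" using S(1) by auto
  have eq: "(\<Inter>i. C i) = {x. \<forall>a\<in>(\<Union>i. S i). a \<bullet> x \<le> 0}" using S(2) by auto
  show "polyhedral_cone (\<Inter>i. C i)" unfolding polyhedral_cone_iff using fin eq by blast
  assume x: "\<And>i. x \<in> C i"
  then have "x \<in> (\<Inter>i. C i)" by auto
  then show "face_span (\<Inter>i. C i) x = (\<Inter>i. face_span (C i) x)"
    using face_span_halfspaces[OF S x] face_span_halfspaces[OF fin eq] by auto
qed

lemma polyhedral_cone_product:
  fixes C :: "'n::finite \<Rightarrow> (real^'d) set"
  assumes C: "\<And>i. polyhedral_cone (C i)"
  shows "polyhedral_cone (cone_product C)"
    and "x \<in> cone_product C \<Longrightarrow> face_span (cone_product C) x = {y. \<forall>i. y $ i \<in> face_span (C i) (x $ i)}"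
proof -
  obtain S where S: "\<And>i. finite (S i)" "\<And>i. C i = {x. \<forall>a\<in>S i. a \<bullet> x \<le> 0}"
    using polyhedral_cone_family[of C, OF C] by blast
  let ?S = "\<Union>i. axis i ` S i"
  have fin: "finite ?S" using S(1) by auto
  have eq: "cone_product C = {x. \<forall>a\<in>?S. a \<bullet> x \<le> 0}"
    using S(2) by (auto simp: cone_product_def inner_axis')
  show "polyhedral_cone (cone_product C)" unfolding polyhedral_cone_iff using fin eq by blast
  assume x: "x \<in> cone_product C"
  then have "x $ i \<in> C i" for i by (auto simp: cone_product_def)
  then show "face_span (cone_product C) x = {y. \<forall>i. y $ i \<in> face_span (C i) (x $ i)}"
    unfolding face_span_halfspaces[OF fin eq x] using face_span_halfspaces[OF S] by (auto simp: inner_axis')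
qed

lemma inner_transpose_matrix_inv:
  fixes T :: "real^'d^'d"
  assumes "invertible T"
  shows "(T *v x) \<bullet> (transpose (matrix_inv T) *v y) = x \<bullet> y"
proof -
  have "(T *v x) \<bullet> (transpose (matrix_inv T) *v y) = (matrix_inv T *v (T *v x)) \<bullet> y"
    by (metis dot_lmul_matrix inner_commute transpose_matrix_vector transpose_transpose)
  also have "\<dots> = x \<bullet> y" by (simp add: matrix_vector_mul_assoc matrix_inv_left[OF assms])
  finally show ?thesis .
qed

lemma polyhedral_cone_image:
  fixes T :: "real^'d^'d"
  assumes T: "invertible T" and C: "polyhedral_cone C"
  shows "polyhedral_cone (cone_image T C)"
proof -
  obtain S where S: "finite S" "C = {x. \<forall>a\<in>S. a \<bullet> x \<le> 0}" using C by (rule polyhedral_coneE)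
  have "cone_image T C = {x. \<forall>a\<in>(\<lambda>a. transpose (matrix_inv T) *v a) ` S. a \<bullet> x \<le> 0}"
  proof (intro set_eqI iffI)
    fix x assume x: "x \<in> {x. \<forall>a\<in>(\<lambda>a. transpose (matrix_inv T) *v a) ` S. a \<bullet> x \<le> 0}"
    have "T *v (matrix_inv T *v x) = x" by (simp add: matrix_vector_mul_assoc matrix_inv_right[OF T])
    moreover from this have "matrix_inv T *v x \<in> C"
      using x inner_transpose_matrix_inv[OF T, of "matrix_inv T *v x"] by (auto simp: S(2) inner_commute)
    ultimately show "x \<in> cone_image T C" unfolding cone_image_def by (metis imageI)
  qed (auto simp: cone_image_def S(2) inner_transpose_matrix_inv[OF T] inner_commute simp del: transpose_matrix_vector)
  with S(1) show ?thesis unfolding polyhedral_cone_iff by blast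
qed

lemma face_span_cone_image:
  fixes T :: "real^'d^'d"
  assumes T: "invertible T"
  shows "face_span (cone_image T C) (T *v x) = (\<lambda>y. T *v y) ` face_span C x"
proof -
  have inj: "T *v x = T *v y \<longleftrightarrow> x = y" for x y
    using inj_matrix_vector_mult[OF T] by (auto dest: injD)
  have mem: "T *v y \<in> cone_image T C \<longleftrightarrow> y \<in> C" for y by (auto simp: cone_image_def inj)
  have iff: "T *v y \<in> face_span (cone_image T C) (T *v x) \<longleftrightarrow> y \<in> face_span C x" for y
    unfolding face_span_def mem_Collect_eq
    by (simp add: matrix_vector_mult_scaleR[symmetric] matrix_vector_right_distrib[symmetric]
        matrix_vector_mult_diff_distrib[symmetric] mem)
  have "\<exists>x. y = T *v x" for y
    by (metis T matrix_inv_right matrix_vector_mul_assoc matrix_vector_mul_lid)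
  then show ?thesis using iff by (force simp: image_iff)
qed

text \<open>A face span is determined by the set of active inequalities.\<close>
lemma finite_face_spans:
  assumes "polyhedral_cone C" shows "finite (face_span C ` C)"
proof -
  obtain S where S: "finite S" "C = {x. \<forall>a\<in>S. a \<bullet> x \<le> 0}" using assms by (rule polyhedral_coneE)
  have "face_span C ` C \<subseteq> (\<lambda>I. {y. \<forall>a\<in>I. a \<bullet> y = 0}) ` Pow S"
  proof
    fix L assume "L \<in> face_span C ` C"
    then obtain x where "x \<in> C" "L = face_span C x" by auto
    then have "L = {y. \<forall>a\<in>{a\<in>S. a \<bullet> x = 0}. a \<bullet> y = 0}" using face_span_halfspaces[OF S] by auto
    then show "L \<in> (\<lambda>I. {y. \<forall>a\<in>I. a \<bullet> y = 0}) ` Pow S" by blast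
  qed
  then show ?thesis using S(1) by (meson finite_Pow_iff finite_imageI finite_subset)
qed

lemma borel_face_stratum:
  assumes "polyhedral_cone C" shows "{x \<in> C. face_span C x = L} \<in> sets borel"
proof -
  obtain S where S: "finite S" "C = {x. \<forall>a\<in>S. a \<bullet> x \<le> 0}" using assms by (rule polyhedral_coneE)
  let ?A = "\<lambda>I. {x. \<forall>a\<in>S. if a \<in> I then a \<bullet> x = 0 else a \<bullet> x < 0}"
  have "{x \<in> C. face_span C x = L} = (\<Union>I\<in>{I\<in>Pow S. {y. \<forall>a\<in>I. a \<bullet> y = 0} = L}. ?A I)" (is "_ = ?R")
  proof (intro set_eqI iffI)
    fix x assume x: "x \<in> {x \<in> C. face_span C x = L}"
    let ?I = "{a\<in>S. a \<bullet> x = 0}"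
    have "{y. \<forall>a\<in>?I. a \<bullet> y = 0} = L" using x face_span_halfspaces[OF S] by auto
    then have "?I \<in> {I\<in>Pow S. {y. \<forall>a\<in>I. a \<bullet> y = 0} = L}" by (intro CollectI conjI) auto
    moreover have "x \<in> ?A ?I" using x S(2) by (auto simp: less_le)
    ultimately show "x \<in> ?R" by (rule UN_I)
  next
    fix x assume "x \<in> ?R"
    then obtain I where I: "I \<subseteq> S" "{y. \<forall>a\<in>I. a \<bullet> y = 0} = L" "x \<in> ?A I" by auto
    have x: "x \<in> C" using I(3) by (auto simp: S(2) split: if_splits intro: less_imp_le)
    have "{y. \<forall>a\<in>S. a \<bullet> x = 0 \<longrightarrow> a \<bullet> y = 0} = {y. \<forall>a\<in>I. a \<bullet> y = 0}"
    proof -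
      have "a \<bullet> x = 0 \<longleftrightarrow> a \<in> I" if "a \<in> S" for a
        using I(3) that by (cases "a \<in> I") auto
      then show ?thesis using I(1) by auto
    qed
    then show "x \<in> {x \<in> C. face_span C x = L}" using x I(2) face_span_halfspaces[OF S x] by auto
  qed
  moreover have "?A I \<in> sets borel" for I
  proof -
    have "{x. if a \<in> I then a \<bullet> x = 0 else a \<bullet> x < 0} \<in> sets borel" for a
      by (cases "a \<in> I") (auto intro!: borel_closed closed_hyperplane borel_open open_halfspace_lt)
    then have "{x\<in>space borel. \<forall>a\<in>S. if a \<in> I then a \<bullet> x = 0 else a \<bullet> x < 0} \<in> sets borel"
      by (intro sets.sets_Collect_finite_All S(1)) simp
    then show ?thesis by simp
  qed
  ultimately show ?thesis using S(1) by (auto intro!: sets.finite_UN)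
qed

text \<open>If \<open>x\<close> is interior to \<open>C \<inter> L\<close> relative to the span \<open>L\<close> of a face \<open>{x \<in> C. x \<bullet> z = 0}\<close>, then
  \<open>face_span C x = L\<close>: short segments around \<open>x\<close> in \<open>L\<close> stay in \<open>C\<close>, and segments around \<open>x\<close> in \<open>C\<close> are
  orthogonal to \<open>z\<close>, so they stay in the face. Conversely, the sum \<open>z\<close> of the normals of the inequalities active at \<open>x\<close>
  exposes a face with span \<open>face_span C x\<close>.\<close>
lemma skeleton_polyhedral_cone:
  assumes "polyhedral_cone C"
  shows "skeleton k C = {x \<in> C. dim (face_span C x) = k}"
proof (intro set_eqI iffI)
  fix x assume "x \<in> skeleton k C"
  then obtain F z where F: "F = {x \<in> C. x \<bullet> z = 0}" "z \<in> polar_cone C" "dim (span F) = k"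
    and "x \<in> top_of_set (span F) interior_of (C \<inter> span F)"
    by (auto simp: skeleton_def face_spans_def cone_faces_def)
  then obtain U where U: "openin (top_of_set (span F)) U" "x \<in> U" "U \<subseteq> C \<inter> span F"
    by (auto simp: interior_of_def)
  then obtain \<delta> where \<delta>: "\<delta> > 0" "\<And>y. y \<in> span F \<Longrightarrow> dist y x < \<delta> \<Longrightarrow> y \<in> U"
    unfolding openin_euclidean_subtopology_iff by blast
  have x: "x \<in> C" "x \<in> span F" using U by auto
  have Fz: "y \<bullet> z = 0" if "y \<in> span F" for y
  proof -
    have "subspace {y. y \<bullet> z = 0}" by (auto simp: subspace_def inner_add_left)
    then have "span F \<subseteq> {y. y \<bullet> z = 0}" by (intro span_minimal) (auto simp: F(1))
    with that show ?thesis by auto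
  qed
  have "face_span C x = span F"
  proof (intro set_eqI iffI)
    fix y assume "y \<in> face_span C x"
    then obtain e where e: "e > 0" "x + e *\<^sub>R y \<in> C" by (auto simp: face_span_def)
    have "y \<bullet> z = 0"
      by (rule normal_orthogonal_face_span[OF F(2) Fz[OF x(2)] \<open>y \<in> face_span C x\<close>])
    then have "x + e *\<^sub>R y \<in> span F"
      using e Fz[OF x(2)] by (intro span_base) (auto simp: F(1) inner_add_left)
    then have "inverse e *\<^sub>R (x + e *\<^sub>R y - x) \<in> span F" using x(2) by (intro span_scale span_diff)
    then show "y \<in> span F" using e(1) by simp
  next
    fix y assume y: "y \<in> span F"
    \<comment> \<open>\<open>e * norm y < \<delta>\<close>, also for \<open>y = 0\<close>\<close>
    define e where "e = \<delta> / (2 * (norm y + 1))"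
    have e: "e > 0" using \<delta>(1) by (auto simp: e_def intro!: divide_pos_pos add_nonneg_pos)
    have "e * norm y < \<delta>"
    proof -
      have "norm y < 2 * (norm y + 1)" by (smt (verit) norm_ge_zero)
      then show ?thesis using \<delta>(1) by (simp add: e_def divide_less_eq pos_divide_less_eq add_nonneg_pos)
    qed
    then have "x + e *\<^sub>R y \<in> U" "x - e *\<^sub>R y \<in> U"
      using e x(2) y by (auto intro!: \<delta>(2) span_add span_diff span_scale simp: dist_norm)
    then show "y \<in> face_span C x" using e U(3) by (auto simp: face_span_def)
  qed
  then show "x \<in> {x \<in> C. dim (face_span C x) = k}" using x F(3) by simp
next
  fix x assume "x \<in> {x \<in> C. dim (face_span C x) = k}"
  then have x: "x \<in> C" "dim (face_span C x) = k" by auto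
  obtain S where S: "finite S" "C = {x. \<forall>a\<in>S. a \<bullet> x \<le> 0}" using assms by (rule polyhedral_coneE)
  define L where "L = face_span C x"
  have L: "L = {y. \<forall>a\<in>S. a \<bullet> x = 0 \<longrightarrow> a \<bullet> y = 0}" unfolding L_def by (rule face_span_halfspaces[OF S x(1)])
  have subL: "subspace L" "x \<in> L" unfolding L_def using subspace_face_span self_in_face_span assms x by auto
  define z where "z = (\<Sum>a\<in>{a\<in>S. a \<bullet> x = 0}. a)"
  have z: "z \<in> polar_cone C"
    by (auto simp: polar_cone_def z_def inner_sum_right S(2) inner_commute intro!: sum_nonpos)
  define F where "F = {y \<in> C. y \<bullet> z = 0}"
  have F: "F = C \<inter> L"
  proof (intro set_eqI iffI)
    fix y assume y: "y \<in> F"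
    then have "(\<Sum>a\<in>{a\<in>S. a \<bullet> x = 0}. - (a \<bullet> y)) = 0"
      by (simp add: F_def z_def inner_sum_right inner_commute sum_negf)
    then have "\<forall>a\<in>{a\<in>S. a \<bullet> x = 0}. - (a \<bullet> y) = 0"
      using y S by (subst (asm) sum_nonneg_eq_0_iff) (auto simp: F_def)
    then show "y \<in> C \<inter> L" using y by (auto simp: L F_def)
  qed (auto simp: F_def z_def L inner_sum_right inner_commute intro!: sum.neutral)
  have "span F = L"
  proof
    show "span F \<subseteq> L" using F subL by (intro span_minimal) auto
    show "L \<subseteq> span F"
    proof
      fix y assume y: "y \<in> L"
      then obtain e where e: "e > 0" "x + e *\<^sub>R y \<in> C" by (auto simp: L_def face_span_def)
      have "x + e *\<^sub>R y \<in> F" "x \<in> F" using e y x(1) subL unfolding F by (auto intro: subspace_add subspace_scale)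
      then have "inverse e *\<^sub>R (x + e *\<^sub>R y - x) \<in> span F" by (intro span_scale span_diff span_base)
      then show "y \<in> span F" using e(1) by simp
    qed
  qed
  moreover have "F \<in> cone_faces C" using z by (auto simp: cone_faces_def F_def)
  ultimately have "L \<in> face_spans k C"
    using x(2) by (auto simp: face_spans_def L_def[symmetric] intro!: exI[of _ F])
  moreover have "x \<in> top_of_set L interior_of (C \<inter> L)"
  proof -
    let ?U = "{y. \<forall>a\<in>{a\<in>S. a \<bullet> x < 0}. a \<bullet> y < 0}"
    have "open (\<Inter>a\<in>{a\<in>S. a \<bullet> x < 0}. {y. a \<bullet> y < 0})" using S(1) by (intro open_INT) (auto intro: open_halfspace_lt)
    also have "(\<Inter>a\<in>{a\<in>S. a \<bullet> x < 0}. {y. a \<bullet> y < 0}) = ?U" by auto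
    finally have "open ?U" .
    then have "openin (top_of_set L) (L \<inter> ?U)" by (rule openin_open_Int)
    moreover have "L \<inter> ?U \<subseteq> C \<inter> L"
    proof
      fix y assume y: "y \<in> L \<inter> ?U"
      have "a \<bullet> y \<le> 0" if "a \<in> S" for a
      proof -
        have "a \<bullet> x = 0 \<or> a \<bullet> x < 0" using x(1) that by (auto simp: S(2) less_le)
        then show ?thesis using y that by (auto simp: L intro: less_imp_le)
      qed
      with y show "y \<in> C \<inter> L" by (auto simp: S(2))
    qed
    ultimately show ?thesis using subL(2) by (auto simp: interior_of_def)
  qed
  ultimately show "x \<in> skeleton k C" by (auto simp: skeleton_def)
qed

lemma moreau_unique:
  assumes C: "convex C" "closed C" and xz: "(x, z) \<in> biconic_lift C"
  shows "closest_point C (x + z) = x" and "closest_point (polar_cone C) (x + z) = z"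
proof -
  have x: "x \<in> C" and z: "z \<in> polar_cone C" and 0: "x \<bullet> z = 0" using xz by (auto simp: biconic_lift_def)
  have "dist (x + z) x \<le> dist (x + z) y" if "y \<in> C" for y
  proof -
    have "y \<bullet> z \<le> 0" using z that by (auto simp: polar_cone_def)
    then have "z \<bullet> z \<le> (x + z - y) \<bullet> (x + z - y)"
      using 0 inner_ge_zero[of "x - y"] by (simp add: inner_diff_left inner_diff_right inner_add_left inner_add_right inner_commute)
    then show ?thesis by (simp add: dist_norm norm_le)
  qed
  then show "closest_point C (x + z) = x" by (intro closest_point_unique[symmetric] C x) auto
  have "dist (x + z) z \<le> dist (x + z) y" if "y \<in> polar_cone C" for y
  proof -
    have "x \<bullet> y \<le> 0" using x that by (auto simp: polar_cone_def)
    then have "x \<bullet> x \<le> (x + z - y) \<bullet> (x + z - y)"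
      using 0 inner_ge_zero[of "z - y"] by (simp add: inner_diff_left inner_diff_right inner_add_left inner_add_right inner_commute)
    then show ?thesis by (simp add: dist_norm norm_le)
  qed
  then show "closest_point (polar_cone C) (x + z) = z"
    by (intro closest_point_unique[symmetric] convex_polar_cone closed_polar_cone z) auto
qed

text \<open>The variational inequality at the nearest point, tested with \<open>0\<close> and with twice the nearest point, gives
  orthogonality; tested with any point of \<open>C\<close>, it then gives membership of the residual in the polar cone.\<close>
lemma moreau_exists:
  assumes C: "polyhedral_cone C"
  shows "(closest_point C g, g - closest_point C g) \<in> biconic_lift C"
proof -
  let ?x = "closest_point C g"
  note cC = convex_polyhedral_cone[OF C] closed_polyhedral_cone[OF C]
  have x: "?x \<in> C" using zero_in_polyhedral_cone[OF C] by (intro closest_point_in_set cC) auto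
  have dot: "(g - ?x) \<bullet> (y - ?x) \<le> 0" if "y \<in> C" for y by (rule closest_point_dot[OF cC that])
  have "2 *\<^sub>R ?x \<in> C" by (rule scale_in_polyhedral_cone[OF C x]) simp
  from dot[OF this] dot[OF zero_in_polyhedral_cone[OF C]]
  have 0: "(g - ?x) \<bullet> ?x = 0" by (simp add: scaleR_2)
  have "y \<bullet> (g - ?x) \<le> 0" if "y \<in> C" for y
    using dot[OF that] 0 by (simp add: inner_diff_right inner_commute)
  with x 0 show ?thesis by (auto simp: biconic_lift_def polar_cone_def inner_commute)
qed

text \<open>By the Moreau decomposition the two nearest point maps disappear: the points \<open>x + z\<close> with
  \<open>(x, z) \<in> biconic_lift C\<close> have nearest points \<open>x\<close> and \<open>z\<close>.\<close>
lemma support_measure_eq: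
  fixes C :: "'a::euclidean_space set"
  assumes C: "polyhedral_cone C" and M: "M \<subseteq> biconic_lift C"
  shows "support_measure k C M =
    measure (completion std_gaussian) {x + z |x z. (x, z) \<in> M \<and> dim (face_span C x) = k}"
proof -
  note cC = convex_polyhedral_cone[OF C] closed_polyhedral_cone[OF C]
  have "{g. closest_point C g \<in> skeleton k C \<and> (closest_point C g, closest_point (polar_cone C) g) \<in> M}
      = {x + z |x z. (x, z) \<in> M \<and> dim (face_span C x) = k}"
  proof (intro set_eqI iffI)
    fix g assume g: "g \<in> {g. closest_point C g \<in> skeleton k C \<and> (closest_point C g, closest_point (polar_cone C) g) \<in> M}"
    have "closest_point (polar_cone C) g = g - closest_point C g"
      using moreau_unique(2)[OF cC moreau_exists[OF C], of g] by simp
    with g show "g \<in> {x + z |x z. (x, z) \<in> M \<and> dim (face_span C x) = k}"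
      unfolding skeleton_polyhedral_cone[OF C] by clarsimp (metis add.commute diff_add_cancel)
  next
    fix g assume "g \<in> {x + z |x z. (x, z) \<in> M \<and> dim (face_span C x) = k}"
    then obtain x z where g: "g = x + z" "(x, z) \<in> M" "dim (face_span C x) = k" by auto
    then have BL: "(x, z) \<in> biconic_lift C" using M by auto
    then have "x \<in> C" by (auto simp: biconic_lift_def)
    with g moreau_unique[OF cC BL]
    show "g \<in> {g. closest_point C g \<in> skeleton k C \<and> (closest_point C g, closest_point (polar_cone C) g) \<in> M}"
      by (simp add: skeleton_polyhedral_cone[OF C])
  qed
  then show ?thesis by (simp add: support_measure_def)
qed

text \<open>The pairs whose first component lies in the relative interior of the face of \<open>C\<close> with span \<open>L\<close>.\<close>
definition face_part :: "'a::euclidean_space set \<Rightarrow> ('a \<times> 'a) set \<Rightarrow> 'a set \<Rightarrow> ('a \<times> 'a) set" where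
  "face_part C M L = {(x, z) \<in> M. face_span C x = L}"

lemma face_part_biconic:
  assumes C: "polyhedral_cone C" and M: "M \<in> biconic_sets" "M \<subseteq> biconic_lift C"
  shows "face_part C M L \<in> sets borel"
    and "\<And>s t x z. 0 < s \<Longrightarrow> 0 < t \<Longrightarrow> (s *\<^sub>R x, t *\<^sub>R z) \<in> face_part C M L \<longleftrightarrow> (x, z) \<in> face_part C M L"
    and "\<And>x z. (x, z) \<in> face_part C M L \<Longrightarrow> x \<in> L \<and> z \<in> L\<^sup>\<bottom>"
proof -
  have MC: "x \<in> C" "z \<in> polar_cone C" "x \<bullet> z = 0" if "(x, z) \<in> M" for x z
    using that M(2) by (auto simp: biconic_lift_def)
  have "face_part C M L = M \<inter> fst -` {x \<in> C. face_span C x = L}"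
    using MC(1) by (auto simp: face_part_def)
  moreover have "fst -` {x \<in> C. face_span C x = L} \<inter> space (borel :: ('a \<times> 'a) measure) \<in> sets borel"
    by (rule measurable_sets[OF borel_measurable_continuous_onI borel_face_stratum[OF C]]) (intro continuous_intros)
  ultimately show "face_part C M L \<in> sets borel" using M(1) by (auto simp: biconic_sets_def)
  have scaled: "(s *\<^sub>R x, t *\<^sub>R z) \<in> face_part C M L" if "0 < s" "0 < t" "(x, z) \<in> face_part C M L" for s t x z
  proof -
    have "(\<lambda>(x, x'). (s *\<^sub>R x, t *\<^sub>R x')) ` M = M" using M(1) that by (auto simp: biconic_sets_def)
    then have "(s *\<^sub>R x, t *\<^sub>R z) \<in> M" using that(3) by (force simp: face_part_def)
    then show ?thesis using that face_span_scale[OF C] MC(1) by (auto simp: face_part_def)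
  qed
  show "(s *\<^sub>R x, t *\<^sub>R z) \<in> face_part C M L \<longleftrightarrow> (x, z) \<in> face_part C M L" if "0 < s" "0 < t" for s t x z
    using scaled[of s t x z] scaled[of "inverse s" "inverse t" "s *\<^sub>R x" "t *\<^sub>R z"] that by auto
  show "x \<in> L \<and> z \<in> L\<^sup>\<bottom>" if "(x, z) \<in> face_part C M L" for x z
    using that MC[of x z] self_in_face_span[OF C] normal_orthogonal_face_span
    by (auto simp: face_part_def orthogonal_comp_def orthogonal_def)
qed

section \<open>Uniqueness of stabilizer-invariant laws of directions\<close>

definition rotate :: "('n::finite \<Rightarrow> real^'d^'d) \<Rightarrow> real^'d^'n \<Rightarrow> real^'d^'n" where
  "rotate R x = (\<chi> i. R i *v x $ i)"

definition rotate2 :: "('n::finite \<Rightarrow> real^'d^'d) \<Rightarrow> (real^'d^'n) \<times> (real^'d^'n) \<Rightarrow> (real^'d^'n) \<times> (real^'d^'n)" where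
  "rotate2 R p = (rotate R (fst p), rotate R (snd p))"

text \<open>As \<open>sgn 0 = 0\<close>, trivial components are kept and no case distinction is needed for zero-dimensional spaces.\<close>
definition directions :: "(real^'d^'n::finite) \<times> (real^'d^'n) \<Rightarrow> (real^'d^'n) \<times> (real^'d^'n)" where
  "directions p = (\<chi> i. sgn (fst p $ i), \<chi> i. sgn (snd p $ i))"

definition stabilizes :: "('n \<Rightarrow> real^'d^'d) \<Rightarrow> ('n \<Rightarrow> (real^'d) set) \<Rightarrow> bool" where
  "stabilizes R L \<longleftrightarrow> (\<forall>i. orthogonal_matrix (R i) \<and> (\<forall>x\<in>L i. R i *v x \<in> L i) \<and> (\<forall>x\<in>(L i)\<^sup>\<bottom>. R i *v x \<in> (L i)\<^sup>\<bottom>))"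

text \<open>A pair with a well-defined direction in every nontrivial \<open>L\<^sub>i\<close> and \<open>L\<^sub>i\<^sup>\<bottom>\<close>; its image under \<open>directions\<close> lies
  in a product of spheres.\<close>
definition nondegenerate :: "('n \<Rightarrow> (real^'d) set) \<Rightarrow> (real^'d^'n::finite) \<times> (real^'d^'n) \<Rightarrow> bool" where
  "nondegenerate L p \<longleftrightarrow> (\<forall>i. fst p $ i \<in> L i \<and> snd p $ i \<in> (L i)\<^sup>\<bottom> \<and>
     (L i \<noteq> {0} \<longrightarrow> fst p $ i \<noteq> 0) \<and> ((L i)\<^sup>\<bottom> \<noteq> {0} \<longrightarrow> snd p $ i \<noteq> 0))"

lemma norm_orthogonal_matrix_mult: "orthogonal_matrix R \<Longrightarrow> norm (R *v x) = norm (x :: real^'d)"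
  using orthogonal_transformation_norm[of "(*v) R" x] by (simp add: orthogonal_transformation_matrix)

lemma orthogonal_transformation_rotate:
  assumes "\<And>i. orthogonal_matrix (R i)" shows "orthogonal_transformation (rotate R)"
proof -
  have "linear (rotate R)"
    by (auto simp: linear_iff rotate_def vec_eq_iff matrix_vector_right_distrib matrix_vector_mult_scaleR)
  moreover have "norm (rotate R x) = norm x" for x
    unfolding norm_vec_def[of "rotate R x"] norm_vec_def[of x]
    by (simp add: rotate_def norm_orthogonal_matrix_mult[OF assms])
  ultimately show ?thesis by (simp add: orthogonal_transformation)
qed

lemma dist_rotate2:
  assumes "\<And>i. orthogonal_matrix (R i)" shows "dist (rotate2 R p) (rotate2 R p') = dist p p'"
  using orthogonal_transformation_rotate[of R, OF assms]
  by (simp add: rotate2_def dist_prod_def orthogonal_transformation_isometry)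

lemma borel_measurable_rotate [measurable]: "rotate R \<in> borel_measurable borel"
  unfolding rotate_def by (intro borel_measurable_continuous_onI continuous_intros)

lemma borel_measurable_rotate2 [measurable]: "rotate2 R \<in> borel_measurable borel"
  unfolding rotate2_def rotate_def by (intro borel_measurable_continuous_onI continuous_intros)

lemma borel_measurable_directions [measurable]: "directions \<in> borel_measurable borel"
proof -
  have *: "(\<lambda>p. \<chi> i. sgn (f p $ i)) \<in> borel_measurable borel"
    if "continuous_on UNIV f" for f :: "(real^'d^'n::finite) \<times> (real^'d^'n) \<Rightarrow> real^'d^'n"
  proof -
    have [measurable]: "f \<in> borel_measurable borel" by (rule borel_measurable_continuous_onI[OF that])
    show ?thesis unfolding sgn_div_norm by measurable
  qed
  show ?thesis unfolding directions_def
    by (intro borel_measurable_Pair * continuous_intros)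
qed

lemma directions_rotate2:
  assumes "\<And>i. orthogonal_matrix (R i)"
  shows "directions (rotate2 R p) = rotate2 R (directions p)"
  by (simp add: directions_def rotate2_def rotate_def vec_eq_iff sgn_div_norm norm_orthogonal_matrix_mult[OF assms]
      matrix_vector_mult_scaleR)

text \<open>In each component the product of two reflections works, one in the difference of the vectors in \<open>L\<^sub>i\<close> and one in the
  difference of those in \<open>L\<^sub>i\<^sup>\<bottom>\<close>: each of them fixes the other subspace pointwise.\<close>
lemma stabilizes_transitive:
  fixes L :: "'n::finite \<Rightarrow> (real^'d) set"
  assumes L: "\<And>i. subspace (L i)"
    and p: "\<And>i. fst p $ i \<in> L i \<and> snd p $ i \<in> (L i)\<^sup>\<bottom>" and p': "\<And>i. fst p' $ i \<in> L i \<and> snd p' $ i \<in> (L i)\<^sup>\<bottom>"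
    and norm: "\<And>i. norm (fst p $ i) = norm (fst p' $ i)" "\<And>i. norm (snd p $ i) = norm (snd p' $ i)"
  obtains R where "stabilizes R L" "rotate2 R p = p'"
proof
  define R where "R i = reflection (snd p $ i - snd p' $ i) ** reflection (fst p $ i - fst p' $ i)" for i
  have perp: "x \<bullet> y = 0" "y \<bullet> x = 0" if "x \<in> L i" "y \<in> (L i)\<^sup>\<bottom>" for x y i
    using that by (auto simp: orthogonal_comp_def orthogonal_def inner_commute)
  have d: "fst p $ i - fst p' $ i \<in> L i" "snd p $ i - snd p' $ i \<in> (L i)\<^sup>\<bottom>" for i
    using p p' by (auto intro!: subspace_diff L subspace_orthogonal_comp)
  have Rx: "R i *v x = reflection (fst p $ i - fst p' $ i) *v x" if x: "x \<in> L i" for i x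
  proof -
    have "reflection (fst p $ i - fst p' $ i) *v x \<in> L i"
      unfolding reflection_mult by (rule subspace_diff[OF L x subspace_scale[OF L d(1)]])
    then have "reflection (snd p $ i - snd p' $ i) *v (reflection (fst p $ i - fst p' $ i) *v x)
        = reflection (fst p $ i - fst p' $ i) *v x"
      by (intro reflection_fix perp(2)[OF _ d(2)])
    then show ?thesis by (simp add: R_def matrix_vector_mul_assoc)
  qed
  have Ry: "R i *v y = reflection (snd p $ i - snd p' $ i) *v y" if y: "y \<in> (L i)\<^sup>\<bottom>" for i y
    using reflection_fix[OF perp(1)[OF d(1) y]] by (simp add: R_def matrix_vector_mul_assoc[symmetric])
  show "stabilizes R L"
    unfolding stabilizes_def
  proof (intro allI conjI ballI)
    show "orthogonal_matrix (R i)" for i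
      unfolding R_def by (intro orthogonal_matrix_mul orthogonal_matrix_reflection)
    show "R i *v x \<in> L i" if "x \<in> L i" for i x
      unfolding Rx[OF that] reflection_mult by (rule subspace_diff[OF L that subspace_scale[OF L d(1)]])
    show "R i *v y \<in> (L i)\<^sup>\<bottom>" if "y \<in> (L i)\<^sup>\<bottom>" for i y
      unfolding Ry[OF that] reflection_mult
      by (rule subspace_diff[OF subspace_orthogonal_comp that subspace_scale[OF subspace_orthogonal_comp d(2)]])
  qed
  have "R i *v fst p $ i = fst p' $ i" "R i *v snd p $ i = snd p' $ i" for i
    using p by (simp_all add: Rx Ry reflection_swap norm)
  then show "rotate2 R p = p'" by (simp add: rotate2_def rotate_def prod_eq_iff vec_eq_iff)
qed

text \<open>Both laws of directions live on the product \<open>X\<close> of the unit spheres of the \<open>L\<^sub>i\<close> and \<open>L\<^sub>i\<^sup>\<bottom>\<close>. The stabilizer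
  acts on \<open>X\<close> transitively by isometries that preserve the laws, so balls of equal radius have equal measure.\<close>
lemma invariant_direction_law_unique:
  fixes L :: "'n::finite \<Rightarrow> (real^'d) set" and \<kappa> \<rho> :: "((real^'d^'n) \<times> (real^'d^'n)) measure"
  assumes L: "\<And>i. subspace (L i)"
    and 1: "prob_space \<kappa>" "sets \<kappa> = sets borel" "AE p in \<kappa>. nondegenerate L p"
      "\<And>R. stabilizes R L \<Longrightarrow> distr \<kappa> borel (rotate2 R) = \<kappa>"
    and 2: "prob_space \<rho>" "sets \<rho> = sets borel" "AE p in \<rho>. nondegenerate L p"
      "\<And>R. stabilizes R L \<Longrightarrow> distr \<rho> borel (rotate2 R) = \<rho>"
  shows "distr \<kappa> borel directions = distr \<rho> borel directions"
proof -
  define X where "X = {p :: (real^'d^'n) \<times> (real^'d^'n). \<forall>i. fst p $ i \<in> L i \<and> snd p $ i \<in> (L i)\<^sup>\<bottom> \<and>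
     norm (fst p $ i) = (if L i = {0} then 0 else 1) \<and> norm (snd p $ i) = (if (L i)\<^sup>\<bottom> = {0} then 0 else 1)}"
  have X_borel: "X \<in> sets borel"
    unfolding X_def
    by (intro borel_closed closed_Collect_all closed_Collect_conj closed_Collect_eq continuous_intros
        continuous_closed_vimage[unfolded vimage_def] closed_subspace L subspace_orthogonal_comp)
  have dir_X: "directions p \<in> X" if "nondegenerate L p" for p
    unfolding X_def mem_Collect_eq
  proof (intro allI conjI)
    fix i
    have p: "fst p $ i \<in> L i" "snd p $ i \<in> (L i)\<^sup>\<bottom>" "L i \<noteq> {0} \<Longrightarrow> fst p $ i \<noteq> 0" "(L i)\<^sup>\<bottom> \<noteq> {0} \<Longrightarrow> snd p $ i \<noteq> 0"
      using that by (auto simp: nondegenerate_def)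
    show "fst (directions p) $ i \<in> L i" "snd (directions p) $ i \<in> (L i)\<^sup>\<bottom>"
      using p by (auto simp: directions_def sgn_div_norm intro!: subspace_scale L subspace_orthogonal_comp)
    show "norm (fst (directions p) $ i) = (if L i = {0} then 0 else 1)"
      "norm (snd (directions p) $ i) = (if (L i)\<^sup>\<bottom> = {0} then 0 else 1)"
      using p by (auto simp: directions_def norm_sgn)
  qed
  have law: "prob_space (distr \<tau> borel directions) \<and> (AE p in distr \<tau> borel directions. p \<in> X) \<and>
      (\<forall>p\<in>X. \<forall>p'\<in>X. \<forall>r. emeasure (distr \<tau> borel directions) (ball p r) = emeasure (distr \<tau> borel directions) (ball p' r))"
    if \<tau>: "prob_space \<tau>" "sets \<tau> = sets borel" "AE p in \<tau>. nondegenerate L p"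
      "\<And>R. stabilizes R L \<Longrightarrow> distr \<tau> borel (rotate2 R) = \<tau>" for \<tau> :: "((real^'d^'n) \<times> (real^'d^'n)) measure"
  proof (intro conjI ballI allI)
    note [measurable_cong] = \<tau>(2)
    show "prob_space (distr \<tau> borel directions)" by (rule prob_space.prob_space_distr[OF \<tau>(1)]) measurable
    show "AE p in distr \<tau> borel directions. p \<in> X"
      using \<tau>(3) X_borel by (subst AE_distr_iff) (auto elim!: eventually_mono simp: dir_X)
    fix p p' r assume p: "p \<in> X" "p' \<in> X"
    obtain R where R: "stabilizes R L" "rotate2 R p = p'"
      by (rule stabilizes_transitive[where p=p and p'=p', OF L]) (use p in \<open>auto simp: X_def\<close>)
    have orth: "orthogonal_matrix (R i)" for i using R(1) by (simp add: stabilizes_def)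
    have "distr \<tau> borel directions = distr (distr \<tau> borel (rotate2 R)) borel directions" by (simp add: \<tau>(4)[OF R(1)])
    also have "\<dots> = distr (distr \<tau> borel directions) borel (rotate2 R)"
      by (simp add: distr_distr comp_def directions_rotate2[OF orth])
    finally have "emeasure (distr \<tau> borel directions) (ball p' r)
        = emeasure (distr (distr \<tau> borel directions) borel (rotate2 R)) (ball p' r)" by simp
    also have "\<dots> = emeasure (distr \<tau> borel directions) (rotate2 R -` ball p' r)"
      by (subst emeasure_distr) auto
    also have "rotate2 R -` ball p' r = ball p r"
      unfolding ball_def vimage_def R(2)[symmetric] by (simp add: dist_rotate2[OF orth])
    finally show "emeasure (distr \<tau> borel directions) (ball p r) = emeasure (distr \<tau> borel directions) (ball p' r)" by simp
  qed
  show ?thesis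
  proof (rule uniformly_distributed_unique[where X=X])
    fix p p' r assume "p \<in> X" "p' \<in> X"
    then show "emeasure (distr \<kappa> borel directions) (ball p r) = emeasure (distr \<kappa> borel directions) (ball p' r)"
      "emeasure (distr \<rho> borel directions) (ball p r) = emeasure (distr \<rho> borel directions) (ball p' r)"
      using law[OF 1] law[OF 2] by blast+
  qed (use law[OF 1] law[OF 2] in simp_all)
qed

lemma sgn_eq_positive_scaleR: "\<exists>s>0. sgn y = s *\<^sub>R (y :: 'a::real_normed_vector)"
  by (cases "y = 0") (auto simp: sgn_div_norm intro: exI[of _ 1] exI[of _ "inverse (norm y)"])

lemma biconic_mem_sgn:
  fixes A :: "('a::real_normed_vector \<times> 'b::real_normed_vector) set"
  assumes "\<And>s t x z. 0 < s \<Longrightarrow> 0 < t \<Longrightarrow> (s *\<^sub>R x, t *\<^sub>R z) \<in> A \<longleftrightarrow> (x, z) \<in> A"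
  shows "(sgn x, sgn z) \<in> A \<longleftrightarrow> (x, z) \<in> A"
proof -
  obtain s where "0 < s" "sgn x = s *\<^sub>R x" using sgn_eq_positive_scaleR[of x] by auto
  moreover obtain t where "0 < t" "sgn z = t *\<^sub>R z" using sgn_eq_positive_scaleR[of z] by auto
  ultimately show ?thesis using assms[of s t x z] by simp
qed

lemma borel_componentwise:
  fixes A :: "'n::finite \<Rightarrow> ((real^'d) \<times> (real^'d)) set"
  assumes "\<And>i. A i \<in> sets borel"
  shows "{p. \<forall>i. (fst p $ i, snd p $ i) \<in> A i} \<in> sets borel"
proof -
  have "{p :: (real^'d^'n) \<times> (real^'d^'n). (fst p $ i, snd p $ i) \<in> A i} \<in> sets borel" for i
    using measurable_sets[OF borel_measurable_continuous_onI assms[of i], of "\<lambda>p :: (real^'d^'n) \<times> (real^'d^'n). (fst p $ i, snd p $ i)"]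
    by (simp add: vimage_def continuous_intros)
  then have "{p \<in> space borel. \<forall>i\<in>UNIV. (fst p $ i, snd p $ i) \<in> A i} \<in> sets borel"
    by (intro sets.sets_Collect_finite_All) auto
  then show ?thesis by simp
qed

text \<open>Membership in a biconic set depends on the directions only.\<close>
lemma invariant_law_biconic_eq:
  fixes L :: "'n::finite \<Rightarrow> (real^'d) set" and \<kappa> \<rho> :: "((real^'d^'n) \<times> (real^'d^'n)) measure"
  assumes L: "\<And>i. subspace (L i)"
    and 1: "prob_space \<kappa>" "sets \<kappa> = sets borel" "AE p in \<kappa>. nondegenerate L p"
      "\<And>R. stabilizes R L \<Longrightarrow> distr \<kappa> borel (rotate2 R) = \<kappa>"
    and 2: "prob_space \<rho>" "sets \<rho> = sets borel" "AE p in \<rho>. nondegenerate L p"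
      "\<And>R. stabilizes R L \<Longrightarrow> distr \<rho> borel (rotate2 R) = \<rho>"
    and A: "\<And>i. A i \<in> sets borel"
    and biconic: "\<And>i s t x z. 0 < s \<Longrightarrow> 0 < t \<Longrightarrow> (s *\<^sub>R x, t *\<^sub>R z) \<in> A i \<longleftrightarrow> (x, z) \<in> A i"
  shows "emeasure \<kappa> {p. \<forall>i. (fst p $ i, snd p $ i) \<in> A i} = emeasure \<rho> {p. \<forall>i. (fst p $ i, snd p $ i) \<in> A i}"
proof -
  let ?E = "{p. \<forall>i. (fst p $ i, snd p $ i) \<in> A i}"
  have "(sgn x, sgn z) \<in> A i \<longleftrightarrow> (x, z) \<in> A i" for i x z
    by (rule biconic_mem_sgn) (rule biconic)
  then have pre: "directions -` ?E = ?E" by (auto simp: directions_def)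
  have eq: "emeasure \<tau> ?E = emeasure (distr \<tau> borel directions) ?E" if "sets \<tau> = sets borel" for \<tau>
  proof -
    have [measurable_cong]: "sets \<tau> = sets borel" by fact
    have "directions \<in> \<tau> \<rightarrow>\<^sub>M borel" by measurable
    then have "emeasure (distr \<tau> borel directions) ?E = emeasure \<tau> (directions -` ?E \<inter> space \<tau>)"
      by (rule emeasure_distr[OF _ borel_componentwise[of A, OF A]])
    then show ?thesis unfolding pre using sets_eq_imp_space_eq[OF that] by simp
  qed
  show ?thesis
    by (rule trans[OF eq[OF 1(2)] trans[OF _ eq[OF 2(2), symmetric]]])
      (simp only: invariant_direction_law_unique[OF L 1 2])
qed

section \<open>Decomposition along a tuple of rotated subspaces\<close>

text \<open>The preimage of a closed set under \<open>f\<close> is a countable union of projections along compact sets of closed parts of the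
  graph. This yields a measurable choice of the solutions of linear systems without solving them.\<close>
lemma borel_measurable_closed_graph:
  fixes f :: "'a::euclidean_space \<Rightarrow> 'b::euclidean_space"
  assumes S: "S \<in> sets borel" and G: "closed G"
    and f: "\<And>x y. x \<in> S \<Longrightarrow> (x, y) \<in> G \<longleftrightarrow> y = f x"
  shows "(\<lambda>x. if x \<in> S then f x else 0) \<in> borel_measurable borel"
proof (rule borel_measurableI)
  fix U :: "'b set" assume "open U"
  define F where "F = - U"
  have F: "closed F" using \<open>open U\<close> by (auto simp: F_def)
  define K where "K n = {x. \<exists>y. y \<in> F \<inter> cball 0 (real n) \<and> (y, x) \<in> {(y, x). (x, y) \<in> G}}" for n
  have "closed {(y, x). (x, y) \<in> G}"
  proof -
    have "{(y, x). (x, y) \<in> G} = (\<lambda>p. (snd p, fst p)) -` G" by auto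
    also have "closed \<dots>" by (intro closed_vimage G continuous_intros)
    finally show ?thesis .
  qed
  then have K: "closed (K n)" for n
    unfolding K_def using F by (intro closed_compact_projection closed_Int_compact) auto
  have "S \<inter> (\<lambda>x. if x \<in> S then f x else 0) -` F = S \<inter> (\<Union>n. K n)"
  proof (intro set_eqI iffI)
    fix x assume x: "x \<in> S \<inter> (\<lambda>x. if x \<in> S then f x else 0) -` F"
    obtain n where "norm (f x) \<le> real n" using real_arch_simple by blast
    then have "x \<in> K n" using x f[of x "f x"] by (auto simp: K_def)
    then show "x \<in> S \<inter> (\<Union>n. K n)" using x by auto
  qed (use f in \<open>auto simp: K_def\<close>)
  moreover have "S \<inter> (\<Union>n. K n) \<in> sets borel"
    using S K by (intro sets.Int sets.countable_UN) (auto intro: borel_closed)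
  ultimately have SF: "S \<inter> (\<lambda>x. if x \<in> S then f x else 0) -` F \<in> sets borel" by simp
  have "(\<lambda>x. if x \<in> S then f x else 0) -` U \<inter> space borel
      = (S - S \<inter> (\<lambda>x. if x \<in> S then f x else 0) -` F) \<union> (if 0 \<in> U then - S else {})"
    by (auto simp: F_def split: if_splits)
  also have "\<dots> \<in> sets borel" using S SF by (auto intro!: sets.Un sets.Diff)
  finally show "(\<lambda>x. if x \<in> S then f x else 0) -` U \<inter> space borel \<in> sets borel" .
qed

text \<open>The inverse transpose acts on normal vectors. For an orthogonal \<open>Q\<close> the inverse transpose of \<open>T ** Q\<close> is
  \<open>dual T ** Q\<close>, which is continuous in \<open>Q\<close>.\<close>
abbreviation dual :: "real^'d^'d \<Rightarrow> real^'d^'d" where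
  "dual T \<equiv> transpose (matrix_inv T)"

lemma invertible_dual: "invertible T \<Longrightarrow> invertible (dual T)" for T :: "real^'d^'d"
  by (metis invertible_def matrix_inv_left matrix_inv_right transpose_invertible)

text \<open>For \<open>p = (a, b)\<close> this says that \<open>g = x + \<Sum>j. y\<^sub>j\<close>, where \<open>x\<close> is the common value of the \<open>T\<^sub>i q\<^sub>i a\<^sub>i\<close> and \<open>y\<^sub>j\<close> the dual
  image of \<open>b\<^sub>j\<close>; that the \<open>T\<^sub>i q\<^sub>i a\<^sub>i\<close> agree follows from the equations for all \<open>i\<close>.\<close>
definition decomposes ::
  "('n::finite \<Rightarrow> real^'d^'d) \<Rightarrow> ('n \<Rightarrow> (real^'d) set) \<Rightarrow> real^'d^'d^'n \<Rightarrow> real^'d \<Rightarrow> (real^'d^'n) \<times> (real^'d^'n) \<Rightarrow> bool" where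
  "decomposes T L q g p \<longleftrightarrow> (\<forall>i. fst p $ i \<in> L i \<and> snd p $ i \<in> (L i)\<^sup>\<bottom> \<and>
     T i *v (q $ i *v fst p $ i) + (\<Sum>j\<in>UNIV. dual (T j) *v (q $ j *v snd p $ j)) = g)"

definition generic :: "('n::finite \<Rightarrow> real^'d^'d) \<Rightarrow> ('n \<Rightarrow> (real^'d) set) \<Rightarrow> real^'d^'d^'n \<Rightarrow> bool" where
  "generic T L q \<longleftrightarrow> (\<forall>i. orthogonal_matrix (q $ i)) \<and> transversal (\<lambda>i. dual (T i)) (\<lambda>i. (L i)\<^sup>\<bottom>) q"

lemma inner_image_dual_image:
  fixes T Q :: "real^'d^'d"
  assumes "invertible T" "orthogonal_matrix Q"
  shows "(T *v (Q *v x)) \<bullet> (dual T *v (Q *v y)) = x \<bullet> y"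
  unfolding inner_transpose_matrix_inv[OF assms(1)]
  using assms(2) by (metis orthogonal_transformation_def orthogonal_transformation_matrix matrix_vector_mul_linear matrix_of_matrix_vector_mul)

lemma inner_orthogonal_comp: "x \<in> L \<Longrightarrow> y \<in> L\<^sup>\<bottom> \<Longrightarrow> x \<bullet> y = 0"
  by (auto simp: orthogonal_comp_def orthogonal_def)

text \<open>The intersection of the subspaces \<open>T\<^sub>i q\<^sub>i L\<^sub>i\<close> is the orthogonal complement of the sum of their orthogonal complements, and the
  orthogonal complement of \<open>T\<^sub>i q\<^sub>i L\<^sub>i\<close> is the dual image of \<open>L\<^sub>i\<^sup>\<bottom>\<close>.\<close>
lemma Inter_images_eq_orthogonal_comp:
  fixes L :: "'n::finite \<Rightarrow> (real^'d) set"
  assumes T: "\<And>i. invertible (T i)" and L: "\<And>i. subspace (L i)" and q: "\<And>i. orthogonal_matrix (q $ i)"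
  shows "(\<Inter>i. (\<lambda>y. T i *v (q $ i *v y)) ` L i)
    = ((\<lambda>b. \<Sum>i\<in>UNIV. dual (T i) *v (q $ i *v b $ i)) ` {b. \<forall>i. b $ i \<in> (L i)\<^sup>\<bottom>})\<^sup>\<bottom>"
    (is "?V = (?S ` ?N)\<^sup>\<bottom>")
proof (intro set_eqI iffI)
  fix x assume x: "x \<in> ?V"
  have "?S b \<bullet> x = 0" if b: "b \<in> ?N" for b
  proof -
    have "(dual (T i) *v (q $ i *v b $ i)) \<bullet> x = 0" for i
    proof -
      obtain y where y: "y \<in> L i" "x = T i *v (q $ i *v y)" using x by blast
      have "y \<bullet> b $ i = 0" using inner_orthogonal_comp[OF y(1)] b by simp
      then show ?thesis
        unfolding y(2) inner_commute[of "dual (T i) *v (q $ i *v b $ i)"] inner_image_dual_image[OF T q] .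
    qed
    then show ?thesis by (simp only: inner_sum_left sum.neutral_const)
  qed
  then show "x \<in> (?S ` ?N)\<^sup>\<bottom>" by (auto simp: orthogonal_comp_def orthogonal_def)
next
  fix x assume x: "x \<in> (?S ` ?N)\<^sup>\<bottom>"
  show "x \<in> ?V"
  proof
    fix i
    define y where "y = transpose (q $ i) *v (matrix_inv (T i) *v x)"
    have xy: "x = T i *v (q $ i *v y)" unfolding y_def by (rule image_of_preimage[OF T q, symmetric])
    have "y \<in> (L i)\<^sup>\<bottom>\<^sup>\<bottom>"
    proof -
      have "z \<bullet> y = 0" if z: "z \<in> (L i)\<^sup>\<bottom>" for z
      proof -
        have S_axis: "?S (axis i z) = dual (T i) *v (q $ i *v z)"
          by (subst sum.remove[of _ i]) (auto simp: axis_def intro!: sum.neutral)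
        have "axis i z \<in> ?N"
          using z subspace_0[OF subspace_orthogonal_comp] by (auto simp: axis_def)
        from imageI[OF this, of ?S] have "dual (T i) *v (q $ i *v z) \<in> ?S ` ?N" unfolding S_axis .
        then have "(dual (T i) *v (q $ i *v z)) \<bullet> x = 0"
          using x by (auto simp: orthogonal_comp_def orthogonal_def)
        then show ?thesis
          unfolding xy inner_commute[of "dual (T i) *v (q $ i *v z)"] inner_image_dual_image[OF T q]
          by (simp add: inner_commute)
      qed
      then show ?thesis by (auto simp: orthogonal_comp_def orthogonal_def)
    qed
    then have "y \<in> L i" by (simp add: orthogonal_comp_self[OF L])
    then show "x \<in> (\<lambda>y. T i *v (q $ i *v y)) ` L i" using xy by blast
  qed
qed

text \<open>The nearest point to \<open>g\<close> in the sum of the dual images provides \<open>b\<close>, and the residual lies in the intersection of the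
  \<open>T\<^sub>i q\<^sub>i L\<^sub>i\<close>, which provides \<open>a\<close>.\<close>
lemma decomposes_exists:
  fixes L :: "'n::finite \<Rightarrow> (real^'d) set"
  assumes T: "\<And>i. invertible (T i)" and L: "\<And>i. subspace (L i)" and q: "\<And>i. orthogonal_matrix (q $ i)"
  shows "\<exists>p. decomposes T L q g p"
proof -
  let ?S = "\<lambda>b. \<Sum>i\<in>UNIV. dual (T i) *v (q $ i *v b $ i)"
  define W where "W = ?S ` {b. \<forall>i. b $ i \<in> (L i)\<^sup>\<bottom>}"
  have W: "subspace W"
    unfolding W_def by (intro linear_subspace_image linear_sum_images subspace_vec subspace_orthogonal_comp)
  define x where "x = g - closest_point W g"
  obtain b where b: "\<forall>i. b $ i \<in> (L i)\<^sup>\<bottom>" "closest_point W g = ?S b"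
    using closest_point_subspace(1)[OF W, of g] by (auto simp: W_def)
  have "x \<in> W\<^sup>\<bottom>" unfolding x_def by (rule residual_in_orthogonal_comp[OF W])
  then have x: "x \<in> (\<Inter>i. (\<lambda>y. T i *v (q $ i *v y)) ` L i)"
    unfolding Inter_images_eq_orthogonal_comp[of T L q, OF T L q] W_def .
  have "\<forall>i. \<exists>y. y \<in> L i \<and> T i *v (q $ i *v y) = x"
  proof
    fix i
    have "x \<in> (\<lambda>y. T i *v (q $ i *v y)) ` L i" using x by (rule INT_D) simp
    then show "\<exists>y. y \<in> L i \<and> T i *v (q $ i *v y) = x" by auto
  qed
  from choice[OF this] obtain a where a: "\<forall>i. a i \<in> L i \<and> T i *v (q $ i *v a i) = x" ..
  have "x + ?S b = g" using b(2) by (simp add: x_def)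
  then have "decomposes T L q g (\<chi> i. a i, b)" using b(1) a by (simp add: decomposes_def)
  then show ?thesis by blast
qed

lemma decomposes_linear:
  fixes L :: "'n::finite \<Rightarrow> (real^'d) set"
  assumes L: "\<And>i. subspace (L i)"
    and "decomposes T L q g p" "decomposes T L q g' p'"
  shows "decomposes T L q (s *\<^sub>R g + s' *\<^sub>R g') (s *\<^sub>R p + s' *\<^sub>R p')"
  unfolding decomposes_def
proof (intro allI conjI)
  fix i
  show "fst (s *\<^sub>R p + s' *\<^sub>R p') $ i \<in> L i" "snd (s *\<^sub>R p + s' *\<^sub>R p') $ i \<in> (L i)\<^sup>\<bottom>"
    using assms by (auto simp: decomposes_def intro!: subspace_add subspace_scale subspace_orthogonal_comp)
  have "g = T i *v (q $ i *v fst p $ i) + (\<Sum>j\<in>UNIV. dual (T j) *v (q $ j *v snd p $ j))"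
    "g' = T i *v (q $ i *v fst p' $ i) + (\<Sum>j\<in>UNIV. dual (T j) *v (q $ j *v snd p' $ j))"
    using assms(2,3) by (simp_all add: decomposes_def)
  then show "T i *v (q $ i *v fst (s *\<^sub>R p + s' *\<^sub>R p') $ i)
      + (\<Sum>j\<in>UNIV. dual (T j) *v (q $ j *v snd (s *\<^sub>R p + s' *\<^sub>R p') $ j)) = s *\<^sub>R g + s' *\<^sub>R g'"
    by (simp add: matrix_vector_right_distrib matrix_vector_mult_scaleR sum.distrib scaleR_sum_right[symmetric]
        scaleR_add_right algebra_simps del: transpose_matrix_vector)
qed

text \<open>The two summands are orthogonal, so both vanish; transversality then gives \<open>b = 0\<close>.\<close>
lemma decomposes_zero:
  assumes T: "\<And>i. invertible (T i)" and gen: "generic T L q" and d: "decomposes T L q 0 p"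
  shows "p = 0"
proof -
  let ?y = "\<Sum>j\<in>UNIV. dual (T j) *v (q $ j *v snd p $ j)"
  have q: "orthogonal_matrix (q $ i)" for i using gen by (auto simp: generic_def)
  have p: "fst p $ i \<in> L i" "snd p $ i \<in> (L i)\<^sup>\<bottom>" "T i *v (q $ i *v fst p $ i) = - ?y" for i
    using d by (auto simp: decomposes_def eq_neg_iff_add_eq_0)
  have "(- ?y) \<bullet> (dual (T j) *v (q $ j *v snd p $ j)) = 0" for j
    unfolding p(3)[of j, symmetric] inner_image_dual_image[OF T q] by (rule inner_orthogonal_comp[OF p(1,2)])
  then have "(- ?y) \<bullet> ?y = 0" by (simp only: inner_sum_right sum.neutral_const)
  then have y: "?y = 0" by simp
  then have "snd p = 0" using gen p(2) by (auto simp: generic_def transversal_def)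
  moreover have "fst p $ i = 0" for i
  proof -
    have "T i *v (q $ i *v fst p $ i) = 0" using p(3) y by simp
    moreover have "(T i *v (q $ i *v fst p $ i)) \<bullet> (dual (T i) *v (q $ i *v fst p $ i)) = fst p $ i \<bullet> fst p $ i"
      by (rule inner_image_dual_image[OF T q])
    ultimately show ?thesis by simp
  qed
  ultimately show "p = 0" by (simp add: prod_eq_iff vec_eq_iff)
qed

lemma decomposes_unique:
  fixes L :: "'n::finite \<Rightarrow> (real^'d) set"
  assumes T: "\<And>i. invertible (T i)" and L: "\<And>i. subspace (L i)" and gen: "generic T L q"
    and d: "decomposes T L q g p" "decomposes T L q g p'"
  shows "p = p'"
proof -
  have "decomposes T L q 0 (p - p')" using decomposes_linear[OF L d, of 1 "- 1"] by simp
  then have "p - p' = 0" by (rule decomposes_zero[OF T gen])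
  then show ?thesis by simp
qed

lemma closed_decomposes:
  fixes L :: "'n::finite \<Rightarrow> (real^'d) set"
  assumes L: "\<And>i. subspace (L i)"
  shows "closed {(w, p). decomposes T L (fst w) (snd w) p}"
proof -
  have "closed {wp :: ((real^'d^'d^'n) \<times> (real^'d)) \<times> ((real^'d^'n) \<times> (real^'d^'n)). decomposes T L (fst (fst wp)) (snd (fst wp)) (snd wp)}"
    unfolding decomposes_def
    by (intro closed_Collect_all closed_Collect_conj closed_Collect_eq continuous_intros
        continuous_closed_vimage[unfolded vimage_def] closed_subspace L subspace_orthogonal_comp)
  then show ?thesis by (simp add: split_def)
qed

lemma borel_generic:
  fixes L :: "'n::finite \<Rightarrow> (real^'d) set"
  shows "{q. generic T L q} \<in> sets borel"
proof -
  have "closed {q :: real^'d^'d^'n. \<forall>i. orthogonal_matrix (q $ i)}"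
    unfolding orthogonal_matrix_def by (intro closed_Collect_all closed_Collect_conj closed_Collect_eq continuous_intros)
  moreover have "closed {q. \<not> transversal (\<lambda>i. dual (T i)) (\<lambda>i. (L i)\<^sup>\<bottom>) q}"
    by (rule closed_not_transversal) (rule subspace_orthogonal_comp)
  ultimately have "{q :: real^'d^'d^'n. \<forall>i. orthogonal_matrix (q $ i)} - {q. \<not> transversal (\<lambda>i. dual (T i)) (\<lambda>i. (L i)\<^sup>\<bottom>) q} \<in> sets borel"
    by (intro sets.Diff borel_closed)
  also have "{q :: real^'d^'d^'n. \<forall>i. orthogonal_matrix (q $ i)} - {q. \<not> transversal (\<lambda>i. dual (T i)) (\<lambda>i. (L i)\<^sup>\<bottom>) q} = {q. generic T L q}"
    by (auto simp: generic_def)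
  finally show ?thesis .
qed

text \<open>The value \<open>0\<close> for rotations that are not generic makes this a Borel function on the whole space.\<close>
definition solution ::
  "('n::finite \<Rightarrow> real^'d^'d) \<Rightarrow> ('n \<Rightarrow> (real^'d) set) \<Rightarrow> (real^'d^'d^'n) \<times> (real^'d) \<Rightarrow> (real^'d^'n) \<times> (real^'d^'n)" where
  "solution T L w = (if generic T L (fst w) then THE p. decomposes T L (fst w) (snd w) p else 0)"

lemma solution_iff:
  fixes L :: "'n::finite \<Rightarrow> (real^'d) set"
  assumes T: "\<And>i. invertible (T i)" and L: "\<And>i. subspace (L i)" and gen: "generic T L q"
  shows "decomposes T L q g p \<longleftrightarrow> p = solution T L (q, g)"
proof -
  have q: "orthogonal_matrix (q $ i)" for i using gen by (auto simp: generic_def)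
  obtain p0 where p0: "decomposes T L q g p0" using decomposes_exists[of T L q, OF T L q] by blast
  have uniq: "p = p0" if "decomposes T L q g p" for p
    by (rule decomposes_unique[of T L q, OF T L gen that p0])
  have "solution T L (q, g) = p0"
    using gen the_equality[of "decomposes T L q g" p0, OF p0 uniq] by (simp add: solution_def)
  then show ?thesis using p0 uniq by blast
qed

lemma borel_measurable_solution:
  fixes L :: "'n::finite \<Rightarrow> (real^'d) set"
  assumes T: "\<And>i. invertible (T i)" and L: "\<And>i. subspace (L i)"
  shows "solution T L \<in> borel_measurable borel"
proof -
  let ?S = "{w :: (real^'d^'d^'n) \<times> (real^'d). generic T L (fst w)}"
  have "fst -` {q. generic T L q} \<inter> space (borel :: ((real^'d^'d^'n) \<times> (real^'d)) measure) \<in> sets borel"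
    by (rule measurable_sets[OF borel_measurable_continuous_onI borel_generic]) (intro continuous_intros)
  then have S: "?S \<in> sets borel" by (simp add: vimage_def)
  have iff: "(w, p) \<in> {(w, p). decomposes T L (fst w) (snd w) p} \<longleftrightarrow> p = solution T L w" if "w \<in> ?S" for w p
    using solution_iff[of T L "fst w" "snd w" p, OF T L] that by simp
  have "(\<lambda>w. if w \<in> ?S then solution T L w else 0) \<in> borel_measurable borel"
    by (rule borel_measurable_closed_graph[OF S closed_decomposes[of L T, OF L] iff])
  also have "(\<lambda>w. if w \<in> ?S then solution T L w else 0) = solution T L"
    by (rule ext) (simp add: solution_def)
  finally show ?thesis .
qed

text \<open>The key equivariance: multiplying the rotations from the right by elements of the stabilizer leaves the subspaces
  \<open>T\<^sub>i q\<^sub>i L\<^sub>i\<close> unchanged and rotates the coordinates \<open>(a, b)\<close> of \<open>g\<close>.\<close>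
lemma decomposes_rotate:
  assumes R: "stabilizes R L" and d: "decomposes T L (\<chi> i. q $ i ** R i) g p"
  shows "decomposes T L q g (rotate2 R p)"
  using d R unfolding decomposes_def stabilizes_def rotate2_def rotate_def
  by (auto simp: matrix_vector_mul_assoc[symmetric] simp del: transpose_matrix_vector)

lemma generic_right_mult:
  assumes R: "stabilizes R L" and gen: "generic T L q"
  shows "generic T L (\<chi> i. q $ i ** R i)"
  unfolding generic_def transversal_def
proof (intro conjI allI impI)
  have orth: "orthogonal_matrix (R i)" for i using R by (simp add: stabilizes_def)
  show "orthogonal_matrix ((\<chi> i. q $ i ** R i) $ i)" for i
    using gen orth by (simp add: generic_def orthogonal_matrix_mul)
  fix b assume b: "\<forall>i. b $ i \<in> (L i)\<^sup>\<bottom>" and 0: "(\<Sum>i\<in>UNIV. dual (T i) *v ((\<chi> i. q $ i ** R i) $ i *v b $ i)) = 0"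
  have "rotate R b = 0"
  proof -
    have "\<forall>i. rotate R b $ i \<in> (L i)\<^sup>\<bottom>" using b R by (simp add: rotate_def stabilizes_def)
    moreover have "(\<Sum>i\<in>UNIV. dual (T i) *v (q $ i *v rotate R b $ i)) = 0"
      using 0 by (simp add: rotate_def matrix_vector_mul_assoc[symmetric] del: transpose_matrix_vector)
    ultimately show ?thesis using gen by (auto simp: generic_def transversal_def)
  qed
  then show "b = 0"
    using orthogonal_transformation_norm[OF orthogonal_transformation_rotate[of R, OF orth], of b] by simp
qed

text \<open>For a fixed generic \<open>q\<close> the solution is linear in \<open>g\<close>, so the vectors \<open>g\<close> for which a component vanishes form a
  subspace. It is proper: if \<open>g\<close> is not in the sum of the dual images, all components \<open>a\<^sub>i\<close> are nonzero, and if \<open>g\<close> is the dual image of a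
  nonzero vector of \<open>L\<^sub>i\<^sup>\<bottom>\<close>, then \<open>b\<^sub>i\<close> is nonzero.\<close>
lemma AE_solution_nondegenerate:
  fixes L :: "'n::finite \<Rightarrow> (real^'d) set"
  assumes T: "\<And>i. invertible (T i)" and L: "\<And>i. subspace (L i)" and gen: "generic T L q"
    and less: "(\<Sum>i\<in>UNIV. dim ((L i)\<^sup>\<bottom>)) < CARD('d)"
  shows "AE g in std_gaussian. nondegenerate L (solution T L (q, g))"
proof -
  let ?S = "\<lambda>b. \<Sum>i\<in>UNIV. dual (T i) *v (q $ i *v b $ i)"
  have q: "orthogonal_matrix (q $ i)" for i using gen by (auto simp: generic_def)
  have sol: "decomposes T L q g (solution T L (q, g))" for g by (simp add: solution_iff[OF T L gen])
  \<comment> \<open>the subspaces of those \<open>g\<close> for which \<open>a $ i\<close>, respectively \<open>b $ i\<close>, vanishes\<close>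
  define Ya where "Ya i = {g. fst (solution T L (q, g)) $ i = 0}" for i
  define Yb where "Yb i = {g. snd (solution T L (q, g)) $ i = 0}" for i
  have lin: "solution T L (q, s *\<^sub>R g + s' *\<^sub>R g') = s *\<^sub>R solution T L (q, g) + s' *\<^sub>R solution T L (q, g')" for s s' g g'
    using decomposes_linear[OF L sol sol] unfolding solution_iff[OF T L gen] by simp
  have add: "solution T L (q, g + g') = solution T L (q, g) + solution T L (q, g')"
    and scale: "solution T L (q, s *\<^sub>R g) = s *\<^sub>R solution T L (q, g)" for s g g'
    using lin[of 1 g 1 g'] lin[of s g 0 g] by simp_all
  have sub: "subspace (Ya i)" "subspace (Yb i)" for i
    using scale[of 0] by (auto simp: Ya_def Yb_def subspace_def add scale)
  define W where "W = ?S ` {b. \<forall>i. b $ i \<in> (L i)\<^sup>\<bottom>}"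
  have "dim W \<le> (\<Sum>i\<in>UNIV. dim ((L i)\<^sup>\<bottom>))"
    unfolding W_def dim_vec_subspace[OF subspace_orthogonal_comp, symmetric] by (rule dim_image_le[OF linear_sum_images])
  then have "W \<noteq> UNIV" using less by auto
  then obtain g0 where g0: "g0 \<notin> W" by auto
  have Ya: "Ya i \<noteq> UNIV" for i
  proof -
    have "fst (solution T L (q, g0)) $ i \<noteq> 0"
    proof
      assume "fst (solution T L (q, g0)) $ i = 0"
      then have "?S (snd (solution T L (q, g0))) = g0" using sol[of g0] by (auto simp: decomposes_def dest!: spec[of _ i])
      moreover have "?S (snd (solution T L (q, g0))) \<in> W" using sol[of g0] by (auto simp: W_def decomposes_def)
      ultimately show False using g0 by simp
    qed
    then show ?thesis by (auto simp: Ya_def)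
  qed
  have Yb: "Yb i \<noteq> UNIV" if "(L i)\<^sup>\<bottom> \<noteq> {0}" for i
  proof -
    have "0 \<in> (L i)\<^sup>\<bottom>" by (rule subspace_0[OF subspace_orthogonal_comp])
    with that obtain y where y: "y \<in> (L i)\<^sup>\<bottom>" "y \<noteq> 0" by blast
    have "?S (axis i y) = dual (T i) *v (q $ i *v y)"
      by (subst sum.remove[of _ i]) (auto simp: axis_def intro!: sum.neutral)
    then have "decomposes T L q (dual (T i) *v (q $ i *v y)) (0, axis i y)"
      unfolding decomposes_def using y subspace_0[OF L] subspace_0[OF subspace_orthogonal_comp]
      by (auto simp: axis_def simp del: transpose_matrix_vector)
    then have "solution T L (q, dual (T i) *v (q $ i *v y)) = (0, axis i y)" by (simp add: solution_iff[OF T L gen])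
    then have "dual (T i) *v (q $ i *v y) \<notin> Yb i" using y by (simp add: Yb_def)
    then show ?thesis by auto
  qed
  have "AE g in std_gaussian. \<forall>i. g \<notin> Ya i"
    using AE_std_gaussian_notin_subspace[OF sub(1) Ya] by (intro AE_all_countable[THEN iffD2]) auto
  moreover have "AE g in std_gaussian. \<forall>i. (L i)\<^sup>\<bottom> \<noteq> {0} \<longrightarrow> g \<notin> Yb i"
    using AE_std_gaussian_notin_subspace[OF sub(2) Yb] by (intro AE_all_countable[THEN iffD2]) auto
  ultimately show ?thesis
  proof eventually_elim
    case (elim g)
    then show ?case using sol[of g] by (auto simp: nondegenerate_def decomposes_def Ya_def Yb_def)
  qed
qed

section \<open>The kinematic formula for a tuple of subspaces\<close>

definition projections :: "('n::finite \<Rightarrow> (real^'d) set) \<Rightarrow> real^'d^'n \<Rightarrow> (real^'d^'n) \<times> (real^'d^'n)" where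
  "projections L g = (\<chi> i. closest_point (L i) (g $ i), \<chi> i. g $ i - closest_point (L i) (g $ i))"

lemma borel_measurable_projections:
  fixes L :: "'n::finite \<Rightarrow> (real^'d) set"
  assumes L: "\<And>i. subspace (L i)"
  shows "projections L \<in> borel_measurable borel"
proof -
  have cp [measurable]: "closest_point (L i) \<in> borel_measurable borel" for i
    using subspace_0[OF L, of i] by (intro borel_measurable_closest_point subspace_imp_convex closed_subspace L) auto
  have [measurable]: "(\<lambda>g :: real^'d^'n. closest_point (L i) (g $ i)) \<in> borel_measurable borel" for i
    by (rule measurable_compose[OF _ cp]) measurable
  show ?thesis unfolding projections_def by (intro borel_measurable_Pair) measurable
qed

lemma borel_nondegenerate:
  fixes L :: "'n::finite \<Rightarrow> (real^'d) set"
  assumes L: "\<And>i. subspace (L i)"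
  shows "{p. nondegenerate L p} \<in> sets borel"
proof -
  let ?A = "\<lambda>i. {p :: (real^'d^'n) \<times> (real^'d^'n). fst p $ i \<in> L i \<and> snd p $ i \<in> (L i)\<^sup>\<bottom>}"
  let ?B = "\<lambda>i. {p :: (real^'d^'n) \<times> (real^'d^'n). L i \<noteq> {0} \<longrightarrow> fst p $ i \<noteq> 0}"
  let ?C = "\<lambda>i. {p :: (real^'d^'n) \<times> (real^'d^'n). (L i)\<^sup>\<bottom> \<noteq> {0} \<longrightarrow> snd p $ i \<noteq> 0}"
  have A: "closed (?A i)" for i
    by (intro closed_Collect_conj continuous_intros
        continuous_closed_vimage[unfolded vimage_def] closed_subspace L subspace_orthogonal_comp)
  have B: "open (?B i)" for i
    by (cases "L i = {0}") (simp_all add: open_Collect_neq continuous_intros)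
  have C: "open (?C i)" for i
    by (cases "(L i)\<^sup>\<bottom> = {0}") (simp_all add: open_Collect_neq continuous_intros)
  have "(\<Inter>i. ?A i \<inter> ?B i \<inter> ?C i) \<in> sets borel"
    using A B C by (intro sets.finite_INT sets.Int borel_closed borel_open) auto
  also have "(\<Inter>i. ?A i \<inter> ?B i \<inter> ?C i) = {p. nondegenerate L p}"
    unfolding nondegenerate_def by blast
  finally show ?thesis .
qed

text \<open>The orthogonal projections to \<open>L\<^sub>i\<close> and \<open>L\<^sub>i\<^sup>\<bottom>\<close> commute with the stabilizer, and the Gaussian measure is invariant
  under orthogonal maps.\<close>
lemma projection_law:
  fixes L :: "'n::finite \<Rightarrow> (real^'d) set"
  assumes L: "\<And>i. subspace (L i)"
  shows "AE p in distr std_gaussian borel (projections L). nondegenerate L p"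
    and "\<And>R. stabilizes R L \<Longrightarrow>
      distr (distr std_gaussian borel (projections L)) borel (rotate2 R) = distr std_gaussian borel (projections L)"
proof -
  note [measurable] = borel_measurable_projections[of L, OF L]
  have ae: "AE g in std_gaussian. (g :: real^'d^'n) $ i \<notin> N" if "subspace N" "N \<noteq> UNIV" for i and N :: "(real^'d) set"
  proof -
    have "subspace {g :: real^'d^'n. g $ i \<in> N}" using that(1) by (auto simp: subspace_def)
    moreover have "{g :: real^'d^'n. g $ i \<in> N} \<noteq> UNIV"
    proof
      assume *: "{g :: real^'d^'n. g $ i \<in> N} = UNIV"
      have "y \<in> N" for y
      proof -
        have "axis i y \<in> {g :: real^'d^'n. g $ i \<in> N}" unfolding * by simp
        then show ?thesis by (simp add: axis_def)
      qed
      with that(2) show False by auto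
    qed
    ultimately show ?thesis using AE_std_gaussian_notin_subspace by fastforce
  qed
  have 1: "AE g in std_gaussian. \<forall>i. L i \<noteq> {0} \<longrightarrow> (g :: real^'d^'n) $ i \<notin> (L i)\<^sup>\<bottom>"
  proof (intro AE_all_countable[THEN iffD2] allI)
    fix i
    have "(L i)\<^sup>\<bottom> \<noteq> UNIV" if "L i \<noteq> {0}"
    proof
      assume U: "(L i)\<^sup>\<bottom> = UNIV"
      have "x = 0" if "x \<in> L i" for x using inner_orthogonal_comp[OF that, of x] U by simp
      then show False using that subspace_0[OF L, of i] by blast
    qed
    then show "AE g in std_gaussian. L i \<noteq> {0} \<longrightarrow> (g :: real^'d^'n) $ i \<notin> (L i)\<^sup>\<bottom>"
      using ae[OF subspace_orthogonal_comp, of "L i" i] by (cases "L i = {0}") auto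
  qed
  have 2: "AE g in std_gaussian. \<forall>i. (L i)\<^sup>\<bottom> \<noteq> {0} \<longrightarrow> (g :: real^'d^'n) $ i \<notin> L i"
  proof (intro AE_all_countable[THEN iffD2] allI)
    fix i
    have "L i \<noteq> UNIV" if "(L i)\<^sup>\<bottom> \<noteq> {0}"
    proof
      assume U: "L i = UNIV"
      have "x = 0" if "x \<in> (L i)\<^sup>\<bottom>" for x using inner_orthogonal_comp[OF _ that, of x] U by simp
      moreover have "0 \<in> (L i)\<^sup>\<bottom>" by (rule subspace_0[OF subspace_orthogonal_comp])
      ultimately show False using that by blast
    qed
    then show "AE g in std_gaussian. (L i)\<^sup>\<bottom> \<noteq> {0} \<longrightarrow> (g :: real^'d^'n) $ i \<notin> L i"
      using ae[OF L, of i i] by (cases "(L i)\<^sup>\<bottom> = {0}") auto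
  qed
  have "AE g in std_gaussian. nondegenerate L (projections L g)"
    using 1 2
  proof eventually_elim
    case (elim g)
    show ?case unfolding nondegenerate_def
    proof (intro allI conjI impI)
      fix i
      show "fst (projections L g) $ i \<in> L i" by (simp add: projections_def closest_point_subspace(1)[OF L])
      show "snd (projections L g) $ i \<in> (L i)\<^sup>\<bottom>" by (simp add: projections_def residual_in_orthogonal_comp[OF L])
      show "fst (projections L g) $ i \<noteq> 0" if "L i \<noteq> {0}"
        using elim(1) that residual_in_orthogonal_comp[OF L, of "g $ i" i] by (auto simp: projections_def)
      show "snd (projections L g) $ i \<noteq> 0" if "(L i)\<^sup>\<bottom> \<noteq> {0}"
        using elim(2) that closest_point_subspace(1)[OF L, of i "g $ i"] by (auto simp: projections_def)
    qed
  qed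
  then show "AE p in distr std_gaussian borel (projections L). nondegenerate L p"
    using borel_nondegenerate[of L, OF L] by (subst AE_distr_iff) auto
  fix R assume R: "stabilizes R L"
  then have orth: "orthogonal_matrix (R i)" for i by (simp add: stabilizes_def)
  have comm: "rotate2 R (projections L g) = projections L (rotate R g)" for g
  proof -
    have "closest_point (L i) (R i *v g $ i) = R i *v closest_point (L i) (g $ i)" for i
    proof -
      have "R i *v g $ i = R i *v closest_point (L i) (g $ i) + R i *v (g $ i - closest_point (L i) (g $ i))"
        by (simp add: matrix_vector_right_distrib[symmetric])
      also have "closest_point (L i) \<dots> = R i *v closest_point (L i) (g $ i)"
        using R closest_point_subspace(1)[OF L, of i "g $ i"] residual_in_orthogonal_comp[OF L, of "g $ i" i]
        by (intro closest_point_subspace_add L) (auto simp: stabilizes_def)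
      finally show ?thesis .
    qed
    then show ?thesis
      by (simp add: rotate2_def rotate_def projections_def vec_eq_iff matrix_vector_mult_diff_distrib)
  qed
  have "distr (distr std_gaussian borel (projections L)) borel (rotate2 R) = distr std_gaussian borel (\<lambda>g. projections L (rotate R g))"
    by (simp add: distr_distr comp_def comm)
  also have "\<dots> = distr (distr std_gaussian borel (rotate R)) borel (projections L)"
    by (simp add: distr_distr comp_def)
  also have "\<dots> = distr std_gaussian borel (projections L)"
    by (simp add: std_gaussian_orthogonal_invariant[OF orthogonal_transformation_rotate[of R, OF orth]])
  finally show "distr (distr std_gaussian borel (projections L)) borel (rotate2 R) = distr std_gaussian borel (projections L)" .
qed

context right_invariant_rotations
begin

sublocale pair: pair_prob_space \<nu> "std_gaussian :: (real^'d) measure" ..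

lemma sets_pair: "sets (\<nu> \<Otimes>\<^sub>M (std_gaussian :: (real^'d) measure)) = sets borel"
proof -
  have "sets (\<nu> \<Otimes>\<^sub>M (std_gaussian :: (real^'d) measure)) = sets (borel \<Otimes>\<^sub>M borel)"
    by (intro sets_pair_measure_cong) auto
  then show ?thesis unfolding borel_prod .
qed

lemma space_pair [simp]: "space (\<nu> \<Otimes>\<^sub>M (std_gaussian :: (real^'d) measure)) = UNIV"
  using sets_eq_imp_space_eq[OF sets_pair] by simp

lemma AE_generic:
  fixes L :: "'n \<Rightarrow> (real^'d) set"
  assumes T: "\<And>i. invertible (T i)" and le: "(\<Sum>i\<in>UNIV. dim ((L i)\<^sup>\<bottom>)) \<le> CARD('d)"
  shows "AE q in \<nu>. generic T L q"
proof -
  have "AE q in \<nu>. transversal (\<lambda>i. dual (T i)) (\<lambda>i. (L i)\<^sup>\<bottom>) q"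
    by (rule AE_transversal[OF invertible_dual[OF T] subspace_orthogonal_comp le])
  with AE_orthogonal show ?thesis by eventually_elim (simp add: generic_def)
qed

text \<open>The map \<open>(q, g) \<mapsto> (q R, g)\<close> preserves the joint law of rotation and Gaussian vector, and it rotates the solution by the
  inverse of \<open>R\<close>.\<close>
lemma solution_law:
  fixes L :: "'n \<Rightarrow> (real^'d) set"
  assumes T: "\<And>i. invertible (T i)" and L: "\<And>i. subspace (L i)"
    and less: "(\<Sum>i\<in>UNIV. dim ((L i)\<^sup>\<bottom>)) < CARD('d)"
  shows "AE p in distr (\<nu> \<Otimes>\<^sub>M std_gaussian) borel (solution T L). nondegenerate L p"
    and "\<And>R. stabilizes R L \<Longrightarrow>
      distr (distr (\<nu> \<Otimes>\<^sub>M std_gaussian) borel (solution T L)) borel (rotate2 R) = distr (\<nu> \<Otimes>\<^sub>M std_gaussian) borel (solution T L)"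
proof -
  note sol_meas [measurable] = borel_measurable_solution[of T L, OF T L]
  have sol_meas' [measurable]: "solution T L \<in> (\<nu> \<Otimes>\<^sub>M std_gaussian) \<rightarrow>\<^sub>M borel"
    by (subst measurable_cong_sets[OF sets_pair refl]) (rule sol_meas)
  have gen: "AE q in \<nu>. generic T L q" by (rule AE_generic[OF T]) (use less in simp)
  have nd: "{w. nondegenerate L (solution T L w)} \<in> sets borel"
    using measurable_sets[OF sol_meas borel_nondegenerate[of L, OF L]] by (simp add: vimage_def)
  have "AE w in \<nu> \<Otimes>\<^sub>M std_gaussian. nondegenerate L (solution T L w)"
  proof (rule pair.AE_pair_measure)
    show "{w \<in> space (\<nu> \<Otimes>\<^sub>M std_gaussian). nondegenerate L (solution T L w)} \<in> sets (\<nu> \<Otimes>\<^sub>M std_gaussian)"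
      using nd unfolding sets_pair by simp
    show "AE q in \<nu>. AE g in std_gaussian. nondegenerate L (solution T L (q, g))"
      using gen by eventually_elim (rule AE_solution_nondegenerate[OF T L _ less])
  qed
  then show "AE p in distr (\<nu> \<Otimes>\<^sub>M std_gaussian) borel (solution T L). nondegenerate L p"
    using borel_nondegenerate[of L, OF L] by (subst AE_distr_iff) auto
  fix R assume R: "stabilizes R L"
  then have orth: "orthogonal_matrix (R i)" for i by (simp add: stabilizes_def)
  define \<Phi> where "\<Phi> = (\<lambda>(q :: real^'d^'d^'n, g :: real^'d). (\<chi> i. q $ i ** R i, g))"
  have \<Phi> [measurable]: "\<Phi> \<in> (\<nu> \<Otimes>\<^sub>M std_gaussian) \<rightarrow>\<^sub>M (borel \<Otimes>\<^sub>M borel)" unfolding \<Phi>_def by measurable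
  have inv: "distr (\<nu> \<Otimes>\<^sub>M std_gaussian) (borel \<Otimes>\<^sub>M borel) \<Phi> = \<nu> \<Otimes>\<^sub>M std_gaussian"
  proof -
    have id: "distr std_gaussian borel (\<lambda>g. g) = (std_gaussian :: (real^'d) measure)"
      by (rule distr_id2) simp
    have "distr \<nu> borel (\<lambda>q. \<chi> i. q $ i ** R i) \<Otimes>\<^sub>M distr (std_gaussian :: (real^'d) measure) borel (\<lambda>g. g)
      = distr (\<nu> \<Otimes>\<^sub>M std_gaussian) (borel \<Otimes>\<^sub>M borel) \<Phi>"
      unfolding \<Phi>_def
      by (rule pair_measure_distr) (auto simp: id intro: std_gaussian.sigma_finite_measure_axioms)
    then show ?thesis by (simp add: id right_invariant[of R, OF orth])
  qed
  have AE: "AE w in \<nu> \<Otimes>\<^sub>M std_gaussian. rotate2 R (solution T L (\<Phi> w)) = solution T L w"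
  proof -
    have "AE w in \<nu> \<Otimes>\<^sub>M (std_gaussian :: (real^'d) measure). generic T L (fst w)"
    proof (rule pair.AE_pair_measure)
      have "fst -` {q. generic T L q} \<inter> space (borel :: ((real^'d^'d^'n) \<times> (real^'d)) measure) \<in> sets borel"
        by (rule measurable_sets[OF borel_measurable_continuous_onI borel_generic]) (intro continuous_intros)
      then show "{w \<in> space (\<nu> \<Otimes>\<^sub>M (std_gaussian :: (real^'d) measure)). generic T L (fst w)} \<in> sets (\<nu> \<Otimes>\<^sub>M std_gaussian)"
        unfolding sets_pair by (simp add: vimage_def)
    qed (use gen in simp)
    then show ?thesis
    proof eventually_elim
      case (elim w)
      obtain q g where w: "w = (q, g)" by (cases w)
      have q: "generic T L q" using elim w by simp
      have "decomposes T L (\<chi> i. q $ i ** R i) g (solution T L (\<Phi> w))"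
        unfolding solution_iff[of T L, OF T L generic_right_mult[OF R q]] by (simp add: w \<Phi>_def)
      then have "decomposes T L q g (rotate2 R (solution T L (\<Phi> w)))" by (rule decomposes_rotate[OF R])
      then show ?case unfolding solution_iff[of T L, OF T L q] by (simp add: w)
    qed
  qed
  have sol_meas2 [measurable]: "solution T L \<in> (borel \<Otimes>\<^sub>M borel) \<rightarrow>\<^sub>M borel" unfolding borel_prod by (rule sol_meas)
  have "distr (distr (\<nu> \<Otimes>\<^sub>M std_gaussian) borel (solution T L)) borel (rotate2 R)
      = distr (\<nu> \<Otimes>\<^sub>M std_gaussian) borel (\<lambda>w. rotate2 R (solution T L w))"
    by (simp add: distr_distr comp_def)
  also have "\<dots> = distr (distr (\<nu> \<Otimes>\<^sub>M std_gaussian) (borel \<Otimes>\<^sub>M borel) \<Phi>) borel (\<lambda>w. rotate2 R (solution T L w))"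
    unfolding inv ..
  also have "\<dots> = distr (\<nu> \<Otimes>\<^sub>M std_gaussian) borel (\<lambda>w. rotate2 R (solution T L (\<Phi> w)))"
    by (subst distr_distr) (auto simp: comp_def)
  also have "\<dots> = distr (\<nu> \<Otimes>\<^sub>M std_gaussian) borel (solution T L)"
    by (rule distr_cong_AE[OF refl refl AE]) measurable
  finally show "distr (distr (\<nu> \<Otimes>\<^sub>M std_gaussian) borel (solution T L)) borel (rotate2 R)
      = distr (\<nu> \<Otimes>\<^sub>M std_gaussian) borel (solution T L)" .
qed

text \<open>Both sides are the probability that all pairs \<open>(a\<^sub>i, b\<^sub>i)\<close> lie in the biconic sets \<open>A\<^sub>i\<close>: on the left the pairs come from the
  decomposition of one Gaussian vector along randomly rotated subspaces, on the right from projecting independent Gaussian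
  vectors. The assumption on the codimensions makes the intersection of the rotated subspaces nontrivial, so that the
  directions of the \<open>a\<^sub>i\<close> are defined.\<close>
lemma kinematic_formula_subspaces:
  fixes L :: "'n \<Rightarrow> (real^'d) set"
  assumes T: "\<And>i. invertible (T i)" and L: "\<And>i. subspace (L i)"
    and less: "(\<Sum>i\<in>UNIV. dim ((L i)\<^sup>\<bottom>)) < CARD('d)"
    and A: "\<And>i. A i \<in> sets borel"
    and biconic: "\<And>i s t x z. 0 < s \<Longrightarrow> 0 < t \<Longrightarrow> (s *\<^sub>R x, t *\<^sub>R z) \<in> A i \<longleftrightarrow> (x, z) \<in> A i"
    and AL: "\<And>i x z. (x, z) \<in> A i \<Longrightarrow> x \<in> L i \<and> z \<in> (L i)\<^sup>\<bottom>"
  shows "{w. \<forall>i. (fst (solution T L w) $ i, snd (solution T L w) $ i) \<in> A i} \<in> sets borel"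
    and "emeasure (\<nu> \<Otimes>\<^sub>M std_gaussian) {w. \<forall>i. (fst (solution T L w) $ i, snd (solution T L w) $ i) \<in> A i}
      = emeasure std_gaussian {x + z |x z. \<forall>i. (x $ i, z $ i) \<in> A i}"
proof -
  let ?E = "{p. \<forall>i. (fst p $ i, snd p $ i) \<in> A i}"
  have E: "?E \<in> sets borel" by (rule borel_componentwise[of A, OF A])
  note sol_meas = borel_measurable_solution[of T L, OF T L]
  have sol_meas' [measurable]: "solution T L \<in> (\<nu> \<Otimes>\<^sub>M std_gaussian) \<rightarrow>\<^sub>M borel"
    by (subst measurable_cong_sets[OF sets_pair refl]) (rule sol_meas)
  note proj_meas [measurable] = borel_measurable_projections[of L, OF L]
  have solE: "{w. \<forall>i. (fst (solution T L w) $ i, snd (solution T L w) $ i) \<in> A i} = solution T L -` ?E" by auto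
  have projE: "{x + z |x z. \<forall>i. (x $ i, z $ i) \<in> A i} = projections L -` ?E"
  proof (intro set_eqI iffI)
    fix g assume "g \<in> {x + z |x z. \<forall>i. (x $ i, z $ i) \<in> A i}"
    then obtain x z where g: "g = x + z" and xz: "\<And>i. (x $ i, z $ i) \<in> A i" by blast
    have "closest_point (L i) (x $ i + z $ i) = x $ i" for i
      using AL[OF xz[of i]] by (intro closest_point_subspace_add L) auto
    then show "g \<in> projections L -` ?E" using xz by (simp add: g projections_def)
  next
    fix g assume "g \<in> projections L -` ?E"
    then have "\<forall>i. (fst (projections L g) $ i, snd (projections L g) $ i) \<in> A i" by simp
    moreover have "g = fst (projections L g) + snd (projections L g)" by (simp add: projections_def vec_eq_iff)
    ultimately show "g \<in> {x + z |x z. \<forall>i. (x $ i, z $ i) \<in> A i}" by blast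
  qed
  show "{w. \<forall>i. (fst (solution T L w) $ i, snd (solution T L w) $ i) \<in> A i} \<in> sets borel"
    unfolding solE using measurable_sets[OF sol_meas E] by simp
  have "emeasure (distr (\<nu> \<Otimes>\<^sub>M std_gaussian) borel (solution T L)) ?E = emeasure (distr std_gaussian borel (projections L)) ?E"
  proof (rule invariant_law_biconic_eq[of L _ _ A, OF L _ _ solution_law[of T L, OF T L less] _ _ projection_law[of L, OF L] A biconic])
    show "prob_space (distr (\<nu> \<Otimes>\<^sub>M std_gaussian) borel (solution T L))"
      by (rule pair.prob_space_distr) measurable
    show "prob_space (distr std_gaussian borel (projections L))"
      by (rule std_gaussian.prob_space_distr) measurable
  qed simp_all
  then show "emeasure (\<nu> \<Otimes>\<^sub>M std_gaussian) {w. \<forall>i. (fst (solution T L w) $ i, snd (solution T L w) $ i) \<in> A i}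
      = emeasure std_gaussian {x + z |x z. \<forall>i. (x $ i, z $ i) \<in> A i}"
    unfolding solE projE using E by (simp add: emeasure_distr)
qed

end

text \<open>The contribution of a tuple of biconic sets to the conjunction of their images, as the set of Gaussian vectors
  \<open>x + z\<close>.\<close>
definition slice ::
  "('n::finite \<Rightarrow> real^'d^'d) \<Rightarrow> ('n \<Rightarrow> ((real^'d) \<times> (real^'d)) set) \<Rightarrow> real^'d^'d^'n \<Rightarrow> (real^'d) set" where
  "slice T A q = {x + (\<Sum>j\<in>UNIV. dual (T j) *v (q $ j *v b j)) |x a b.
     \<forall>i. x = T i *v (q $ i *v a i) \<and> (a i, b i) \<in> A i}"

lemma solution_slice:
  fixes L :: "'n::finite \<Rightarrow> (real^'d) set"
  assumes T: "\<And>i. invertible (T i)" and L: "\<And>i. subspace (L i)" and gen: "generic T L q"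
    and AL: "\<And>i x z. (x, z) \<in> A i \<Longrightarrow> x \<in> L i \<and> z \<in> (L i)\<^sup>\<bottom>"
  shows "{g. \<forall>i. (fst (solution T L (q, g)) $ i, snd (solution T L (q, g)) $ i) \<in> A i}
    = slice T A q"
proof (intro set_eqI iffI)
  fix g assume g: "g \<in> {g. \<forall>i. (fst (solution T L (q, g)) $ i, snd (solution T L (q, g)) $ i) \<in> A i}"
  let ?p = "solution T L (q, g)"
  have d: "decomposes T L q g ?p" by (simp add: solution_iff[of T L, OF T L gen])
  let ?y = "\<Sum>j\<in>UNIV. dual (T j) *v (q $ j *v snd ?p $ j)"
  have "T i *v (q $ i *v fst ?p $ i) = g - ?y" for i
    unfolding eq_diff_eq using d unfolding decomposes_def by (rule allE[of _ i]) (elim conjE)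
  then show "g \<in> slice T A q"
    unfolding slice_def using g by (intro CollectI exI[of _ "g - ?y"] exI[of _ "\<lambda>i. fst ?p $ i"] exI[of _ "\<lambda>i. snd ?p $ i"]) simp
next
  fix g assume "g \<in> slice T A q"
  then obtain x a b where g: "g = x + (\<Sum>j\<in>UNIV. dual (T j) *v (q $ j *v b j))"
    and x: "\<And>i. x = T i *v (q $ i *v a i)" and ab: "\<And>i. (a i, b i) \<in> A i"
    unfolding slice_def by blast
  have "decomposes T L q g (\<chi> i. a i, \<chi> i. b i)"
    unfolding decomposes_def using AL[OF ab] by (simp add: g x[symmetric] del: transpose_matrix_vector)
  then have "solution T L (q, g) = (\<chi> i. a i, \<chi> i. b i)" unfolding solution_iff[of T L, OF T L gen] by simp
  then show "g \<in> {g. \<forall>i. (fst (solution T L (q, g)) $ i, snd (solution T L (q, g)) $ i) \<in> A i}"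
    using ab by simp
qed

section \<open>Dimensions of random intersections\<close>

lemma dim_orthogonal_comp:
  fixes L :: "'a::euclidean_space set"
  assumes "subspace L" shows "dim (L\<^sup>\<bottom>) + dim L = DIM('a)"
proof -
  have "dim {y \<in> UNIV. \<forall>x\<in>L. orthogonal x y} + dim L = dim (UNIV :: 'a set)"
    by (rule dim_subspace_orthogonal_to_vectors) (use assms in auto)
  then show ?thesis by (simp add: orthogonal_comp_def)
qed

text \<open>Reduces tuples whose total codimension exceeds the dimension of the space to the critical case.\<close>
lemma shrink_subspaces:
  fixes N :: "'n::finite \<Rightarrow> 'a::euclidean_space set"
  assumes "\<And>i. subspace (N i)" and "m \<le> (\<Sum>i\<in>UNIV. dim (N i))"
  obtains N' where "\<And>i. subspace (N' i)" "\<And>i. N' i \<subseteq> N i" "(\<Sum>i\<in>UNIV. dim (N' i)) = m"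
proof -
  have "\<exists>c'. (\<forall>i. c' i \<le> c i) \<and> (\<Sum>i\<in>I. c' i) = m"
    if "finite I" "m \<le> (\<Sum>i\<in>I. c i)" for c :: "'n \<Rightarrow> nat" and I m
    using that
  proof (induction I arbitrary: m rule: finite_induct)
    case empty
    then show ?case by (intro exI[of _ "\<lambda>_. 0"]) auto
  next
    case (insert i I)
    \<comment> \<open>greedy choice: the index \<open>i\<close> receives as much as possible\<close>
    have "m - min m (c i) \<le> (\<Sum>i\<in>I. c i)" using insert by auto
    then obtain c' where c': "\<forall>i. c' i \<le> c i" "(\<Sum>i\<in>I. c' i) = m - min m (c i)" using insert.IH by blast
    have "(\<Sum>j\<in>I. (c'(i := min m (c i))) j) = (\<Sum>j\<in>I. c' j)"
      by (rule sum.cong) (use insert.hyps in auto)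
    then show ?case using insert.hyps c'
      by (intro exI[of _ "c'(i := min m (c i))"]) auto
  qed
  from this[OF _ assms(2)] obtain c' where c': "\<forall>i. c' i \<le> dim (N i)" "(\<Sum>i\<in>UNIV. c' i) = m" by auto
  have "\<forall>i. \<exists>N'. subspace N' \<and> N' \<subseteq> N i \<and> dim N' = c' i"
  proof
    fix i
    obtain N' where "subspace N'" "N' \<subseteq> span (N i)" "dim N' = c' i"
      using choose_subspace_of_subspace[of "c' i" "N i"] c'(1) by auto
    then show "\<exists>N'. subspace N' \<and> N' \<subseteq> N i \<and> dim N' = c' i" using span_eq_iff[THEN iffD2, OF assms(1)[of i]] by auto
  qed
  from choice[OF this] obtain N' where "\<forall>i. subspace (N' i) \<and> N' i \<subseteq> N i \<and> dim (N' i) = c' i" ..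
  then show ?thesis using c'(2) by (intro that[of N']) auto
qed

lemma dim_transversal_sum:
  assumes N: "\<And>i. subspace (N i)" and tr: "transversal B N q"
  shows "dim ((\<lambda>b. \<Sum>i\<in>UNIV. B i *v (q $ i *v b $ i)) ` {b. \<forall>i. b $ i \<in> N i}) = (\<Sum>i\<in>UNIV. dim (N i))"
proof -
  let ?S = "\<lambda>b. \<Sum>i\<in>UNIV. B i *v (q $ i *v b $ i)"
  have sub: "subspace {b. \<forall>i. b $ i \<in> N i}" by (rule subspace_vec[of N, OF N])
  have "inj_on ?S (span {b. \<forall>i. b $ i \<in> N i})"
  proof (subst linear_inj_on_iff_eq_0[OF linear_sum_images])
    show "\<forall>b\<in>span {b. \<forall>i. b $ i \<in> N i}. ?S b = 0 \<longrightarrow> b = 0"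
      using tr unfolding span_eq_iff[THEN iffD2, OF sub] transversal_def by auto
  qed simp
  then have "dim (?S ` {b. \<forall>i. b $ i \<in> N i}) = dim {b. \<forall>i. b $ i \<in> N i}"
    by (rule dim_image_eq[OF linear_sum_images])
  also have "\<dots> = (\<Sum>i\<in>UNIV. dim (N i))" by (rule dim_vec_subspace[of N, OF N])
  finally show ?thesis .
qed

text \<open>In general position the intersection has dimension \<open>\<Sum>i. dim (L i) - n d\<close>, where \<open>n + 1\<close> is the number of subspaces, if this is
  nonnegative, and dimension \<open>0\<close> otherwise; as \<open>k > 0\<close>, the second case does not occur for dimension \<open>k\<close>. The sum of the
  dual images of the \<open>L\<^sub>i\<^sup>\<bottom>\<close> is the orthogonal complement of the intersection. If the codimensions sum up to more than \<open>d\<close>,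
  subspaces of the \<open>L\<^sub>i\<^sup>\<bottom>\<close> with total dimension \<open>d\<close> already have dual images that span everything.\<close>
lemma (in right_invariant_rotations) AE_dim_Inter:
  fixes L :: "'n \<Rightarrow> (real^'d) set" and T :: "'n \<Rightarrow> real^'d^'d"
  assumes T: "\<And>i. invertible (T i)" and L: "\<And>i. subspace (L i)" and k: "0 < k"
  shows "AE q in \<nu>. dim (\<Inter>i. (\<lambda>y. T i *v (q $ i *v y)) ` L i) = k \<longleftrightarrow>
    (\<Sum>i\<in>UNIV. dim (L i)) + CARD('d) = CARD('n) * CARD('d) + k"
proof -
  let ?S = "\<lambda>(q :: real^'d^'d^'n) (b :: real^'d^'n). \<Sum>i\<in>UNIV. dual (T i) *v (q $ i *v b $ i)"
  let ?U = "\<lambda>q. ?S q ` {b. \<forall>i. b $ i \<in> (L i)\<^sup>\<bottom>}"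
  \<comment> \<open>the total codimension\<close>
  define c where "c = (\<Sum>i\<in>UNIV. dim ((L i)\<^sup>\<bottom>))"
  have "(\<Sum>i\<in>UNIV. dim ((L i)\<^sup>\<bottom>) + dim (L i)) = CARD('n) * CARD('d)"
    by (simp add: dim_orthogonal_comp[OF L])
  then have c: "c + (\<Sum>i\<in>UNIV. dim (L i)) = CARD('n) * CARD('d)" by (simp add: c_def sum.distrib)
  have subU: "subspace (?U q)" for q
    by (intro linear_subspace_image linear_sum_images subspace_vec subspace_orthogonal_comp)
  have dimV: "dim (\<Inter>i. (\<lambda>y. T i *v (q $ i *v y)) ` L i) + dim (?U q) = CARD('d)"
    if "\<forall>i. orthogonal_matrix (q $ i)" for q
    using dim_orthogonal_comp[OF subU[of q]] Inter_images_eq_orthogonal_comp[of T L q, OF T L] that by simp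
  show ?thesis
  proof (cases "c \<le> CARD('d)")
    case True
    have "AE q in \<nu>. generic T L q" by (rule AE_generic[OF T]) (use True c_def in simp)
    then show ?thesis
    proof eventually_elim
      case (elim q)
      have "dim (?U q) = c"
        unfolding c_def by (rule dim_transversal_sum[OF subspace_orthogonal_comp]) (use elim in \<open>simp add: generic_def\<close>)
      then show ?case using dimV[of q] elim c True by (auto simp: generic_def)
    qed
  next
    case False
    then obtain N where N: "\<And>i. subspace (N i)" "\<And>i. N i \<subseteq> (L i)\<^sup>\<bottom>" "(\<Sum>i\<in>UNIV. dim (N i)) = CARD('d)"
      using shrink_subspaces[of "\<lambda>i. (L i)\<^sup>\<bottom>" "CARD('d)"] subspace_orthogonal_comp by (force simp: c_def)
    have "AE q in \<nu>. transversal (\<lambda>i. dual (T i)) N q"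
      by (rule AE_transversal[OF invertible_dual[OF T] N(1)]) (simp add: N(3))
    then show ?thesis using AE_orthogonal
    proof eventually_elim
      case (elim q)
      have "CARD('d) = dim (?S q ` {b. \<forall>i. b $ i \<in> N i})"
        using dim_transversal_sum[OF N(1) elim(1)] N(3) by simp
      also have "\<dots> \<le> dim (?U q)" using N(2) by (intro dim_subset image_mono) auto
      finally have "dim (\<Inter>i. (\<lambda>y. T i *v (q $ i *v y)) ` L i) = 0" using dimV[OF elim(2)] by linarith
      then show ?case using c False k by linarith
    qed
  qed
qed

lemma matrix_inv_eqI:
  fixes A B :: "real^'d^'d"
  assumes "A ** B = mat 1" "B ** A = mat 1"
  shows "matrix_inv A = B"
proof -
  have "invertible A" using assms by (auto simp: invertible_def)
  then have "matrix_inv A ** (A ** B) = B" by (simp add: matrix_mul_assoc matrix_inv_left)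
  then show ?thesis by (simp add: assms)
qed

lemma dual_mul_orthogonal:
  fixes T Q :: "real^'d^'d"
  assumes T: "invertible T" and Q: "orthogonal_matrix Q"
  shows "invertible (T ** Q)" and "dual (T ** Q) *v y = dual T *v (Q *v y)"
proof -
  have "(T ** Q) ** (transpose Q ** matrix_inv T) = T ** (Q ** transpose Q) ** matrix_inv T"
    by (simp add: matrix_mul_assoc)
  then have 1: "(T ** Q) ** (transpose Q ** matrix_inv T) = mat 1"
    using Q by (simp add: orthogonal_matrix_def matrix_inv_right[OF T])
  have "(transpose Q ** matrix_inv T) ** (T ** Q) = transpose Q ** (matrix_inv T ** T) ** Q"
    by (simp add: matrix_mul_assoc)
  then have 2: "(transpose Q ** matrix_inv T) ** (T ** Q) = mat 1"
    using Q by (simp add: orthogonal_matrix_def matrix_inv_left[OF T])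
  show "invertible (T ** Q)" using 1 2 by (auto simp: invertible_def)
  have "dual (T ** Q) = dual T ** Q"
    unfolding matrix_inv_eqI[OF 1 2] by (simp add: matrix_transpose_mul)
  then show "dual (T ** Q) *v y = dual T *v (Q *v y)" by (simp add: matrix_vector_mul_assoc)
qed

section \<open>Completed measures and product cones\<close>

text \<open>Needed because the support measure of the random intersection is controlled only for generic rotations; elsewhere it
  may depend on the rotation in a nonmeasurable way.\<close>
lemma borel_measurable_completion_AE:
  assumes g: "g \<in> M \<rightarrow>\<^sub>M N" and AE: "AE x in M. f x = g x" and f: "\<And>x. x \<in> space M \<Longrightarrow> f x \<in> space N"
  shows "f \<in> completion M \<rightarrow>\<^sub>M N"
proof (rule measurableI)
  fix B assume B: "B \<in> sets N"
  obtain Z where Z: "Z \<in> null_sets M" "{x \<in> space M. f x \<noteq> g x} \<subseteq> Z" using AE by (auto elim!: AE_E intro: null_setsI)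
  have eq: "f -` B \<inter> space M = (g -` B \<inter> space M - Z) \<union> (f -` B \<inter> space M \<inter> Z)" using Z(2) by auto
  have "g -` B \<inter> space M - Z \<in> sets (completion M)"
    using measurable_sets[OF g B] Z(1) by (intro sets_completionI_sets sets.Diff) auto
  moreover have "f -` B \<inter> space M \<inter> Z \<in> null_sets (completion M)"
    by (rule null_sets_completion_subset[OF _ null_sets_completionI[OF Z(1)]]) auto
  ultimately have "(g -` B \<inter> space M - Z) \<union> (f -` B \<inter> space M \<inter> Z) \<in> sets (completion M)"
    by (intro sets.Un) (auto simp: null_sets_def)
  then show "f -` B \<inter> space (completion M) \<in> sets (completion M)"
    unfolding space_completion eq[symmetric] .
qed (use f in simp)

lemma measure_completion_finite_UN:
  fixes B :: "'i \<Rightarrow> 'a::euclidean_space set"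
  assumes "finite I" "\<And>i. i \<in> I \<Longrightarrow> B i \<in> sets borel" "disjoint_family_on B I"
  shows "measure (completion std_gaussian) (\<Union>i\<in>I. B i) = (\<Sum>i\<in>I. measure std_gaussian (B i))"
proof -
  have "(\<Union>i\<in>I. B i) \<in> sets std_gaussian" using assms(1,2) by (auto intro: sets.finite_UN)
  then have "measure (completion std_gaussian) (\<Union>i\<in>I. B i) = measure std_gaussian (\<Union>i\<in>I. B i)"
    by (rule measure_completion)
  also have "\<dots> = (\<Sum>i\<in>I. measure std_gaussian (B i))"
    using assms by (intro std_gaussian.finite_measure_finite_Union) auto
  finally show ?thesis .
qed

lemma biconic_product_subset_lift:
  assumes "\<And>i. M i \<subseteq> biconic_lift (C i)"
  shows "biconic_product M \<subseteq> biconic_lift (cone_product C)"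
proof (rule subsetI, clarify)
  fix x z assume xz: "(x, z) \<in> biconic_product M"
  then have BL: "(x $ i, z $ i) \<in> biconic_lift (C i)" for i using assms by (auto simp: biconic_product_def)
  have "w \<bullet> z \<le> 0" if w: "w \<in> cone_product C" for w
    unfolding inner_vec_def[of w z]
  proof (rule sum_nonpos)
    fix i
    have "w $ i \<in> C i" using w by (simp add: cone_product_def)
    then show "w $ i \<bullet> z $ i \<le> 0" using BL[of i] by (simp add: biconic_lift_def polar_cone_def)
  qed
  moreover have "x \<bullet> z = 0"
    unfolding inner_vec_def[of x z] using BL by (intro sum.neutral) (simp add: biconic_lift_def)
  moreover have "x \<in> cone_product C" using BL by (simp add: biconic_lift_def cone_product_def)
  ultimately show "(x, z) \<in> biconic_lift (cone_product C)" by (simp add: biconic_lift_def polar_cone_def)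
qed

lemma dim_face_span_cone_product:
  fixes C :: "'n::finite \<Rightarrow> (real^'d) set"
  assumes C: "\<And>i. polyhedral_cone (C i)" and x: "x \<in> cone_product C"
  shows "dim (face_span (cone_product C) x) = (\<Sum>i\<in>UNIV. dim (face_span (C i) (x $ i)))"
proof -
  have "x $ i \<in> C i" for i using x by (simp add: cone_product_def)
  then have "subspace (face_span (C i) (x $ i))" for i by (rule subspace_face_span[OF C])
  then show ?thesis
    unfolding polyhedral_cone_product(2)[of C, OF C x] by (rule dim_vec_subspace)
qed

section \<open>Support measures as sums over faces\<close>

text \<open>The unions over faces below are disjoint because the nearest point to \<open>g\<close> reveals the face.\<close>
lemma disjoint_family_on_labelled:
  assumes "\<And>i g. g \<in> B i \<Longrightarrow> h g = i"
  shows "disjoint_family_on B I"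
  unfolding disjoint_family_on_def using assms by (metis disjoint_iff)

definition pair_sums :: "('a::euclidean_space \<times> 'a) set \<Rightarrow> 'a set" where
  "pair_sums A = {x + z |x z. (x, z) \<in> A}"

lemma borel_pair_sums_face_part:
  assumes C: "polyhedral_cone C" and M: "M \<in> biconic_sets" "M \<subseteq> biconic_lift C"
  shows "pair_sums (face_part C M L) \<in> sets borel"
proof -
  note cC = convex_polyhedral_cone[OF C] closed_polyhedral_cone[OF C]
  let ?f = "\<lambda>g. (closest_point C g, g - closest_point C g)"
  have "pair_sums (face_part C M L) = ?f -` face_part C M L"
  proof (intro set_eqI iffI)
    fix g assume "g \<in> pair_sums (face_part C M L)"
    then obtain x z where g: "g = x + z" "(x, z) \<in> face_part C M L" by (auto simp: pair_sums_def)
    then have "(x, z) \<in> biconic_lift C" using M(2) by (auto simp: face_part_def)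
    then show "g \<in> ?f -` face_part C M L" using g moreau_unique(1)[OF cC, of x z] by simp
  next
    fix g assume g: "g \<in> ?f -` face_part C M L"
    have "g = closest_point C g + (g - closest_point C g)" by simp
    then show "g \<in> pair_sums (face_part C M L)" using g unfolding pair_sums_def by blast
  qed
  moreover have "?f \<in> borel_measurable borel"
    using zero_in_polyhedral_cone[OF C]
    by (intro borel_measurable_continuous_onI continuous_intros continuous_on_closest_point cC) auto
  ultimately show ?thesis
    using measurable_sets[OF _ face_part_biconic(1)[OF C M], of ?f borel L] by simp
qed

text \<open>By the Moreau decomposition the sums \<open>x + z\<close> of different face parts are disjoint, and they are Borel sets.\<close>
lemma support_measure_eq_sum_faces:
  assumes C: "polyhedral_cone C" and M: "M \<in> biconic_sets" "M \<subseteq> biconic_lift C"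
  shows "support_measure k C M =
    (\<Sum>L | L \<in> face_span C ` C \<and> dim L = k. measure std_gaussian (pair_sums (face_part C M L)))"
proof -
  note cC = convex_polyhedral_cone[OF C] closed_polyhedral_cone[OF C]
  let ?K = "{L. L \<in> face_span C ` C \<and> dim L = k}"
  have "{x + z |x z. (x, z) \<in> M \<and> dim (face_span C x) = k} = (\<Union>L\<in>?K. pair_sums (face_part C M L))"
  proof (intro set_eqI iffI)
    fix g assume "g \<in> {x + z |x z. (x, z) \<in> M \<and> dim (face_span C x) = k}"
    then obtain x z where g: "g = x + z" "(x, z) \<in> M" "dim (face_span C x) = k" by blast
    then have "x \<in> C" using M(2) by (auto simp: biconic_lift_def)
    then have "face_span C x \<in> ?K" using g(3) by simp
    moreover have "g \<in> pair_sums (face_part C M (face_span C x))"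
      using g by (auto simp: pair_sums_def face_part_def)
    ultimately show "g \<in> (\<Union>L\<in>?K. pair_sums (face_part C M L))" by (rule UN_I)
  next
    fix g assume "g \<in> (\<Union>L\<in>?K. pair_sums (face_part C M L))"
    then obtain x z where "g = x + z" "(x, z) \<in> M" "dim (face_span C x) = k"
      by (auto simp: pair_sums_def face_part_def)
    then show "g \<in> {x + z |x z. (x, z) \<in> M \<and> dim (face_span C x) = k}" by blast
  qed
  moreover have "disjoint_family_on (\<lambda>L. pair_sums (face_part C M L)) ?K"
  proof (rule disjoint_family_on_labelled)
    fix L g assume "g \<in> pair_sums (face_part C M L)"
    then obtain x z where g: "g = x + z" "(x, z) \<in> M" "face_span C x = L"
      by (auto simp: pair_sums_def face_part_def)
    then show "face_span C (closest_point C g) = L" using moreau_unique(1)[OF cC, of x z] M(2) by auto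
  qed
  moreover have "finite ?K" using finite_face_spans[OF C] by simp
  ultimately show ?thesis
    unfolding support_measure_eq[OF C M(2)]
    using borel_pair_sums_face_part[OF C M] by (simp add: measure_completion_finite_UN)
qed

lemma pair_sums_componentwise:
  "{x + z |x z. \<forall>i. (x $ i, z $ i) \<in> A i} = {g. \<forall>i. g $ i \<in> pair_sums (A i)}"
proof (intro set_eqI iffI)
  fix g assume "g \<in> {g. \<forall>i. g $ i \<in> pair_sums (A i)}"
  then have "\<forall>i. \<exists>p. g $ i = fst p + snd p \<and> p \<in> A i" by (force simp: pair_sums_def)
  from choice[OF this] obtain p where "\<forall>i. g $ i = fst (p i) + snd (p i) \<and> p i \<in> A i" ..
  then show "g \<in> {x + z |x z. \<forall>i. (x $ i, z $ i) \<in> A i}"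
    by (intro CollectI exI[of _ "\<chi> i. fst (p i)"] exI[of _ "\<chi> i. snd (p i)"]) (simp add: vec_eq_iff)
next
  fix g assume "g \<in> {x + z |x z. \<forall>i. (x $ i, z $ i) \<in> A i}"
  then obtain x z where g: "g = x + z" "\<And>i. (x $ i, z $ i) \<in> A i" by blast
  then have "x $ i + z $ i \<in> pair_sums (A i)" for i unfolding pair_sums_def by blast
  then show "g \<in> {g. \<forall>i. g $ i \<in> pair_sums (A i)}" by (simp add: g(1))
qed

lemma measure_pair_sums_componentwise:
  fixes A :: "'n::finite \<Rightarrow> ((real^'d) \<times> (real^'d)) set"
  assumes "\<And>i. pair_sums (A i) \<in> sets borel"
  shows "{x + z |x z. \<forall>i. (x $ i, z $ i) \<in> A i} \<in> sets borel"
    and "measure std_gaussian {x + z |x z. \<forall>i. (x $ i, z $ i) \<in> A i} = (\<Prod>i\<in>UNIV. measure std_gaussian (pair_sums (A i)))"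
proof -
  note [measurable] = assms
  have "{g \<in> space borel. \<forall>i. g $ i \<in> pair_sums (A i)} \<in> sets borel" by measurable
  then show "{x + z |x z. \<forall>i. (x $ i, z $ i) \<in> A i} \<in> sets borel"
    unfolding pair_sums_componentwise by simp
  show "measure std_gaussian {x + z |x z. \<forall>i. (x $ i, z $ i) \<in> A i} = (\<Prod>i\<in>UNIV. measure std_gaussian (pair_sums (A i)))"
    unfolding pair_sums_componentwise measure_def emeasure_std_gaussian_vec[of "\<lambda>i. pair_sums (A i)", OF assms]
    by (simp add: std_gaussian.emeasure_eq_measure prod_ennreal prod_nonneg)
qed

text \<open>The tuples of face spans with total dimension \<open>m\<close>. They index the \<open>m\<close>-dimensional faces of the product cone; for
  generic rotations and \<open>m = n d + k\<close>, every \<open>k\<close>-dimensional face of the intersection comes from one of them.\<close>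
definition face_tuples :: "('n \<Rightarrow> (real^'d) set) \<Rightarrow> nat \<Rightarrow> ('n::finite \<Rightarrow> (real^'d) set) set" where
  "face_tuples C m = {L. (\<forall>i. L i \<in> face_span (C i) ` C i) \<and> (\<Sum>i\<in>UNIV. dim (L i)) = m}"

lemma finite_face_tuples:
  assumes "\<And>i. polyhedral_cone (C i)" shows "finite (face_tuples C m)"
proof -
  have "finite (PiE UNIV (\<lambda>i. face_span (C i) ` C i))"
    by (rule finite_PiE) (auto intro: finite_face_spans assms)
  then show ?thesis by (rule finite_subset[rotated]) (auto simp: face_tuples_def PiE_iff)
qed

lemma support_measure_product_eq_sum_tuples:
  fixes C :: "'n::finite \<Rightarrow> (real^'d) set"
  assumes C: "\<And>i. polyhedral_cone (C i)" and M: "\<And>i. M i \<in> biconic_sets" "\<And>i. M i \<subseteq> biconic_lift (C i)"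
  shows "support_measure m (cone_product C) (biconic_product M) =
    (\<Sum>L\<in>face_tuples C m. measure std_gaussian {x + z |x z. \<forall>i. (x $ i, z $ i) \<in> face_part (C i) (M i) (L i)})"
proof -
  note pC = polyhedral_cone_product(1)[of C, OF C]
  note BL = biconic_product_subset_lift[of M C, OF M(2)]
  let ?Z = "\<lambda>L. {x + z |x z. \<forall>i. (x $ i, z $ i) \<in> face_part (C i) (M i) (L i)}"
  have prod: "x \<in> cone_product C" "(x, z) \<in> biconic_lift (cone_product C)" if "(x, z) \<in> biconic_product M" for x z
    using that BL by (auto simp: biconic_lift_def)
  have mem: "(x, z) \<in> biconic_product M \<longleftrightarrow> (\<forall>i. (x $ i, z $ i) \<in> M i)" for x z
    by (simp add: biconic_product_def)
  have "{x + z |x z. (x, z) \<in> biconic_product M \<and> dim (face_span (cone_product C) x) = m} = (\<Union>L\<in>face_tuples C m. ?Z L)"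
  proof (intro set_eqI iffI)
    fix g assume "g \<in> {x + z |x z. (x, z) \<in> biconic_product M \<and> dim (face_span (cone_product C) x) = m}"
    then obtain x z where g: "g = x + z" "(x, z) \<in> biconic_product M" "dim (face_span (cone_product C) x) = m" by blast
    let ?L = "\<lambda>i. face_span (C i) (x $ i)"
    have x: "x \<in> cone_product C" by (rule prod(1)[OF g(2)])
    have "?L \<in> face_tuples C m"
      using g(3) x unfolding dim_face_span_cone_product[of C, OF C x] by (simp add: face_tuples_def cone_product_def)
    moreover have "g \<in> ?Z ?L" using g(1,2) unfolding mem by (auto simp: face_part_def)
    ultimately show "g \<in> (\<Union>L\<in>face_tuples C m. ?Z L)" by (rule UN_I[where B="?Z"])
  next
    fix g assume "g \<in> (\<Union>L\<in>face_tuples C m. ?Z L)"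
    then obtain L x z where L: "L \<in> face_tuples C m" and g: "g = x + z" and xz: "\<And>i. (x $ i, z $ i) \<in> face_part (C i) (M i) (L i)"
      by blast
    have xzM: "(x, z) \<in> biconic_product M" unfolding mem using xz by (simp add: face_part_def)
    have "face_span (C i) (x $ i) = L i" for i using xz[of i] by (simp add: face_part_def)
    then have "dim (face_span (cone_product C) x) = m"
      using L unfolding dim_face_span_cone_product[of C, OF C prod(1)[OF xzM]] by (simp add: face_tuples_def)
    then show "g \<in> {x + z |x z. (x, z) \<in> biconic_product M \<and> dim (face_span (cone_product C) x) = m}"
      using g xzM by blast
  qed
  moreover have "disjoint_family_on ?Z (face_tuples C m)"
  proof (rule disjoint_family_on_labelled)
    fix L g assume "g \<in> ?Z L"
    then obtain x z where g: "g = x + z" and xz: "\<And>i. (x $ i, z $ i) \<in> face_part (C i) (M i) (L i)" by blast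
    have xzM: "(x, z) \<in> biconic_product M" unfolding mem using xz by (simp add: face_part_def)
    have "closest_point (cone_product C) g = x"
      unfolding g by (rule moreau_unique(1)[OF convex_polyhedral_cone[OF pC] closed_polyhedral_cone[OF pC] prod(2)[OF xzM]])
    then show "(\<lambda>i. face_span (C i) (closest_point (cone_product C) g $ i)) = L"
      using xz by (simp add: face_part_def)
  qed
  moreover have "?Z L \<in> sets borel" for L
    by (rule measure_pair_sums_componentwise(1)) (rule borel_pair_sums_face_part[OF C M])
  ultimately show ?thesis
    unfolding support_measure_eq[OF pC BL]
    using finite_face_tuples[of C m, OF C] by (simp add: measure_completion_finite_UN)
qed

text \<open>The tuples of face spans are grouped by their dimensions, and the measure of a product set factors; the sum over all
  tuples with prescribed dimensions is then a product of sums over faces.\<close>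
lemma support_measure_product:
  fixes C :: "'n::finite \<Rightarrow> (real^'d) set"
  assumes C: "\<And>i. polyhedral_cone (C i)" and M: "\<And>i. M i \<in> biconic_sets" "\<And>i. M i \<subseteq> biconic_lift (C i)"
  shows "support_measure m (cone_product C) (biconic_product M) =
    (\<Sum>j | (\<forall>i. j i \<le> CARD('d)) \<and> (\<Sum>i\<in>UNIV. j i) = m. \<Prod>i\<in>UNIV. support_measure (j i) (C i) (M i))"
proof -
  let ?w = "\<lambda>i L. measure std_gaussian (pair_sums (face_part (C i) (M i) L))"
  let ?F = "\<lambda>i j. {L. L \<in> face_span (C i) ` C i \<and> dim L = j}"
  let ?J = "{j :: 'n \<Rightarrow> nat. (\<forall>i. j i \<le> CARD('d)) \<and> (\<Sum>i\<in>UNIV. j i) = m}"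
  have fin: "finite (?F i j)" for i j using finite_face_spans[OF C] by simp
  have finJ: "finite ?J"
    by (rule finite_subset[of _ "PiE UNIV (\<lambda>_. {..CARD('d)})"]) (auto intro: finite_PiE simp: PiE_iff)
  have tuples: "face_tuples C m = (\<Union>j\<in>?J. PiE UNIV (\<lambda>i. ?F i (j i)))"
  proof (intro set_eqI iffI)
    fix L assume L: "L \<in> face_tuples C m"
    have "(\<lambda>i. dim (L i)) \<in> ?J" using L dim_subset_UNIV[of "L _"] by (auto simp: face_tuples_def)
    moreover have "L \<in> PiE UNIV (\<lambda>i. ?F i (dim (L i)))" using L by (simp add: face_tuples_def PiE_iff)
    ultimately show "L \<in> (\<Union>j\<in>?J. PiE UNIV (\<lambda>i. ?F i (j i)))"
      by (rule UN_I[where B="\<lambda>j. PiE UNIV (\<lambda>i. ?F i (j i))"])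
  next
    fix L assume "L \<in> (\<Union>j\<in>?J. PiE UNIV (\<lambda>i. ?F i (j i)))"
    then obtain j where "j \<in> ?J" "\<And>i. L i \<in> ?F i (j i)" by (auto simp: PiE_iff)
    then show "L \<in> face_tuples C m" by (simp add: face_tuples_def)
  qed
  have "support_measure m (cone_product C) (biconic_product M) = (\<Sum>L\<in>face_tuples C m. \<Prod>i\<in>UNIV. ?w i (L i))"
    unfolding support_measure_product_eq_sum_tuples[of C M m, OF C M]
    by (intro sum.cong refl measure_pair_sums_componentwise(2)) (rule borel_pair_sums_face_part[OF C M])
  also have "\<dots> = (\<Sum>j\<in>?J. \<Sum>L\<in>PiE UNIV (\<lambda>i. ?F i (j i)). \<Prod>i\<in>UNIV. ?w i (L i))"
    unfolding tuples
  proof (rule sum.UNION_disjoint[OF finJ])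
    show "\<forall>j\<in>?J. finite (PiE UNIV (\<lambda>i. ?F i (j i)))" by (intro ballI finite_PiE fin) simp
    show "\<forall>j\<in>?J. \<forall>j'\<in>?J. j \<noteq> j' \<longrightarrow> PiE UNIV (\<lambda>i. ?F i (j i)) \<inter> PiE UNIV (\<lambda>i. ?F i (j' i)) = {}"
    proof (intro ballI impI)
      fix j j' :: "'n \<Rightarrow> nat" assume "j \<noteq> j'"
      then obtain i where i: "j i \<noteq> j' i" by blast
      have "L \<notin> PiE UNIV (\<lambda>i. ?F i (j' i))" if "L \<in> PiE UNIV (\<lambda>i. ?F i (j i))" for L
      proof
        assume "L \<in> PiE UNIV (\<lambda>i. ?F i (j' i))"
        with that have "L i \<in> ?F i (j i)" "L i \<in> ?F i (j' i)" by (blast dest: PiE_mem)+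
        with i show False by simp
      qed
      then show "PiE UNIV (\<lambda>i. ?F i (j i)) \<inter> PiE UNIV (\<lambda>i. ?F i (j' i)) = {}" by blast
    qed
  qed
  also have "\<dots> = (\<Sum>j\<in>?J. \<Prod>i\<in>UNIV. \<Sum>L\<in>?F i (j i). ?w i L)"
    by (intro sum.cong refl prod_sum_PiE[symmetric] fin) simp
  also have "\<dots> = (\<Sum>j\<in>?J. \<Prod>i\<in>UNIV. support_measure (j i) (C i) (M i))"
    by (simp only: support_measure_eq_sum_faces[OF C M])
  finally show ?thesis .
qed

section \<open>Support measures of intersections\<close>

lemma mem_conjunction_images:
  fixes M :: "'n::finite \<Rightarrow> ((real^'d) \<times> (real^'d)) set"
  assumes T: "\<And>i. invertible (T i)" and q: "\<And>i. orthogonal_matrix (q $ i)"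
  shows "(x, z) \<in> conjunction (\<lambda>i. biconic_image (T i ** q $ i) (M i)) \<longleftrightarrow>
    (\<exists>a b. z = (\<Sum>j\<in>UNIV. dual (T j) *v (q $ j *v b j)) \<and> (\<forall>i. x = T i *v (q $ i *v a i) \<and> (a i, b i) \<in> M i))"
proof
  assume "(x, z) \<in> conjunction (\<lambda>i. biconic_image (T i ** q $ i) (M i))"
  then obtain y where z: "z = (\<Sum>i\<in>UNIV. y i)" and y: "\<And>i. (x, y i) \<in> biconic_image (T i ** q $ i) (M i)"
    unfolding conjunction_def by blast
  have "\<forall>i. \<exists>p. x = T i *v (q $ i *v fst p) \<and> y i = dual (T i) *v (q $ i *v snd p) \<and> p \<in> M i"
  proof
    fix i
    obtain a b where "(a, b) \<in> M i" "x = (T i ** q $ i) *v a" "y i = dual (T i ** q $ i) *v b"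
      using y[of i] by (auto simp: biconic_image_def simp del: transpose_matrix_vector)
    then show "\<exists>p. x = T i *v (q $ i *v fst p) \<and> y i = dual (T i) *v (q $ i *v snd p) \<and> p \<in> M i"
      unfolding dual_mul_orthogonal(2)[OF T q]
      by (intro exI[of _ "(a, b)"]) (simp add: matrix_vector_mul_assoc del: transpose_matrix_vector)
  qed
  from choice[OF this] obtain p
    where p: "\<forall>i. x = T i *v (q $ i *v fst (p i)) \<and> y i = dual (T i) *v (q $ i *v snd (p i)) \<and> p i \<in> M i" ..
  have "z = (\<Sum>j\<in>UNIV. dual (T j) *v (q $ j *v snd (p j)))"
    unfolding z by (rule sum.cong[OF refl]) (use p in blast)
  moreover have "\<forall>i. x = T i *v (q $ i *v fst (p i)) \<and> (fst (p i), snd (p i)) \<in> M i" using p by simp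
  ultimately show "\<exists>a b. z = (\<Sum>j\<in>UNIV. dual (T j) *v (q $ j *v b j)) \<and> (\<forall>i. x = T i *v (q $ i *v a i) \<and> (a i, b i) \<in> M i)"
    by (intro exI[of _ "\<lambda>i. fst (p i)"] exI[of _ "\<lambda>i. snd (p i)"] conjI)
next
  assume "\<exists>a b. z = (\<Sum>j\<in>UNIV. dual (T j) *v (q $ j *v b j)) \<and> (\<forall>i. x = T i *v (q $ i *v a i) \<and> (a i, b i) \<in> M i)"
  then obtain a b where z: "z = (\<Sum>j\<in>UNIV. dual (T j) *v (q $ j *v b j))"
    and x: "\<And>i. x = T i *v (q $ i *v a i)" and ab: "\<And>i. (a i, b i) \<in> M i" by blast
  have "(x, dual (T i) *v (q $ i *v b i)) \<in> biconic_image (T i ** q $ i) (M i)" for i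
    unfolding biconic_image_def
  proof (rule image_eqI[OF _ ab[of i]])
    show "(x, dual (T i) *v (q $ i *v b i)) = (case (a i, b i) of (x, x') \<Rightarrow> ((T i ** q $ i) *v x, dual (T i ** q $ i) *v x'))"
      using x[of i] unfolding prod.case dual_mul_orthogonal(2)[OF T q] by (simp add: matrix_vector_mul_assoc)
  qed
  then show "(x, z) \<in> conjunction (\<lambda>i. biconic_image (T i ** q $ i) (M i))"
    unfolding conjunction_def z by blast
qed

lemma conjunction_subset_lift:
  fixes M :: "'n::finite \<Rightarrow> ((real^'d) \<times> (real^'d)) set"
  assumes T: "\<And>i. invertible (T i)" and q: "\<And>i. orthogonal_matrix (q $ i)"
    and M: "\<And>i. M i \<subseteq> biconic_lift (C i)"
  shows "conjunction (\<lambda>i. biconic_image (T i ** q $ i) (M i)) \<subseteq> biconic_lift (\<Inter>i. cone_image (T i ** q $ i) (C i))"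
proof (rule subsetI, clarify)
  fix x z assume "(x, z) \<in> conjunction (\<lambda>i. biconic_image (T i ** q $ i) (M i))"
  then obtain a b where z: "z = (\<Sum>j\<in>UNIV. dual (T j) *v (q $ j *v b j))"
    and x: "\<And>i. x = T i *v (q $ i *v a i)" and ab: "\<And>i. (a i, b i) \<in> M i"
    unfolding mem_conjunction_images[of T q, OF T q] by blast
  have BL: "a i \<in> C i" "b i \<in> polar_cone (C i)" "a i \<bullet> b i = 0" for i
    using ab[of i] M[of i] by (auto simp: biconic_lift_def)
  have img: "cone_image (T i ** q $ i) (C i) = (\<lambda>y. T i *v (q $ i *v y)) ` C i" for i
    by (simp add: cone_image_def matrix_vector_mul_assoc)
  have "x \<in> (\<Inter>i. cone_image (T i ** q $ i) (C i))"
    unfolding img using x BL(1) by blast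
  moreover have "w \<bullet> z \<le> 0" if w: "w \<in> (\<Inter>i. cone_image (T i ** q $ i) (C i))" for w
    unfolding z inner_sum_right
  proof (rule sum_nonpos)
    fix i
    obtain c where c: "c \<in> C i" "w = T i *v (q $ i *v c)" using w unfolding img by blast
    show "w \<bullet> (dual (T i) *v (q $ i *v b i)) \<le> 0"
      unfolding c(2) inner_image_dual_image[OF T q] using BL(2)[of i] c(1) by (simp add: polar_cone_def)
  qed
  moreover have "x \<bullet> z = 0"
    unfolding z inner_sum_right
  proof (rule sum.neutral, rule ballI)
    fix i
    show "x \<bullet> (dual (T i) *v (q $ i *v b i)) = 0"
      unfolding x[of i] inner_image_dual_image[OF T q] by (rule BL(3))
  qed
  ultimately show "(x, z) \<in> biconic_lift (\<Inter>i. cone_image (T i ** q $ i) (C i))"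
    by (simp add: biconic_lift_def polar_cone_def)
qed

lemma face_span_intersection:
  fixes C :: "'n::finite \<Rightarrow> (real^'d) set"
  assumes C: "\<And>i. polyhedral_cone (C i)" and T: "\<And>i. invertible (T i)" and q: "\<And>i. orthogonal_matrix (q $ i)"
    and x: "\<And>i. x = T i *v (q $ i *v a i)" and a: "\<And>i. a i \<in> C i"
  shows "face_span (\<Inter>i. cone_image (T i ** q $ i) (C i)) x = (\<Inter>i. (\<lambda>y. T i *v (q $ i *v y)) ` face_span (C i) (a i))"
proof -
  have inv: "invertible (T i ** q $ i)" for i by (rule dual_mul_orthogonal(1)[OF T q])
  have xa: "x = (T i ** q $ i) *v a i" for i using x[of i] by (simp add: matrix_vector_mul_assoc)
  have "x \<in> cone_image (T i ** q $ i) (C i)" for i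
    unfolding cone_image_def by (rule image_eqI[where x="a i"]) (rule xa, rule a)
  then have "face_span (\<Inter>i. cone_image (T i ** q $ i) (C i)) x = (\<Inter>i. face_span (cone_image (T i ** q $ i) (C i)) x)"
    by (rule polyhedral_cone_Inter(2)[OF polyhedral_cone_image[OF inv C]])
  moreover have "face_span (cone_image (T i ** q $ i) (C i)) x = (\<lambda>y. T i *v (q $ i *v y)) ` face_span (C i) (a i)" for i
    unfolding xa[of i] face_span_cone_image[OF inv] by (simp add: matrix_vector_mul_assoc)
  ultimately show ?thesis by (simp only:)
qed

text \<open>The deterministic part of the kinematic formula. The assumption \<open>dim\<close> expresses general position: the images of a
  tuple intersect in dimension \<open>k\<close> exactly if its total dimension is \<open>m\<close>. The tuple is recovered from the nearest point to \<open>g\<close> in the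
  intersection, so the slices are disjoint.\<close>
lemma support_measure_intersection_eq_sum_tuples:
  fixes C :: "'n::finite \<Rightarrow> (real^'d) set"
  assumes C: "\<And>i. polyhedral_cone (C i)" and M: "\<And>i. M i \<subseteq> biconic_lift (C i)"
    and T: "\<And>i. invertible (T i)" and q: "\<And>i. orthogonal_matrix (q $ i)"
    and dim: "\<And>L. (\<And>i. L i \<in> face_span (C i) ` C i) \<Longrightarrow>
      dim (\<Inter>i. (\<lambda>y. T i *v (q $ i *v y)) ` L i) = k \<longleftrightarrow> (\<Sum>i\<in>UNIV. dim (L i)) = m"
    and borel: "\<And>L. L \<in> face_tuples C m \<Longrightarrow> slice T (\<lambda>i. face_part (C i) (M i) (L i)) q \<in> sets borel"
  shows "support_measure k (\<Inter>i. cone_image (T i ** q $ i) (C i)) (conjunction (\<lambda>i. biconic_image (T i ** q $ i) (M i)))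
    = (\<Sum>L\<in>face_tuples C m. measure std_gaussian (slice T (\<lambda>i. face_part (C i) (M i) (L i)) q))"
proof -
  let ?D = "\<Inter>i. cone_image (T i ** q $ i) (C i)"
  let ?N = "conjunction (\<lambda>i. biconic_image (T i ** q $ i) (M i))"
  let ?E = "\<lambda>L. slice T (\<lambda>i. face_part (C i) (M i) (L i)) q"
  note mem = mem_conjunction_images[of T q _ _ M, OF T q]
  note BL = conjunction_subset_lift[of T q M C, OF T q M]
  have D: "polyhedral_cone ?D"
  proof -
    have pc: "polyhedral_cone (cone_image (T i ** q $ i) (C i))" for i
      by (rule polyhedral_cone_image[OF dual_mul_orthogonal(1)[OF T q] C])
    show ?thesis
      by (rule polyhedral_cone_Inter(1)[of "\<lambda>i. cone_image (T i ** q $ i) (C i)", OF pc])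
  qed
  have MC: "a \<in> C i" if "(a, b) \<in> M i" for a b i using that M[of i] by (auto simp: biconic_lift_def)
  have "{x + z |x z. (x, z) \<in> ?N \<and> dim (face_span ?D x) = k} = (\<Union>L\<in>face_tuples C m. ?E L)"
  proof (intro set_eqI iffI)
    fix g assume "g \<in> {x + z |x z. (x, z) \<in> ?N \<and> dim (face_span ?D x) = k}"
    then obtain x z where g: "g = x + z" "(x, z) \<in> ?N" "dim (face_span ?D x) = k" by blast
    from g(2) obtain a b where z: "z = (\<Sum>j\<in>UNIV. dual (T j) *v (q $ j *v b j))"
      and x: "\<And>i. x = T i *v (q $ i *v a i)" and ab: "\<And>i. (a i, b i) \<in> M i"
      unfolding mem by blast
    let ?L = "\<lambda>i. face_span (C i) (a i)"
    have L: "?L i \<in> face_span (C i) ` C i" for i using MC[OF ab] by simp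
    have "dim (\<Inter>i. (\<lambda>y. T i *v (q $ i *v y)) ` ?L i) = k"
      using g(3) face_span_intersection[of C T q x a, OF C T q x MC[OF ab]] by simp
    then have "?L \<in> face_tuples C m" using dim[of ?L, OF L] L by (simp add: face_tuples_def)
    moreover have "g \<in> ?E ?L"
      unfolding slice_def g(1) z
    proof (intro CollectI exI conjI allI)
      show "x = T i *v (q $ i *v a i)" for i by (rule x)
      show "(a i, b i) \<in> face_part (C i) (M i) (?L i)" for i using ab by (simp add: face_part_def)
    qed (rule refl)
    ultimately show "g \<in> (\<Union>L\<in>face_tuples C m. ?E L)" by (rule UN_I[where B="?E"])
  next
    fix g assume "g \<in> (\<Union>L\<in>face_tuples C m. ?E L)"
    then obtain L where L: "L \<in> face_tuples C m" and gE: "g \<in> ?E L" by (rule UN_E)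
    from gE obtain x a b where g: "g = x + (\<Sum>j\<in>UNIV. dual (T j) *v (q $ j *v b j))"
      and x: "\<And>i. x = T i *v (q $ i *v a i)" and ab: "\<And>i. (a i, b i) \<in> face_part (C i) (M i) (L i)"
      unfolding slice_def by blast
    have abM: "(a i, b i) \<in> M i" "face_span (C i) (a i) = L i" for i using ab[of i] by (simp_all add: face_part_def)
    have "(x, \<Sum>j\<in>UNIV. dual (T j) *v (q $ j *v b j)) \<in> ?N"
      unfolding mem using x abM(1) by blast
    moreover have "dim (face_span ?D x) = k"
      unfolding face_span_intersection[of C T q x a, OF C T q x MC[OF abM(1)]] abM(2)
      using dim[of L] L by (simp add: face_tuples_def)
    ultimately show "g \<in> {x + z |x z. (x, z) \<in> ?N \<and> dim (face_span ?D x) = k}" unfolding g by blast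
  qed
  moreover have "disjoint_family_on ?E (face_tuples C m)"
  proof (rule disjoint_family_on_labelled)
    fix L g assume gE: "g \<in> ?E L"
    from gE obtain x a b where g: "g = x + (\<Sum>j\<in>UNIV. dual (T j) *v (q $ j *v b j))"
      and x: "\<And>i. x = T i *v (q $ i *v a i)" and ab: "\<And>i. (a i, b i) \<in> face_part (C i) (M i) (L i)"
      unfolding slice_def by blast
    have abM: "(a i, b i) \<in> M i" "face_span (C i) (a i) = L i" for i using ab[of i] by (simp_all add: face_part_def)
    have "(x, \<Sum>j\<in>UNIV. dual (T j) *v (q $ j *v b j)) \<in> ?N"
      unfolding mem using x abM(1) by blast
    then have cp: "closest_point ?D g = x"
      unfolding g using BL by (intro moreau_unique(1) convex_polyhedral_cone closed_polyhedral_cone D) (rule subsetD)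
    have "matrix_inv (T i ** q $ i) *v x = a i" for i
      unfolding x[of i]
      by (simp add: matrix_vector_mul_assoc matrix_inv_left[OF dual_mul_orthogonal(1)[OF T q]] matrix_mul_assoc[symmetric])
    then show "(\<lambda>i. face_span (C i) (matrix_inv (T i ** q $ i) *v closest_point ?D g)) = L"
      unfolding cp using abM(2) by simp
  qed
  ultimately show ?thesis
    unfolding support_measure_eq[OF D BL]
    using finite_face_tuples[of C m, OF C] borel by (simp add: measure_completion_finite_UN)
qed

section \<open>The kinematic formula for polyhedral cones\<close>

text \<open>Almost surely the support measure of the intersection is the sum of the Gaussian measures of the slices. By Fubini the
  expectation of each summand is the probability of an event for \<open>(q, g)\<close>, and \<open>kinematic_formula_subspaces\<close> identifies it with
  the contribution of the same tuple to the product.\<close>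
lemma (in right_invariant_rotations) expected_support_measure_intersection:
  fixes C :: "'n \<Rightarrow> (real^'d) set" and T :: "'n \<Rightarrow> real^'d^'d"
  assumes C: "\<And>i. polyhedral_cone (C i)" and M: "\<And>i. M i \<in> biconic_sets" "\<And>i. M i \<subseteq> biconic_lift (C i)"
    and T: "\<And>i. invertible (T i)" and k: "0 < k" and m: "m + CARD('d) = CARD('n) * CARD('d) + k"
  obtains h where "has_bochner_integral \<nu> h (support_measure m (cone_product C) (biconic_product M))"
    and "AE q in \<nu>. support_measure k (\<Inter>i. cone_image (T i ** q $ i) (C i))
      (conjunction (\<lambda>i. biconic_image (T i ** q $ i) (M i))) = h q"
proof
  let ?A = "\<lambda>L i. face_part (C i) (M i) (L i)"
  \<comment> \<open>the event that the solution for the tuple \<open>L\<close> lies in the face parts; its section at \<open>q\<close> is the slice\<close>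
  define E where "E L = {w. \<forall>i. (fst (solution T L w) $ i, snd (solution T L w) $ i) \<in> ?A L i}" for L
  define h where "h q = (\<Sum>L\<in>face_tuples C m. measure std_gaussian (Pair q -` E L))" for q
  have sub: "subspace (L i)" if "\<And>i. L i \<in> face_span (C i) ` C i" for L i
    using that[of i] subspace_face_span[OF C] by auto
  have L: "subspace (L i)" if "L \<in> face_tuples C m" for L i
    using that sub by (simp add: face_tuples_def)
  have codim: "(\<Sum>i\<in>UNIV. dim ((L i)\<^sup>\<bottom>)) < CARD('d)" if "L \<in> face_tuples C m" for L
  proof -
    have "(\<Sum>i\<in>UNIV. dim ((L i)\<^sup>\<bottom>) + dim (L i)) = CARD('n) * CARD('d)"
      by (simp add: dim_orthogonal_comp[OF L[OF that]])
    then have "(\<Sum>i\<in>UNIV. dim ((L i)\<^sup>\<bottom>)) + m = CARD('n) * CARD('d)"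
      using that by (simp add: sum.distrib face_tuples_def)
    then show ?thesis using m k by linarith
  qed
  note A = face_part_biconic[OF C M]
  note kinematic = kinematic_formula_subspaces[of T _ "\<lambda>i. ?A _ i", OF T L codim A(1) A(2) A(3)]
  have E: "E L \<in> sets (\<nu> \<Otimes>\<^sub>M std_gaussian)" if "L \<in> face_tuples C m" for L
    unfolding E_def sets_pair by (rule kinematic(1)[OF that that])
  show "has_bochner_integral \<nu> h (support_measure m (cone_product C) (biconic_product M))"
    unfolding h_def support_measure_product_eq_sum_tuples[of C M m, OF C M]
  proof (rule has_bochner_integral_sum)
    fix L assume LK: "L \<in> face_tuples C m"
    let ?r = "measure std_gaussian {x + z |x z. \<forall>i. (x $ i, z $ i) \<in> ?A L i}"
    have meas: "(\<lambda>q. emeasure std_gaussian (Pair q -` E L)) \<in> borel_measurable \<nu>"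
      by (rule std_gaussian.measurable_emeasure_Pair[OF E[OF LK]])
    show "has_bochner_integral \<nu> (\<lambda>q. measure std_gaussian (Pair q -` E L)) ?r"
    proof (rule has_bochner_integral_nn_integral)
      show "(\<lambda>q. measure std_gaussian (Pair q -` E L)) \<in> borel_measurable \<nu>"
        unfolding measure_def using meas by measurable
      have "(\<integral>\<^sup>+q. ennreal (measure std_gaussian (Pair q -` E L)) \<partial>\<nu>) = (\<integral>\<^sup>+q. emeasure std_gaussian (Pair q -` E L) \<partial>\<nu>)"
        by (simp add: std_gaussian.emeasure_eq_measure)
      also have "\<dots> = emeasure (\<nu> \<Otimes>\<^sub>M std_gaussian) (E L)"
        by (rule std_gaussian.emeasure_pair_measure_alt[OF E[OF LK], symmetric])
      also have "\<dots> = emeasure std_gaussian {x + z |x z. \<forall>i. (x $ i, z $ i) \<in> ?A L i}"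
        unfolding E_def by (rule kinematic(2)[OF LK LK])
      finally show "(\<integral>\<^sup>+q. ennreal (measure std_gaussian (Pair q -` E L)) \<partial>\<nu>) = ennreal ?r"
        by (simp add: std_gaussian.emeasure_eq_measure)
    qed simp_all
  qed
  have generic: "AE q in \<nu>. \<forall>L\<in>face_tuples C m. generic T L q"
    by (rule AE_finite_allI[OF finite_face_tuples[of C m, OF C]], rule AE_generic[OF T])
      (use codim in \<open>simp add: less_imp_le\<close>)
  have finite_all: "finite (PiE UNIV (\<lambda>i. face_span (C i) ` C i))"
    by (rule finite_PiE) (auto intro: finite_face_spans C)
  have "AE q in \<nu>. \<forall>L\<in>PiE UNIV (\<lambda>i. face_span (C i) ` C i).
      dim (\<Inter>i. (\<lambda>y. T i *v (q $ i *v y)) ` L i) = k \<longleftrightarrow> (\<Sum>i\<in>UNIV. dim (L i)) = m"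
  proof (rule AE_finite_allI[OF finite_all])
    fix L assume "L \<in> PiE UNIV (\<lambda>i. face_span (C i) ` C i)"
    then have "subspace (L i)" for i by (intro sub) (simp add: PiE_iff)
    then have "AE q in \<nu>. dim (\<Inter>i. (\<lambda>y. T i *v (q $ i *v y)) ` L i) = k \<longleftrightarrow>
        (\<Sum>i\<in>UNIV. dim (L i)) + CARD('d) = CARD('n) * CARD('d) + k"
      by (rule AE_dim_Inter[of T L k, OF T _ k])
    then show "AE q in \<nu>. dim (\<Inter>i. (\<lambda>y. T i *v (q $ i *v y)) ` L i) = k \<longleftrightarrow> (\<Sum>i\<in>UNIV. dim (L i)) = m"
      unfolding m[symmetric] by simp
  qed
  with generic show "AE q in \<nu>. support_measure k (\<Inter>i. cone_image (T i ** q $ i) (C i))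
      (conjunction (\<lambda>i. biconic_image (T i ** q $ i) (M i))) = h q"
    using AE_orthogonal
  proof eventually_elim
    case (elim q)
    have slice: "slice T (?A L) q = Pair q -` E L" if LK: "L \<in> face_tuples C m" for L
    proof -
      have "generic T L q" using elim(1) LK by blast
      from solution_slice[of T L q "?A L", OF T L[OF LK] this A(3)] show ?thesis
        unfolding E_def by auto
    qed
    have "support_measure k (\<Inter>i. cone_image (T i ** q $ i) (C i)) (conjunction (\<lambda>i. biconic_image (T i ** q $ i) (M i)))
      = (\<Sum>L\<in>face_tuples C m. measure std_gaussian (slice T (?A L) q))"
    proof (rule support_measure_intersection_eq_sum_tuples[of C M T q k m, OF C M(2) T])
      show "orthogonal_matrix (q $ i)" for i using elim(3) by blast
      show "dim (\<Inter>i. (\<lambda>y. T i *v (q $ i *v y)) ` L i) = k \<longleftrightarrow> (\<Sum>i\<in>UNIV. dim (L i)) = m"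
        if "\<And>i. L i \<in> face_span (C i) ` C i" for L
        using elim(2) that by (auto simp: PiE_iff)
      show "slice T (?A L) q \<in> sets borel" if LK: "L \<in> face_tuples C m" for L
        using sets_Pair1[OF E[OF LK], of q] unfolding slice[OF LK] by simp
    qed
    also have "\<dots> = h q" unfolding h_def by (rule sum.cong[OF refl]) (simp add: slice)
    finally show ?case .
  qed
qed

lemma has_bochner_integral_completion_AE:
  fixes f :: "'a \<Rightarrow> real"
  assumes g: "has_bochner_integral M g r" and AE: "AE x in M. f x = g x"
  shows "has_bochner_integral (completion M) f r"
proof -
  have gM: "g \<in> borel_measurable M" by (rule borel_measurable_has_bochner_integral[OF g])
  show ?thesis
  proof (rule has_bochner_integralI_AE)
    show "has_bochner_integral (completion M) g r"
      using g gM by (simp add: has_bochner_integral_iff integrable_completion integral_completion)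
    show "f \<in> borel_measurable (completion M)" by (rule borel_measurable_completion_AE[OF gM AE]) simp
    show "AE x in completion M. g x = f x" using AE by (intro AE_completion) (auto elim: eventually_mono)
  qed
qed

theorem theorem3p8:
  fixes C :: "'n::finite \<Rightarrow> (real^'d) set"
    and M :: "'n \<Rightarrow> ((real^'d) \<times> (real^'d)) set"
    and T :: "'n \<Rightarrow> real^'d^'d"
    and Q :: "'n \<Rightarrow> 'w \<Rightarrow> real^'d^'d"
    and P :: "'w measure"
    and n k :: nat
  assumes "CARD('n) = n + 1"
    and "\<And>i. polyhedral_cone (C i)"
    and "\<And>i. M i \<in> biconic_sets"
    and "\<And>i. M i \<subseteq> biconic_lift (C i)"
    and "\<And>i. invertible (T i)"
    and "0 < k" and "k \<le> CARD('d)"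
    and "prob_space P"
    and "prob_space.indep_vars P (\<lambda>_. orthogonal_borel) Q UNIV"
    and "\<And>i. normalized_haar (distr P orthogonal_borel (Q i))"
  shows "has_bochner_integral (completion P)
           (\<lambda>\<omega>. support_measure k (\<Inter>i. cone_image (T i ** Q i \<omega>) (C i))
                  (conjunction (\<lambda>i. biconic_image (T i ** Q i \<omega>) (M i))))
           (support_measure (n * CARD('d) + k) (cone_product C) (biconic_product M)) \<and>
         (\<forall>m \<le> (n + 1) * CARD('d).
           support_measure m (cone_product C) (biconic_product M) =
             (\<Sum>j | (\<forall>i. j i \<le> CARD('d)) \<and> (\<Sum>i\<in>UNIV. j i) = m.
                \<Prod>i\<in>UNIV. support_measure (j i) (C i) (M i)))"
proof (intro conjI allI impI)
  interpret P: prob_space P by fact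
  define X where "X = (\<lambda>\<omega>. \<chi> i. Q i \<omega>)"
  interpret right_invariant_rotations "distr P borel X"
    unfolding X_def by (rule joint_haar_right_invariant[OF assms(8-10)])
  have "Q i \<in> borel_measurable P" for i
    using assms(9) unfolding P.indep_vars_def orthogonal_borel_def by (auto simp: measurable_restrict_space2_iff)
  then have X: "X \<in> borel_measurable P" unfolding X_def by measurable
  have m: "n * CARD('d) + k + CARD('d) = CARD('n) * CARD('d) + k" using assms(1) by simp
  obtain h where h: "has_bochner_integral (distr P borel X) h
      (support_measure (n * CARD('d) + k) (cone_product C) (biconic_product M))"
    and ae: "AE q in distr P borel X. support_measure k (\<Inter>i. cone_image (T i ** q $ i) (C i))
      (conjunction (\<lambda>i. biconic_image (T i ** q $ i) (M i))) = h q"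
    by (rule expected_support_measure_intersection[of C M T k "n * CARD('d) + k", OF assms(2-6) m])
  have hm: "h \<in> borel_measurable borel"
    using borel_measurable_has_bochner_integral[OF h] by simp
  show "has_bochner_integral (completion P)
      (\<lambda>\<omega>. support_measure k (\<Inter>i. cone_image (T i ** Q i \<omega>) (C i))
        (conjunction (\<lambda>i. biconic_image (T i ** Q i \<omega>) (M i))))
      (support_measure (n * CARD('d) + k) (cone_product C) (biconic_product M))"
  proof (rule has_bochner_integral_completion_AE)
    show "has_bochner_integral P (\<lambda>\<omega>. h (X \<omega>)) (support_measure (n * CARD('d) + k) (cone_product C) (biconic_product M))"
      using h by (simp add: has_bochner_integral_iff integrable_distr_eq[OF X hm] integral_distr[OF X hm])
    show "AE \<omega> in P. support_measure k (\<Inter>i. cone_image (T i ** Q i \<omega>) (C i))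
        (conjunction (\<lambda>i. biconic_image (T i ** Q i \<omega>) (M i))) = h (X \<omega>)"
      using AE_distrD[OF X ae] by (simp add: X_def)
  qed
next
  fix m
  show "support_measure m (cone_product C) (biconic_product M) =
      (\<Sum>j | (\<forall>i. j i \<le> CARD('d)) \<and> (\<Sum>i\<in>UNIV. j i) = m. \<Prod>i\<in>UNIV. support_measure (j i) (C i) (M i))"
    by (rule support_measure_product[of C M m, OF assms(2-4)])
qed

end
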